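(* Let $\mathcal{A}$ be a locally noetherian Grothendieck category. Then the map $\mathrm{InjSpec}(\mathcal{A})\to\mathrm{TorSpec}(\mathcal{A})$, $E\mapsto\mathcal{F}(E)$, is a (well-defined) homeomorphism.
   Context: A Grothendieck category is locally noetherian if it has a generating set of noetherian objects. $\mathcal{A}^{\mathrm{fp}}$ is the full subcategory of finitely presented objects; $(A,E)$ is the group of morphisms $A\to E$. $\mathrm{InjSpec}(\mathcal{A})$ is the set of isomorphism classes of indecomposable injective objects of $\mathcal{A}$, with the (Zariski) topology having as basis of open sets the sets $[A]=\{E:(A,E)=0\}$ for $A\in\mathcal{A}^{\mathrm{fp}}$. A (hereditary) torsion theory in $\mathcal{A}$ is a pair $(\mathcal{T},\mathcal{F})$ of classes of objects with no non-zero maps from objects of $\mathcal{T}$ to objects of $\mathcal{F}$, both maximal with this property, and with the torsion class $\mathcal{T}$ closed under subobjects (equivalently, the torsionfree class $\mathcal{F}$ closed under injective hulls). Each of $\mathcal{T}$ and $\mathcal{F}$ determines the other, so a torsion theory is identified with its torsionfree class; objects of $\mathcal{T}$ are called $\mathcal{F}$-torsion. $\mathcal{T}(A)$ (resp. $\mathcal{F}(A)$) is the smallest torsion class (resp. torsionfree class) containing $A$. A non-zero object $A$ is torsion-critical if every proper quotient of $A$ (by a non-zero subobject) is $\mathcal{F}(A)$-torsion. A torsion theory is prime if its torsionfree class is $\mathcal{F}(A)$ for some torsion-critical $A$. $\mathrm{TorSpec}(\mathcal{A})$ is the set of prime torsion theories, with the topology having as basis of open sets the sets $[\mathcal{T}(A)]$,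 $A\in\mathcal{A}^{\mathrm{fp}}$, where for a torsion class $\mathcal{T}$, $[\mathcal{T}]$ denotes the set of prime torsion theories whose torsion class contains $\mathcal{T}$. *)

theory Defs
  imports "HOL-Analysis.Abstract_Topology" "HOL-Algebra.Group"
begin

unbundle cardinal_syntax

section \<open>Preadditive and abelian categories\<close>

text \<open>Composition is in the usual order: in \<open>g \<cdot>\<^bsub>C\<^esub> f\<close> the arrow \<open>f\<close> comes first.
  \<open>Zero C A B\<close> and \<open>Add C\<close> are the group operations on the morphisms from \<open>A\<close> to \<open>B\<close>.\<close>

record ('o, 'm) category =
  Ob :: "'o set"
  Arr :: "'m set"
  Dom :: "'m \<Rightarrow> 'o"
  Cod :: "'m \<Rightarrow> 'o"
  Ident :: "'o \<Rightarrow> 'm"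
  Comp :: "'m \<Rightarrow> 'm \<Rightarrow> 'm"  (infixl \<open>\<cdot>\<index>\<close> 70)
  Zero :: "'o \<Rightarrow> 'o \<Rightarrow> 'm"
  Add :: "'m \<Rightarrow> 'm \<Rightarrow> 'm"

definition Hom :: "('o, 'm) category \<Rightarrow> 'o \<Rightarrow> 'o \<Rightarrow> 'm set" where
  "Hom C A B = {f \<in> Arr C. Dom C f = A \<and> Cod C f = B}"

definition Hom_group :: "('o, 'm) category \<Rightarrow> 'o \<Rightarrow> 'o \<Rightarrow> 'm monoid" where
  "Hom_group C A B = \<lparr>carrier = Hom C A B, monoid.mult = Add C, one = Zero C A B\<rparr>"

locale preadditive_category =
  fixes C :: "('o, 'm) category" (structure)
  assumes Dom_in_Ob: "f \<in> Arr C \<Longrightarrow> Dom C f \<in> Ob C"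
    and Cod_in_Ob: "f \<in> Arr C \<Longrightarrow> Cod C f \<in> Ob C"
    and Ident_in_Hom: "A \<in> Ob C \<Longrightarrow> Ident C A \<in> Hom C A A"
    and Comp_in_Hom: "\<lbrakk>f \<in> Hom C A B; g \<in> Hom C B D\<rbrakk> \<Longrightarrow> g \<cdot> f \<in> Hom C A D"
    and Comp_Ident_right: "f \<in> Hom C A B \<Longrightarrow> f \<cdot> Ident C A = f"
    and Comp_Ident_left: "f \<in> Hom C A B \<Longrightarrow> Ident C B \<cdot> f = f"
    and Comp_assoc: "\<lbrakk>f \<in> Hom C A B; g \<in> Hom C B D; h \<in> Hom C D E\<rbrakk>
      \<Longrightarrow> h \<cdot> (g \<cdot> f) = (h \<cdot> g) \<cdot> f"
    and Hom_comm_group: "\<lbrakk>A \<in> Ob C; B \<in> Ob C\<rbrakk> \<Longrightarrow> comm_group (Hom_group C A B)"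
    and Comp_Add_right: "\<lbrakk>f \<in> Hom C A B; f' \<in> Hom C A B; g \<in> Hom C B D\<rbrakk>
      \<Longrightarrow> g \<cdot> Add C f f' = Add C (g \<cdot> f) (g \<cdot> f')"
    and Comp_Add_left: "\<lbrakk>f \<in> Hom C A B; g \<in> Hom C B D; g' \<in> Hom C B D\<rbrakk>
      \<Longrightarrow> Add C g g' \<cdot> f = Add C (g \<cdot> f) (g' \<cdot> f)"

definition monic :: "('o, 'm) category \<Rightarrow> 'm \<Rightarrow> bool" where
  "monic C m \<longleftrightarrow> m \<in> Arr C \<and>
     (\<forall>X. \<forall>f \<in> Hom C X (Dom C m). \<forall>g \<in> Hom C X (Dom C m). m \<cdot>\<^bsub>C\<^esub> f = m \<cdot>\<^bsub>C\<^esub> g \<longrightarrow> f = g)"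

definition epic :: "('o, 'm) category \<Rightarrow> 'm \<Rightarrow> bool" where
  "epic C e \<longleftrightarrow> e \<in> Arr C \<and>
     (\<forall>X. \<forall>f \<in> Hom C (Cod C e) X. \<forall>g \<in> Hom C (Cod C e) X. f \<cdot>\<^bsub>C\<^esub> e = g \<cdot>\<^bsub>C\<^esub> e \<longrightarrow> f = g)"

definition isomorphic :: "('o, 'm) category \<Rightarrow> 'o \<Rightarrow> 'o \<Rightarrow> bool" where
  "isomorphic C A B \<longleftrightarrow> A \<in> Ob C \<and> B \<in> Ob C \<and>
     (\<exists>f \<in> Hom C A B. \<exists>g \<in> Hom C B A. g \<cdot>\<^bsub>C\<^esub> f = Ident C A \<and> f \<cdot>\<^bsub>C\<^esub> g = Ident C B)"

definition zero_object :: "('o, 'm) category \<Rightarrow> 'o \<Rightarrow> bool" where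
  "zero_object C Z \<longleftrightarrow> Z \<in> Ob C \<and>
     (\<forall>A \<in> Ob C. (\<exists>!f. f \<in> Hom C A Z) \<and> (\<exists>!f. f \<in> Hom C Z A))"

definition is_kernel :: "('o, 'm) category \<Rightarrow> 'm \<Rightarrow> 'm \<Rightarrow> bool" where
  "is_kernel C k f \<longleftrightarrow> k \<in> Arr C \<and> f \<in> Arr C \<and> Cod C k = Dom C f \<and>
     f \<cdot>\<^bsub>C\<^esub> k = Zero C (Dom C k) (Cod C f) \<and>
     (\<forall>X \<in> Ob C. \<forall>g \<in> Hom C X (Dom C f). f \<cdot>\<^bsub>C\<^esub> g = Zero C X (Cod C f) \<longrightarrow>
        (\<exists>!u. u \<in> Hom C X (Dom C k) \<and> k \<cdot>\<^bsub>C\<^esub> u = g))"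

definition is_cokernel :: "('o, 'm) category \<Rightarrow> 'm \<Rightarrow> 'm \<Rightarrow> bool" where
  "is_cokernel C c f \<longleftrightarrow> c \<in> Arr C \<and> f \<in> Arr C \<and> Dom C c = Cod C f \<and>
     c \<cdot>\<^bsub>C\<^esub> f = Zero C (Dom C f) (Cod C c) \<and>
     (\<forall>X \<in> Ob C. \<forall>g \<in> Hom C (Cod C f) X. g \<cdot>\<^bsub>C\<^esub> f = Zero C (Dom C f) X \<longrightarrow>
        (\<exists>!u. u \<in> Hom C (Cod C c) X \<and> u \<cdot>\<^bsub>C\<^esub> c = g))"

text \<open>\<open>0 \<rightarrow> A \<rightarrow> B \<rightarrow> D \<rightarrow> 0\<close> is exact.\<close>

definition short_exact :: "('o, 'm) category \<Rightarrow> 'm \<Rightarrow> 'm \<Rightarrow> bool" where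
  "short_exact C f g \<longleftrightarrow> is_kernel C f g \<and> is_cokernel C g f"

text \<open>The object \<open>S\<close> is the direct sum of \<open>A\<close> and \<open>B\<close>; the equations \<open>p \<cdot> j = 0\<close> and
  \<open>q \<cdot> i = 0\<close> follow from the stated ones.\<close>

definition is_biproduct :: "('o, 'm) category \<Rightarrow> 'o \<Rightarrow> 'o \<Rightarrow> 'o \<Rightarrow> bool" where
  "is_biproduct C A B S \<longleftrightarrow> A \<in> Ob C \<and> B \<in> Ob C \<and> S \<in> Ob C \<and>
     (\<exists>i \<in> Hom C A S. \<exists>j \<in> Hom C B S. \<exists>p \<in> Hom C S A. \<exists>q \<in> Hom C S B.
        p \<cdot>\<^bsub>C\<^esub> i = Ident C A \<and> q \<cdot>\<^bsub>C\<^esub> j = Ident C B \<and>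
        Add C (i \<cdot>\<^bsub>C\<^esub> p) (j \<cdot>\<^bsub>C\<^esub> q) = Ident C S)"

locale abelian_category = preadditive_category +
  assumes ex_zero_object: "\<exists>Z. zero_object C Z"
    and ex_biproduct: "\<lbrakk>A \<in> Ob C; B \<in> Ob C\<rbrakk> \<Longrightarrow> \<exists>S. is_biproduct C A B S"
    and ex_kernel: "f \<in> Arr C \<Longrightarrow> \<exists>k. is_kernel C k f"
    and ex_cokernel: "f \<in> Arr C \<Longrightarrow> \<exists>c. is_cokernel C c f"
    and monic_normal: "monic C m \<Longrightarrow> \<exists>f. is_kernel C m f"
    and epic_normal: "epic C e \<Longrightarrow> \<exists>f. is_cokernel C e f"


section \<open>Small coproducts and direct limits\<close>

text \<open>Smallness is relative to a type \<open>'u\<close> that plays the role of a universe: a set is small if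
  its cardinality is less than that of \<open>'u\<close>, and the cardinality of \<open>'u\<close> is a regular uncountable
  cardinal. When that cardinal is strongly inaccessible, these are (up to bijection) the small
  sets of the corresponding Grothendieck universe. Strong inaccessibility is not demanded,
  because no HOL type can be proved to have this property.\<close>

definition universe_type :: "'u itself \<Rightarrow> bool" where
  "universe_type U \<longleftrightarrow> natLeq <o |UNIV :: 'u set| \<and> regularCard |UNIV :: 'u set|"

definition small :: "'u itself \<Rightarrow> 'a set \<Rightarrow> bool" where
  "small U X \<longleftrightarrow> |X| <o |UNIV :: 'u set|"

definition is_coproduct ::
    "('o, 'm) category \<Rightarrow> 'i set \<Rightarrow> ('i \<Rightarrow> 'o) \<Rightarrow> 'o \<Rightarrow> ('i \<Rightarrow> 'm) \<Rightarrow> bool" where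
  "is_coproduct C I D S \<iota> \<longleftrightarrow> S \<in> Ob C \<and> (\<forall>i \<in> I. \<iota> i \<in> Hom C (D i) S) \<and>
     (\<forall>X \<in> Ob C. \<forall>f. (\<forall>i \<in> I. f i \<in> Hom C (D i) X) \<longrightarrow>
        (\<exists>!u. u \<in> Hom C S X \<and> (\<forall>i \<in> I. u \<cdot>\<^bsub>C\<^esub> \<iota> i = f i)))"

definition directed_set :: "'i set \<Rightarrow> ('i \<Rightarrow> 'i \<Rightarrow> bool) \<Rightarrow> bool" where
  "directed_set I lq \<longleftrightarrow> I \<noteq> {} \<and> (\<forall>i \<in> I. lq i i) \<and>
     (\<forall>i \<in> I. \<forall>j \<in> I. \<forall>k \<in> I. lq i j \<and> lq j k \<longrightarrow> lq i k) \<and>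
     (\<forall>i \<in> I. \<forall>j \<in> I. \<exists>k \<in> I. lq i k \<and> lq j k)"

definition directed_system :: "('o, 'm) category \<Rightarrow>
    'i set \<Rightarrow> ('i \<Rightarrow> 'i \<Rightarrow> bool) \<Rightarrow> ('i \<Rightarrow> 'o) \<Rightarrow> ('i \<Rightarrow> 'i \<Rightarrow> 'm) \<Rightarrow> bool" where
  "directed_system C I lq D d \<longleftrightarrow> directed_set I lq \<and> (\<forall>i \<in> I. D i \<in> Ob C) \<and>
     (\<forall>i \<in> I. \<forall>j \<in> I. lq i j \<longrightarrow> d i j \<in> Hom C (D i) (D j)) \<and>
     (\<forall>i \<in> I. d i i = Ident C (D i)) \<and>
     (\<forall>i \<in> I. \<forall>j \<in> I. \<forall>k \<in> I. lq i j \<and> lq j k \<longrightarrow> d j k \<cdot>\<^bsub>C\<^esub> d i j = d i k)"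

definition is_direct_limit :: "('o, 'm) category \<Rightarrow>
    'i set \<Rightarrow> ('i \<Rightarrow> 'i \<Rightarrow> bool) \<Rightarrow> ('i \<Rightarrow> 'o) \<Rightarrow> ('i \<Rightarrow> 'i \<Rightarrow> 'm) \<Rightarrow> 'o \<Rightarrow> ('i \<Rightarrow> 'm) \<Rightarrow> bool" where
  "is_direct_limit C I lq D d L l \<longleftrightarrow> L \<in> Ob C \<and> (\<forall>i \<in> I. l i \<in> Hom C (D i) L) \<and>
     (\<forall>i \<in> I. \<forall>j \<in> I. lq i j \<longrightarrow> l j \<cdot>\<^bsub>C\<^esub> d i j = l i) \<and>
     (\<forall>X \<in> Ob C. \<forall>f. (\<forall>i \<in> I. f i \<in> Hom C (D i) X) \<and>
          (\<forall>i \<in> I. \<forall>j \<in> I. lq i j \<longrightarrow> f j \<cdot>\<^bsub>C\<^esub> d i j = f i) \<longrightarrow>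
        (\<exists>!u. u \<in> Hom C L X \<and> (\<forall>i \<in> I. u \<cdot>\<^bsub>C\<^esub> l i = f i)))"

definition system_morphism :: "('o, 'm) category \<Rightarrow> 'i set \<Rightarrow> ('i \<Rightarrow> 'i \<Rightarrow> bool) \<Rightarrow>
    ('i \<Rightarrow> 'o) \<Rightarrow> ('i \<Rightarrow> 'i \<Rightarrow> 'm) \<Rightarrow> ('i \<Rightarrow> 'o) \<Rightarrow> ('i \<Rightarrow> 'i \<Rightarrow> 'm) \<Rightarrow> ('i \<Rightarrow> 'm) \<Rightarrow> bool" where
  "system_morphism C I lq D d E e f \<longleftrightarrow> (\<forall>i \<in> I. f i \<in> Hom C (D i) (E i)) \<and>
     (\<forall>i \<in> I. \<forall>j \<in> I. lq i j \<longrightarrow> e i j \<cdot>\<^bsub>C\<^esub> f i = f j \<cdot>\<^bsub>C\<^esub> d i j)"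

definition has_small_coproducts :: "'u itself \<Rightarrow> ('o, 'm) category \<Rightarrow> bool" where
  "has_small_coproducts U C \<longleftrightarrow> (\<forall>(I :: 'u set) D. small U I \<and> (\<forall>i \<in> I. D i \<in> Ob C) \<longrightarrow>
     (\<exists>S \<iota>. is_coproduct C I D S \<iota>))"

text \<open>A direct limit of short exact sequences over a small directed set is exact; \<open>u\<close> and \<open>v\<close>
  are the induced maps between the direct limits.\<close>

definition exact_direct_limits :: "'u itself \<Rightarrow> ('o, 'm) category \<Rightarrow> bool" where
  "exact_direct_limits U C \<longleftrightarrow>
     (\<forall>(I :: 'u set) lq D d E e F f \<alpha> \<beta> L l M m N n u v.
        small U I \<and>
        directed_system C I lq D d \<and> directed_system C I lq E e \<and> directed_system C I lq F f \<and>
        system_morphism C I lq D d E e \<alpha> \<and> system_morphism C I lq E e F f \<beta> \<and>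
        (\<forall>i \<in> I. short_exact C (\<alpha> i) (\<beta> i)) \<and>
        is_direct_limit C I lq D d L l \<and> is_direct_limit C I lq E e M m \<and>
        is_direct_limit C I lq F f N n \<and>
        u \<in> Hom C L M \<and> (\<forall>i \<in> I. u \<cdot>\<^bsub>C\<^esub> l i = m i \<cdot>\<^bsub>C\<^esub> \<alpha> i) \<and>
        v \<in> Hom C M N \<and> (\<forall>i \<in> I. v \<cdot>\<^bsub>C\<^esub> m i = n i \<cdot>\<^bsub>C\<^esub> \<beta> i) \<longrightarrow>
        short_exact C u v)"

definition generating :: "('o, 'm) category \<Rightarrow> 'o set \<Rightarrow> bool" where
  "generating C G \<longleftrightarrow> G \<subseteq> Ob C \<and>
     (\<forall>A B. \<forall>f \<in> Hom C A B. \<forall>g \<in> Hom C A B. f \<noteq> g \<longrightarrow>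
        (\<exists>X \<in> G. \<exists>h \<in> Hom C X A. f \<cdot>\<^bsub>C\<^esub> h \<noteq> g \<cdot>\<^bsub>C\<^esub> h))"

text \<open>Generating sets are small. Local smallness is required only of the morphisms out of the
  generators. If the cardinality of \<open>'u\<close> is strongly inaccessible, then it follows for all
  morphisms: \<open>Hom C A B\<close> embeds into the product of the sets \<open>Hom C X B\<close> over all \<open>X\<close> in \<open>G\<close> and
  all elements of \<open>Hom C X A\<close>. So in that case this is the usual notion of a Grothendieck
  category, and for other regular cardinals it is a more general one; for instance, the countable
  abelian groups form such a category when \<open>'u\<close> has cardinality \<open>\<aleph>\<^sub>1\<close>. To require all \<open>Hom C A B\<close>
  to be small would force the cardinality of \<open>'u\<close> to be strongly inaccessible as soon as \<open>C\<close> has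
  a non-zero object, since \<open>Hom C (A\<^sup>(\<^sup>I\<^sup>)) A\<close> is the power \<open>(Hom C A A)\<^sup>I\<close>.\<close>

definition grothendieck_category :: "'u itself \<Rightarrow> ('o, 'm) category \<Rightarrow> bool" where
  "grothendieck_category U C \<longleftrightarrow> abelian_category C \<and>
     has_small_coproducts U C \<and> exact_direct_limits U C \<and>
     (\<exists>G. small U G \<and> generating C G \<and> (\<forall>X \<in> G. \<forall>A \<in> Ob C. small U (Hom C X A)))"


section \<open>Noetherian, finitely presented and injective objects\<close>

text \<open>Subobjects are represented by monomorphisms, ordered by factorization.\<close>

definition sub_le :: "('o, 'm) category \<Rightarrow> 'm \<Rightarrow> 'm \<Rightarrow> bool" where
  "sub_le C m n \<longleftrightarrow> (\<exists>h \<in> Hom C (Dom C m) (Dom C n). n \<cdot>\<^bsub>C\<^esub> h = m)"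

definition noetherian_object :: "('o, 'm) category \<Rightarrow> 'o \<Rightarrow> bool" where
  "noetherian_object C A \<longleftrightarrow> A \<in> Ob C \<and>
     (\<forall>m :: nat \<Rightarrow> 'm. (\<forall>n. monic C (m n) \<and> Cod C (m n) = A \<and> sub_le C (m n) (m (Suc n))) \<longrightarrow>
        (\<exists>N. \<forall>n \<ge> N. sub_le C (m n) (m N)))"

definition locally_noetherian :: "'u itself \<Rightarrow> ('o, 'm) category \<Rightarrow> bool" where
  "locally_noetherian U C \<longleftrightarrow> grothendieck_category U C \<and>
     (\<exists>G. small U G \<and> generating C G \<and> (\<forall>X \<in> G. noetherian_object C X))"

text \<open>The functor \<open>(A, -)\<close> commutes with direct limits over small directed sets: the canonical map
  from the direct limit of the \<open>Hom C A (D i)\<close> to \<open>Hom C A L\<close> is bijective. The two conjuncts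
  are its surjectivity and its injectivity.\<close>

definition finitely_presented :: "'u itself \<Rightarrow> ('o, 'm) category \<Rightarrow> 'o \<Rightarrow> bool" where
  "finitely_presented U C A \<longleftrightarrow> A \<in> Ob C \<and>
     (\<forall>(I :: 'u set) lq D d L l.
        small U I \<and> directed_system C I lq D d \<and> is_direct_limit C I lq D d L l \<longrightarrow>
        (\<forall>f \<in> Hom C A L. \<exists>i \<in> I. \<exists>g \<in> Hom C A (D i). l i \<cdot>\<^bsub>C\<^esub> g = f) \<and>
        (\<forall>i \<in> I. \<forall>j \<in> I. \<forall>g \<in> Hom C A (D i). \<forall>h \<in> Hom C A (D j).
           l i \<cdot>\<^bsub>C\<^esub> g = l j \<cdot>\<^bsub>C\<^esub> h \<longrightarrow>
           (\<exists>k \<in> I. lq i k \<and> lq j k \<and> d i k \<cdot>\<^bsub>C\<^esub> g = d j k \<cdot>\<^bsub>C\<^esub> h)))"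

definition injective_object :: "('o, 'm) category \<Rightarrow> 'o \<Rightarrow> bool" where
  "injective_object C E \<longleftrightarrow> E \<in> Ob C \<and>
     (\<forall>m. monic C m \<longrightarrow> (\<forall>f \<in> Hom C (Dom C m) E. \<exists>g \<in> Hom C (Cod C m) E. g \<cdot>\<^bsub>C\<^esub> m = f))"

definition indecomposable_object :: "('o, 'm) category \<Rightarrow> 'o \<Rightarrow> bool" where
  "indecomposable_object C E \<longleftrightarrow> E \<in> Ob C \<and> \<not> zero_object C E \<and>
     (\<forall>A B. is_biproduct C A B E \<longrightarrow> zero_object C A \<or> zero_object C B)"

definition iso_class :: "('o, 'm) category \<Rightarrow> 'o \<Rightarrow> 'o set" where
  "iso_class C A = {B. isomorphic C A B}"

definition indec_injectives :: "('o, 'm) category \<Rightarrow> 'o set" where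
  "indec_injectives C = {E. indecomposable_object C E \<and> injective_object C E}"

definition InjSpec_basic :: "('o, 'm) category \<Rightarrow> 'o \<Rightarrow> 'o set set" where
  "InjSpec_basic C A = iso_class C ` {E \<in> indec_injectives C. Hom C A E = {Zero C A E}}"

text \<open>The topology whose open sets are the unions of basic open sets. Its underlying set is
  \<open>iso_class C ` indec_injectives C\<close>, the basic open set of a zero object.\<close>

definition InjSpec :: "'u itself \<Rightarrow> ('o, 'm) category \<Rightarrow> 'o set topology" where
  "InjSpec U C =
     topology (arbitrary union_of (\<lambda>V. \<exists>A. finitely_presented U C A \<and> V = InjSpec_basic C A))"


section \<open>Hereditary torsion theories\<close>

definition torsion_theory :: "('o, 'm) category \<Rightarrow> 'o set \<Rightarrow> 'o set \<Rightarrow> bool" where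
  "torsion_theory C T F \<longleftrightarrow> T \<subseteq> Ob C \<and> F \<subseteq> Ob C \<and>
     (\<forall>X \<in> T. \<forall>Y \<in> F. Hom C X Y = {Zero C X Y}) \<and>
     (\<forall>X \<in> Ob C. (\<forall>Y \<in> F. Hom C X Y = {Zero C X Y}) \<longrightarrow> X \<in> T) \<and>
     (\<forall>Y \<in> Ob C. (\<forall>X \<in> T. Hom C X Y = {Zero C X Y}) \<longrightarrow> Y \<in> F) \<and>
     (\<forall>m. monic C m \<and> Cod C m \<in> T \<longrightarrow> Dom C m \<in> T)"

definition torsion_class :: "('o, 'm) category \<Rightarrow> 'o set \<Rightarrow> bool" where
  "torsion_class C T \<longleftrightarrow> (\<exists>F. torsion_theory C T F)"

definition torsionfree_class :: "('o, 'm) category \<Rightarrow> 'o set \<Rightarrow> bool" where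
  "torsionfree_class C F \<longleftrightarrow> (\<exists>T. torsion_theory C T F)"

text \<open>The torsion class belonging to the torsionfree class \<open>F\<close>.\<close>

definition torsion_of :: "('o, 'm) category \<Rightarrow> 'o set \<Rightarrow> 'o set" where
  "torsion_of C F = (THE T. torsion_theory C T F)"

definition gen_torsion :: "('o, 'm) category \<Rightarrow> 'o \<Rightarrow> 'o set" where
  "gen_torsion C A = \<Inter> {T. torsion_class C T \<and> A \<in> T}"

definition gen_torsionfree :: "('o, 'm) category \<Rightarrow> 'o \<Rightarrow> 'o set" where
  "gen_torsionfree C A = \<Inter> {F. torsionfree_class C F \<and> A \<in> F}"

definition torsion_critical :: "('o, 'm) category \<Rightarrow> 'o \<Rightarrow> bool" where
  "torsion_critical C A \<longleftrightarrow> A \<in> Ob C \<and> \<not> zero_object C A \<and>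
     (\<forall>m c. monic C m \<and> Cod C m = A \<and> \<not> zero_object C (Dom C m) \<and> is_cokernel C c m \<longrightarrow>
        Cod C c \<in> torsion_of C (gen_torsionfree C A))"

text \<open>A torsion theory is identified with its torsionfree class.\<close>

definition prime_torsion_theories :: "('o, 'm) category \<Rightarrow> 'o set set" where
  "prime_torsion_theories C =
     {F. torsionfree_class C F \<and> (\<exists>A. torsion_critical C A \<and> F = gen_torsionfree C A)}"

definition TorSpec_basic :: "('o, 'm) category \<Rightarrow> 'o set \<Rightarrow> 'o set set" where
  "TorSpec_basic C T = {F \<in> prime_torsion_theories C. T \<subseteq> torsion_of C F}"

definition TorSpec :: "'u itself \<Rightarrow> ('o, 'm) category \<Rightarrow> 'o set topology" where
  "TorSpec U C = topology (arbitrary union_of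
     (\<lambda>V. \<exists>A. finitely_presented U C A \<and> V = TorSpec_basic C (gen_torsion C A)))"

end

theory Submission
  imports Defs
begin

text \<open>For an injective object \<open>E\<close>, the torsionfree class generated by \<open>E\<close> has torsion class
  \<open>{X. (X, E) = 0}\<close>. So once \<open>E \<mapsto> \<F>(E)\<close> is known to be a bijection, it carries the basic open
  set \<open>[A]\<close> to \<open>[\<T>(A)]\<close> for every object \<open>A\<close>.

  Torsionfree classes are closed under subobjects and essential extensions, and an indecomposable
  injective object \<open>E\<close> is an essential extension of each of its non-zero subobjects. If
  \<open>f : X \<rightarrow> E\<close> is non-zero with \<open>X\<close> noetherian and the kernel of \<open>f\<close> is maximal, then the
  image of \<open>f\<close> is torsion-critical and generates the same class as \<open>E\<close>. If \<open>E'\<close> generates this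
  class too, then the image embeds into \<open>E'\<close>, which yields an isomorphism from \<open>E\<close> to \<open>E'\<close>.
  Conversely, a torsion-critical object \<open>A\<close> generating a prime torsion theory is uniform, so its
  injective hull is indecomposable and generates the same class.

  Injective objects are obtained by Baer's method: noetherian generators have, up to restriction,
  only a small set of partial arrows to an object \<open>M\<close>, which are extended simultaneously in a
  pushout. Countably many such steps suffice, because noetherian objects are finitely generated.
  Uncountability of the universe is what makes this work without strong inaccessibility.\<close>

section \<open>Preadditive categories\<close>

text \<open>There are no elements, so element arguments are made with arrows into an object, up to
  epimorphic covers: an arrow into the image of \<open>w\<close> lifts through \<open>w\<close> only
  after composition with an epimorphism.

  Exactness of direct limits is mostly used as one principle,
  \<open>directed_cover_pullback\<close>. From it come maximal subobjects with trivial intersection,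
  exactness of coproducts, and the fact that arrows from noetherian objects to the limit of a tower
  land in a stage.

  The subobjects of an object need not form a small set, as power sets of small sets need not be
  small. This rules out constructions indexed by all subobjects; indices have to be cut down to
  finite data or to points from generators.

  A locally noetherian category comes with two generating sets, one with small sets of arrows out of
  its members and one with noetherian members. The first is used to show that the second has both
  properties.

  The unions of basic open sets form a topology because finitely presented objects are closed under
  direct sums and \<open>[A] \<inter> [B] = [A \<oplus> B]\<close>.\<close>

context preadditive_category
begin

text \<open>Unfolding \<open>Hom\<close> lets the simplifier discharge typing conditions through
  rules for \<open>Arr\<close>, \<open>Dom\<close> and \<open>Cod\<close>. Where facts about
  \<open>Hom\<close> must match syntactically, the rule is removed.\<close>

lemma Hom_iff [simp]: "f \<in> Hom C A B \<longleftrightarrow> f \<in> Arr C \<and> Dom C f = A \<and> Cod C f = B"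
  by (simp add: Hom_def)

declare Dom_in_Ob [simp] Cod_in_Ob [simp]

lemma Comp_arr [simp]:
  assumes "f \<in> Arr C" "g \<in> Arr C" "Cod C f = Dom C g"
  shows "g \<cdot> f \<in> Arr C" "Dom C (g \<cdot> f) = Dom C f" "Cod C (g \<cdot> f) = Cod C g"
  using Comp_in_Hom[of f "Dom C f" "Cod C f" g "Cod C g"] assms by auto

lemma Ident_arr [simp]:
  assumes "A \<in> Ob C"
  shows "Ident C A \<in> Arr C" "Dom C (Ident C A) = A" "Cod C (Ident C A) = A"
  using Ident_in_Hom[OF assms] by auto

text \<open>Composites are bracketed to the right. Steps that must keep an inner composite together
  delete the rule or apply it by hand.\<close>

lemma assoc [simp]:
  assumes "f \<in> Arr C" "g \<in> Arr C" "h \<in> Arr C" "Cod C f = Dom C g" "Cod C g = Dom C h"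
  shows "(h \<cdot> g) \<cdot> f = h \<cdot> (g \<cdot> f)"
  using Comp_assoc[of f "Dom C f" "Cod C f" g "Cod C g" h "Cod C h"] assms by auto

lemma Ident_simps [simp]:
  assumes "f \<in> Arr C"
  shows "Dom C f = A \<Longrightarrow> f \<cdot> Ident C A = f" "Cod C f = B \<Longrightarrow> Ident C B \<cdot> f = f"
  using Comp_Ident_right[of f A "Cod C f"] Comp_Ident_left[of f "Dom C f" B] assms by auto

lemma Zero_arr [simp]:
  assumes "A \<in> Ob C" "B \<in> Ob C"
  shows "Zero C A B \<in> Arr C" "Dom C (Zero C A B) = A" "Cod C (Zero C A B) = B"
proof -
  interpret comm_group "Hom_group C A B" by (rule Hom_comm_group[OF assms])
  have "Zero C A B \<in> Hom C A B" using one_closed by (simp add: Hom_group_def del: Hom_iff)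
  then show "Zero C A B \<in> Arr C" "Dom C (Zero C A B) = A" "Cod C (Zero C A B) = B" by auto
qed

lemma Add_arr [simp]:
  assumes "f \<in> Arr C" "g \<in> Arr C" "Dom C f = Dom C g" "Cod C f = Cod C g"
  shows "Add C f g \<in> Arr C" "Dom C (Add C f g) = Dom C g" "Cod C (Add C f g) = Cod C g"
proof -
  interpret comm_group "Hom_group C (Dom C f) (Cod C f)" by (rule Hom_comm_group) (use assms in auto)
  have "Add C f g \<in> Hom C (Dom C f) (Cod C f)"
    using m_closed[of f g] assms by (simp add: Hom_group_def)
  then show "Add C f g \<in> Arr C" "Dom C (Add C f g) = Dom C g" "Cod C (Add C f g) = Cod C g"
    using assms by auto
qed

lemma Add_Zero [simp]:
  assumes "f \<in> Arr C" "Dom C f = A" "Cod C f = B"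
  shows "Add C f (Zero C A B) = f" "Add C (Zero C A B) f = f"
proof -
  interpret comm_group "Hom_group C A B" by (rule Hom_comm_group) (use assms in auto)
  show "Add C f (Zero C A B) = f" "Add C (Zero C A B) f = f"
    using r_one[of f] l_one[of f] assms by (simp_all add: Hom_group_def)
qed

lemma Add_right_cancel:
  assumes "f \<in> Hom C A B" "g \<in> Hom C A B" "h \<in> Hom C A B" "Add C f h = Add C g h"
  shows "f = g"
proof -
  interpret comm_group "Hom_group C A B" by (rule Hom_comm_group) (use assms in auto)
  show ?thesis using right_cancel[of h f g] assms by (simp add: Hom_group_def)
qed

section \<open>Subtraction and vanishing of arrows\<close>

definition dif :: "'m \<Rightarrow> 'm \<Rightarrow> 'm" where
  "dif f g = Add C f (m_inv (Hom_group C (Dom C f) (Cod C f)) g)"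

lemma dif_Hom:
  assumes "f \<in> Hom C A B" "g \<in> Hom C A B"
  shows "dif f g \<in> Hom C A B" "Add C (dif f g) g = f"
proof -
  interpret comm_group "Hom_group C A B" by (rule Hom_comm_group) (use assms in auto)
  let ?i = "m_inv (Hom_group C A B) g"
  have g: "g \<in> carrier (Hom_group C A B)" and f: "f \<in> carrier (Hom_group C A B)"
    using assms by (auto simp: Hom_group_def)
  have "f \<otimes>\<^bsub>Hom_group C A B\<^esub> ?i \<in> carrier (Hom_group C A B)" using f g by simp
  then show "dif f g \<in> Hom C A B" using assms by (simp add: dif_def Hom_group_def)
  have "f \<otimes>\<^bsub>Hom_group C A B\<^esub> ?i \<otimes>\<^bsub>Hom_group C A B\<^esub> g = f"
    using f g by (simp add: m_assoc)
  then show "Add C (dif f g) g = f" using assms by (simp add: dif_def Hom_group_def)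
qed

lemma dif_arr [simp]:
  assumes "f \<in> Arr C" "g \<in> Arr C" "Dom C f = Dom C g" "Cod C f = Cod C g"
  shows "dif f g \<in> Arr C" "Dom C (dif f g) = Dom C g" "Cod C (dif f g) = Cod C g"
    "Add C (dif f g) g = f"
  using dif_Hom[of f "Dom C g" "Cod C g" g] assms by auto

lemma dif_eqI:
  assumes "f \<in> Hom C A B" "g \<in> Hom C A B" "h \<in> Hom C A B" "Add C h g = f"
  shows "dif f g = h"
  using Add_right_cancel[of "dif f g" A B h g] assms by auto

lemma Comp_dif [simp]:
  assumes "f \<in> Arr C" "g \<in> Arr C" "Dom C f = Dom C g" "Cod C f = Cod C g" "h \<in> Arr C"
    "Dom C h = Cod C g"
  shows "h \<cdot> dif f g = dif (h \<cdot> f) (h \<cdot> g)"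
proof (rule dif_eqI[symmetric])
  show "Add C (h \<cdot> dif f g) (h \<cdot> g) = h \<cdot> f"
    using Comp_Add_right[of "dif f g" "Dom C g" "Cod C g" g h "Cod C h"] assms by simp
qed (use assms in auto)

lemma dif_Comp [simp]:
  assumes "f \<in> Arr C" "g \<in> Arr C" "Dom C f = Dom C g" "Cod C f = Cod C g" "h \<in> Arr C"
    "Cod C h = Dom C g"
  shows "dif f g \<cdot> h = dif (f \<cdot> h) (g \<cdot> h)"
proof (rule dif_eqI[symmetric])
  show "Add C (dif f g \<cdot> h) (g \<cdot> h) = f \<cdot> h"
    using Comp_Add_left[of h "Dom C h" "Cod C h" "dif f g" "Cod C g" g] assms by simp
qed (use assms in auto)

lemma Add_Comp [simp]:
  assumes "f \<in> Arr C" "g \<in> Arr C" "Dom C f = Dom C g" "Cod C f = Cod C g" "h \<in> Arr C"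
    "Cod C h = Dom C g"
  shows "Add C f g \<cdot> h = Add C (f \<cdot> h) (g \<cdot> h)"
  using Comp_Add_left[of h "Dom C h" "Cod C h" f "Cod C g" g] assms by simp

lemma Comp_Add [simp]:
  assumes "f \<in> Arr C" "g \<in> Arr C" "Dom C f = Dom C g" "Cod C f = Cod C g" "h \<in> Arr C"
    "Dom C h = Cod C g"
  shows "h \<cdot> Add C f g = Add C (h \<cdot> f) (h \<cdot> g)"
  using Comp_Add_right[of f "Dom C g" "Cod C g" g h "Cod C h"] assms by simp

lemma dif_self [simp]: "f \<in> Arr C \<Longrightarrow> dif f f = Zero C (Dom C f) (Cod C f)"
  by (rule dif_eqI[of f "Dom C f" "Cod C f"]) auto

lemma dif_Zero [simp]: "\<lbrakk>f \<in> Arr C; Dom C f = A; Cod C f = B\<rbrakk> \<Longrightarrow> dif f (Zero C A B) = f"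
  by (rule dif_eqI[of f A B]) auto

lemma dif_eq_Zero:
  assumes "f \<in> Arr C" "g \<in> Arr C" "Dom C f = Dom C g" "Cod C f = Cod C g"
  shows "dif f g = Zero C (Dom C g) (Cod C g) \<longleftrightarrow> f = g"
  using assms dif_arr(4)[OF assms] dif_self[of g] Add_Zero(2)[of g] by metis

text \<open>A zero arrow is its own difference with itself, and composition preserves
  differences.\<close>

lemma Comp_Zero [simp]:
  assumes "f \<in> Arr C"
  shows "\<lbrakk>Dom C f = B; A \<in> Ob C\<rbrakk> \<Longrightarrow> f \<cdot> Zero C A B = Zero C A (Cod C f)"
    "\<lbrakk>Cod C f = A; B \<in> Ob C\<rbrakk> \<Longrightarrow> Zero C A B \<cdot> f = Zero C (Dom C f) B"
proof -
  assume *: "Dom C f = B" "A \<in> Ob C"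
  then have "B \<in> Ob C" using assms by auto
  with * show "f \<cdot> Zero C A B = Zero C A (Cod C f)"
    using assms Comp_dif[of "Zero C A B" "Zero C A B" f] by simp
next
  assume *: "Cod C f = A" "B \<in> Ob C"
  then have "A \<in> Ob C" using assms by auto
  with * show "Zero C A B \<cdot> f = Zero C (Dom C f) B"
    using assms dif_Comp[of "Zero C A B" "Zero C A B" f] by simp
qed

text \<open>\<open>Zero\<close> takes the domain and the codomain as arguments; this predicate lets
  vanishing be passed along composites without computing them.\<close>

definition nul :: "'m \<Rightarrow> bool" where
  "nul f \<longleftrightarrow> f = Zero C (Dom C f) (Cod C f)"

lemma nul_Zero [simp]: "A \<in> Ob C \<Longrightarrow> B \<in> Ob C \<Longrightarrow> nul (Zero C A B)"
  by (simp add: nul_def)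

lemma nulD: "\<lbrakk>nul f; Dom C f = A; Cod C f = B\<rbrakk> \<Longrightarrow> f = Zero C A B"
  unfolding nul_def by simp

lemma nul_Comp_left:
  assumes "f \<in> Arr C" "g \<in> Arr C" "Cod C f = Dom C g" "nul f"
  shows "nul (g \<cdot> f)"
proof -
  have "f = Zero C (Dom C f) (Dom C g)" using assms by (simp add: nul_def)
  then have "g \<cdot> f = g \<cdot> Zero C (Dom C f) (Dom C g)" by simp
  then show ?thesis using assms by (simp add: nul_def)
qed

lemma nul_Comp_right:
  assumes "f \<in> Arr C" "g \<in> Arr C" "Cod C f = Dom C g" "nul g"
  shows "nul (g \<cdot> f)"
proof -
  have "g = Zero C (Cod C f) (Cod C g)" using assms by (simp add: nul_def)
  then have "g \<cdot> f = Zero C (Cod C f) (Cod C g) \<cdot> f" by simp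
  then show ?thesis using assms by (simp add: nul_def)
qed

lemma nul_dif:
  assumes "f \<in> Arr C" "g \<in> Arr C" "Dom C f = Dom C g" "Cod C f = Cod C g"
  shows "nul (dif f g) \<longleftrightarrow> f = g"
  using assms by (simp add: nul_def dif_eq_Zero)

section \<open>Monomorphisms and epimorphisms\<close>

text \<open>By subtraction, cancellability follows from its special case for zero
  composites.\<close>

lemma monicI:
  assumes "m \<in> Arr C"
    and "\<And>x. \<lbrakk>x \<in> Arr C; Cod C x = Dom C m; nul (m \<cdot> x)\<rbrakk> \<Longrightarrow> nul x"
  shows "monic C m"
  unfolding monic_def
proof (intro conjI allI ballI impI)
  fix X f g assume fg: "f \<in> Hom C X (Dom C m)" "g \<in> Hom C X (Dom C m)" "m \<cdot> f = m \<cdot> g"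
  have *: "nul (m \<cdot> dif f g)" using fg assms(1) by auto
  have "nul (dif f g)" by (rule assms(2)) (use * fg in auto)
  then show "f = g" using fg by (simp add: nul_dif)
qed (rule assms)

lemma monicD:
  assumes "monic C m" "x \<in> Arr C" "Cod C x = Dom C m" "nul (m \<cdot> x)"
  shows "nul x"
proof -
  have m: "m \<in> Arr C" using assms by (simp add: monic_def)
  have "m \<cdot> x = m \<cdot> Zero C (Dom C x) (Dom C m)"
    using assms m by (simp add: nul_def)
  then have "x = Zero C (Dom C x) (Dom C m)"
    using assms(1-3) m unfolding monic_def by (metis Hom_iff Zero_arr Dom_in_Ob)
  then show ?thesis using assms by (simp add: nul_def)
qed

lemma epicI:
  assumes "e \<in> Arr C"
    and "\<And>x. \<lbrakk>x \<in> Arr C; Dom C x = Cod C e; nul (x \<cdot> e)\<rbrakk> \<Longrightarrow> nul x"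
  shows "epic C e"
  unfolding epic_def
proof (intro conjI allI ballI impI)
  fix X f g assume fg: "f \<in> Hom C (Cod C e) X" "g \<in> Hom C (Cod C e) X" "f \<cdot> e = g \<cdot> e"
  have *: "nul (dif f g \<cdot> e)" using fg assms(1) by auto
  have "nul (dif f g)" by (rule assms(2)) (use * fg in auto)
  then show "f = g" using fg by (simp add: nul_dif)
qed (rule assms)

lemma epicD:
  assumes "epic C e" "x \<in> Arr C" "Dom C x = Cod C e" "nul (x \<cdot> e)"
  shows "nul x"
proof -
  have e: "e \<in> Arr C" using assms by (simp add: epic_def)
  have "x \<cdot> e = Zero C (Cod C e) (Cod C x) \<cdot> e"
    using assms e by (simp add: nul_def)
  then have "x = Zero C (Cod C e) (Cod C x)"
    using assms(1-3) e unfolding epic_def by (metis Hom_iff Zero_arr Cod_in_Ob)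
  then show ?thesis using assms by (simp add: nul_def)
qed

lemma monic_arr [simp]: "monic C m \<Longrightarrow> m \<in> Arr C" by (simp add: monic_def)
lemma epic_arr [simp]: "epic C e \<Longrightarrow> e \<in> Arr C" by (simp add: epic_def)

lemma monic_cancel:
  "\<lbrakk>monic C m; m \<cdot> f = m \<cdot> g; f \<in> Arr C; g \<in> Arr C; Cod C f = Dom C m; Cod C g = Dom C m;
    Dom C f = Dom C g\<rbrakk> \<Longrightarrow> f = g"
  unfolding monic_def by auto

lemma epic_cancel:
  "\<lbrakk>epic C e; f \<cdot> e = g \<cdot> e; f \<in> Arr C; g \<in> Arr C; Dom C f = Cod C e; Dom C g = Cod C e;
    Cod C f = Cod C g\<rbrakk> \<Longrightarrow> f = g"
  unfolding epic_def by auto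

lemma monic_Comp:
  assumes "monic C f" "monic C g" "Cod C f = Dom C g"
  shows "monic C (g \<cdot> f)"
proof (rule monicI)
  fix x assume x: "x \<in> Arr C" "Cod C x = Dom C (g \<cdot> f)" "nul ((g \<cdot> f) \<cdot> x)"
  have *: "nul (f \<cdot> x)" by (rule monicD[OF assms(2)]) (use x assms in auto)
  show "nul x" by (rule monicD[OF assms(1)]) (use * x assms in auto)
qed (use assms in auto)

lemma monic_Comp_right:
  assumes "monic C (g \<cdot> f)" "f \<in> Arr C" "g \<in> Arr C" "Cod C f = Dom C g"
  shows "monic C f"
proof (rule monicI)
  fix x assume x: "x \<in> Arr C" "Cod C x = Dom C f" "nul (f \<cdot> x)"
  have *: "nul (g \<cdot> (f \<cdot> x))" by (rule nul_Comp_left) (use x assms in auto)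
  show "nul x" by (rule monicD[OF assms(1)]) (use * x assms(2-4) in auto)
qed (use assms in auto)

lemma epic_Comp_left:
  assumes "epic C (g \<cdot> f)" "f \<in> Arr C" "g \<in> Arr C" "Cod C f = Dom C g"
  shows "epic C g"
proof (rule epicI)
  fix x assume x: "x \<in> Arr C" "Dom C x = Cod C g" "nul (x \<cdot> g)"
  have *: "nul ((x \<cdot> g) \<cdot> f)" by (rule nul_Comp_right) (use x assms(2-4) in auto)
  show "nul x" by (rule epicD[OF assms(1)]) (use * x assms(2-4) in auto)
qed (use assms in auto)

lemma monic_Ident [simp]: "A \<in> Ob C \<Longrightarrow> monic C (Ident C A)"
  by (rule monicI) auto

text \<open>Below \<open>sub_le C x m\<close> is also used when \<open>x\<close> or \<open>m\<close> is not a monomorphism; it says that \<open>x\<close> factors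
  through \<open>m\<close>.\<close>

lemma sub_leI:
  "\<lbrakk>u \<in> Arr C; Dom C u = Dom C x; Cod C u = Dom C m; m \<cdot> u = x\<rbrakk> \<Longrightarrow> sub_le C x m"
  unfolding sub_le_def by auto

lemma sub_leE:
  assumes "sub_le C x m"
  obtains u where "u \<in> Arr C" "Dom C u = Dom C x" "Cod C u = Dom C m" "m \<cdot> u = x"
  using assms unfolding sub_le_def by auto

lemma sub_le_refl [simp]: "x \<in> Arr C \<Longrightarrow> sub_le C x x"
  by (rule sub_leI[of "Ident C (Dom C x)"]) auto

lemma sub_le_trans:
  assumes "sub_le C x y" "sub_le C y z" "z \<in> Arr C"
  shows "sub_le C x z"
proof -
  obtain u where u: "u \<in> Arr C" "Dom C u = Dom C x" "Cod C u = Dom C y" "y \<cdot> u = x"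
    using assms(1) by (rule sub_leE)
  obtain v where v: "v \<in> Arr C" "Dom C v = Dom C y" "Cod C v = Dom C z" "z \<cdot> v = y"
    using assms(2) by (rule sub_leE)
  show ?thesis
    by (rule sub_leI[of "v \<cdot> u"]) (use u v assms(3) assoc[of u v z] in auto)
qed

lemma sub_le_Comp:
  assumes "sub_le C x m" "y \<in> Arr C" "Cod C y = Dom C x" "m \<in> Arr C"
  shows "sub_le C (x \<cdot> y) m"
proof -
  obtain u where u: "u \<in> Arr C" "Dom C u = Dom C x" "Cod C u = Dom C m" "m \<cdot> u = x"
    using assms(1) by (rule sub_leE)
  show ?thesis
    by (rule sub_leI[of "u \<cdot> y"]) (use u assms assoc[of y u m] in auto)
qed

lemma sub_le_Comp_left:
  assumes "sub_le C x m" "m \<in> Arr C" "f \<in> Arr C" "Dom C f = Cod C m"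
  shows "sub_le C (f \<cdot> x) (f \<cdot> m)"
proof -
  obtain u where u: "u \<in> Arr C" "Dom C u = Dom C x" "Cod C u = Dom C m" "m \<cdot> u = x"
    using assms(1) by (rule sub_leE)
  show ?thesis
    by (rule sub_leI[of u]) (use u assms in auto)
qed

lemma sub_le_Comp_self: "\<lbrakk>m \<in> Arr C; y \<in> Arr C; Cod C y = Dom C m\<rbrakk> \<Longrightarrow> sub_le C (m \<cdot> y) m"
  by (rule sub_leI[of y]) auto

section \<open>Zero objects\<close>

text \<open>Every arrow into or out of \<open>Z\<close> equals its composite with the identity of
  \<open>Z\<close>, so it vanishes as soon as that identity does.\<close>

lemma zero_object_iff: "zero_object C Z \<longleftrightarrow> Z \<in> Ob C \<and> Ident C Z = Zero C Z Z"
proof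
  assume Z: "zero_object C Z"
  then show "Z \<in> Ob C \<and> Ident C Z = Zero C Z Z"
    unfolding zero_object_def by (metis Hom_iff Ident_arr Zero_arr)
next
  assume Z: "Z \<in> Ob C \<and> Ident C Z = Zero C Z Z"
  show "zero_object C Z"
    unfolding zero_object_def
  proof (intro conjI ballI)
    fix A assume A: "A \<in> Ob C"
    show "\<exists>!f. f \<in> Hom C A Z"
    proof (rule ex1I[of _ "Zero C A Z"])
      fix f assume f: "f \<in> Hom C A Z"
      then show "f = Zero C A Z" using Z Ident_simps(2)[of f Z] Comp_Zero(2)[of f Z Z] by auto
    qed (use A Z in auto)
    show "\<exists>!f. f \<in> Hom C Z A"
    proof (rule ex1I[of _ "Zero C Z A"])
      fix f assume f: "f \<in> Hom C Z A"
      then show "f = Zero C Z A" using Z Ident_simps(1)[of f Z] Comp_Zero(1)[of f Z Z] by auto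
    qed (use A Z in auto)
  qed (use Z in auto)
qed

lemma nul_from_zero_object: "\<lbrakk>zero_object C Z; f \<in> Arr C; Dom C f = Z\<rbrakk> \<Longrightarrow> nul f"
  unfolding nul_def zero_object_def by (metis Hom_iff Zero_arr Cod_in_Ob Dom_in_Ob)

lemma nul_to_zero_object: "\<lbrakk>zero_object C Z; f \<in> Arr C; Cod C f = Z\<rbrakk> \<Longrightarrow> nul f"
  unfolding nul_def zero_object_def by (metis Hom_iff Zero_arr Cod_in_Ob Dom_in_Ob)

lemma zero_object_Ident: "A \<in> Ob C \<Longrightarrow> zero_object C A \<longleftrightarrow> nul (Ident C A)"
  by (simp add: zero_object_iff nul_def)

lemma zero_object_nul_monic:
  assumes "monic C m" "nul m"
  shows "zero_object C (Dom C m)"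
proof -
  have "nul (Ident C (Dom C m))"
    by (rule monicD[OF assms(1)]) (use assms in auto)
  then show ?thesis using assms by (simp add: zero_object_Ident)
qed

lemma monic_nonzero_iff: "monic C m \<Longrightarrow> zero_object C (Dom C m) \<longleftrightarrow> nul m"
  using zero_object_nul_monic nul_from_zero_object by auto

lemma Hom_trivial_iff:
  assumes "A \<in> Ob C" "B \<in> Ob C"
  shows "Hom C A B = {Zero C A B} \<longleftrightarrow> (\<forall>f \<in> Hom C A B. nul f)"
  using assms by (auto simp: nul_def simp del: Hom_iff) (auto simp: Hom_def)

section \<open>Kernels and cokernels without uniqueness clauses\<close>

lemma is_kernel_monic:
  assumes "is_kernel C k f" shows "monic C k"
  unfolding monic_def
proof (intro conjI allI ballI impI)
  fix X x y assume xy: "x \<in> Hom C X (Dom C k)" "y \<in> Hom C X (Dom C k)" "k \<cdot> x = k \<cdot> y"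
  have k: "k \<in> Arr C" "f \<in> Arr C" "Cod C k = Dom C f" "f \<cdot> k = Zero C (Dom C k) (Cod C f)"
    using assms by (auto simp: is_kernel_def)
  have "f \<cdot> (k \<cdot> x) = (f \<cdot> k) \<cdot> x" using k(1-3) xy by simp
  also have "\<dots> = Zero C X (Cod C f)" using k xy by simp
  finally have z: "f \<cdot> (k \<cdot> x) = Zero C X (Cod C f)" .
  have "X \<in> Ob C" "k \<cdot> x \<in> Hom C X (Dom C f)" using xy k by auto
  then have "\<exists>!u. u \<in> Hom C X (Dom C k) \<and> k \<cdot> u = k \<cdot> x"
    using assms z unfolding is_kernel_def by blast
  then show "x = y" using xy by metis
qed (use assms in \<open>simp add: is_kernel_def\<close>)

text \<open>Uniqueness of the factorization is absorbed into \<open>k\<close> being monic, and its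
  existence into \<open>sub_le\<close>.\<close>

lemma is_kernel_iff:
  "is_kernel C k f \<longleftrightarrow> monic C k \<and> f \<in> Arr C \<and> Cod C k = Dom C f \<and> nul (f \<cdot> k) \<and>
    (\<forall>x \<in> Arr C. Cod C x = Dom C f \<longrightarrow> nul (f \<cdot> x) \<longrightarrow> sub_le C x k)"
proof
  assume K: "is_kernel C k f"
  have "sub_le C x k" if "x \<in> Arr C" "Cod C x = Dom C f" "nul (f \<cdot> x)" for x
  proof -
    have "x \<in> Hom C (Dom C x) (Dom C f)" "f \<cdot> x = Zero C (Dom C x) (Cod C f)"
      "Dom C x \<in> Ob C"
      using that K by (auto simp: nul_def is_kernel_def)
    then have "\<exists>u. u \<in> Hom C (Dom C x) (Dom C k) \<and> k \<cdot> u = x"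
      using K unfolding is_kernel_def by blast
    then show ?thesis unfolding sub_le_def by blast
  qed
  then show "monic C k \<and> f \<in> Arr C \<and> Cod C k = Dom C f \<and> nul (f \<cdot> k) \<and>
    (\<forall>x \<in> Arr C. Cod C x = Dom C f \<longrightarrow> nul (f \<cdot> x) \<longrightarrow> sub_le C x k)"
    using K is_kernel_monic[OF K] by (auto simp: is_kernel_def nul_def)
next
  assume R: "monic C k \<and> f \<in> Arr C \<and> Cod C k = Dom C f \<and> nul (f \<cdot> k) \<and>
    (\<forall>x \<in> Arr C. Cod C x = Dom C f \<longrightarrow> nul (f \<cdot> x) \<longrightarrow> sub_le C x k)"
  show "is_kernel C k f"
    unfolding is_kernel_def
  proof (intro conjI ballI impI)
    fix X g assume g: "X \<in> Ob C" "g \<in> Hom C X (Dom C f)" "f \<cdot> g = Zero C X (Cod C f)"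
    then have "sub_le C g k" using R by (simp add: nul_def)
    then obtain u where "u \<in> Hom C X (Dom C k)" "k \<cdot> u = g"
      using g unfolding sub_le_def by auto
    then show "\<exists>!u. u \<in> Hom C X (Dom C k) \<and> k \<cdot> u = g"
      using R unfolding monic_def by blast
  qed (use R nulD[of "f \<cdot> k" "Dom C k" "Cod C f"] in auto)
qed

lemma is_cokernel_epic:
  assumes "is_cokernel C k f" shows "epic C k"
  unfolding epic_def
proof (intro conjI allI ballI impI)
  fix X x y assume xy: "x \<in> Hom C (Cod C k) X" "y \<in> Hom C (Cod C k) X" "x \<cdot> k = y \<cdot> k"
  have k: "k \<in> Arr C" "f \<in> Arr C" "Dom C k = Cod C f" "k \<cdot> f = Zero C (Dom C f) (Cod C k)"
    using assms by (auto simp: is_cokernel_def)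
  have "(x \<cdot> k) \<cdot> f = Zero C (Dom C f) X" using k xy by simp
  moreover have "X \<in> Ob C" "x \<cdot> k \<in> Hom C (Cod C f) X" using xy k by auto
  ultimately have "\<exists>!u. u \<in> Hom C (Cod C k) X \<and> u \<cdot> k = x \<cdot> k"
    using assms unfolding is_cokernel_def by blast
  then show "x = y" using xy by metis
qed (use assms in \<open>simp add: is_cokernel_def\<close>)

lemma is_cokernel_iff:
  "is_cokernel C k f \<longleftrightarrow> epic C k \<and> f \<in> Arr C \<and> Dom C k = Cod C f \<and> nul (k \<cdot> f) \<and>
    (\<forall>x \<in> Arr C. Dom C x = Cod C f \<longrightarrow> nul (x \<cdot> f) \<longrightarrow>
      (\<exists>u \<in> Arr C. Dom C u = Cod C k \<and> Cod C u = Cod C x \<and> u \<cdot> k = x))"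
proof
  assume K: "is_cokernel C k f"
  have "\<exists>u \<in> Arr C. Dom C u = Cod C k \<and> Cod C u = Cod C x \<and> u \<cdot> k = x"
    if "x \<in> Arr C" "Dom C x = Cod C f" "nul (x \<cdot> f)" for x
  proof -
    have "x \<in> Hom C (Cod C f) (Cod C x)" "x \<cdot> f = Zero C (Dom C f) (Cod C x)"
      "Cod C x \<in> Ob C"
      using that K by (auto simp: nul_def is_cokernel_def)
    then have "\<exists>u. u \<in> Hom C (Cod C k) (Cod C x) \<and> u \<cdot> k = x"
      using K unfolding is_cokernel_def by blast
    then show ?thesis by auto
  qed
  then show "epic C k \<and> f \<in> Arr C \<and> Dom C k = Cod C f \<and> nul (k \<cdot> f) \<and>
    (\<forall>x \<in> Arr C. Dom C x = Cod C f \<longrightarrow> nul (x \<cdot> f) \<longrightarrow>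
      (\<exists>u \<in> Arr C. Dom C u = Cod C k \<and> Cod C u = Cod C x \<and> u \<cdot> k = x))"
    using K is_cokernel_epic[OF K] by (auto simp: is_cokernel_def nul_def)
next
  assume R: "epic C k \<and> f \<in> Arr C \<and> Dom C k = Cod C f \<and> nul (k \<cdot> f) \<and>
    (\<forall>x \<in> Arr C. Dom C x = Cod C f \<longrightarrow> nul (x \<cdot> f) \<longrightarrow>
      (\<exists>u \<in> Arr C. Dom C u = Cod C k \<and> Cod C u = Cod C x \<and> u \<cdot> k = x))"
  show "is_cokernel C k f"
    unfolding is_cokernel_def
  proof (intro conjI ballI impI)
    fix X g assume g: "X \<in> Ob C" "g \<in> Hom C (Cod C f) X" "g \<cdot> f = Zero C (Dom C f) X"
    then have "\<exists>u \<in> Arr C. Dom C u = Cod C k \<and> Cod C u = Cod C g \<and> u \<cdot> k = g"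
      using R by (metis Hom_iff nul_Zero Dom_in_Ob)
    then obtain u where "u \<in> Hom C (Cod C k) X" "u \<cdot> k = g"
      using g by auto
    then show "\<exists>!u. u \<in> Hom C (Cod C k) X \<and> u \<cdot> k = g"
      using R unfolding epic_def by blast
  qed (use R nulD[of "k \<cdot> f" "Dom C f" "Cod C k"] in auto)
qed

end

section \<open>Abelian categories\<close>

lemma is_biproductE:
  assumes "is_biproduct C A B S"
  obtains i j p q where "i \<in> Hom C A S" "j \<in> Hom C B S" "p \<in> Hom C S A" "q \<in> Hom C S B"
    "p \<cdot>\<^bsub>C\<^esub> i = Ident C A" "q \<cdot>\<^bsub>C\<^esub> j = Ident C B"
    "Add C (i \<cdot>\<^bsub>C\<^esub> p) (j \<cdot>\<^bsub>C\<^esub> q) = Ident C S"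
  using assms unfolding is_biproduct_def by blast

context preadditive_category
begin

text \<open>Multiplying the decomposition of the identity by \<open>j\<close> on the right gives
  \<open>j = i p j + j\<close>, so \<open>i p j\<close> vanishes, and \<open>p\<close> cancels
  \<open>i\<close>. The other equation comes from multiplying by \<open>q\<close> on the
  left.\<close>

lemma biproduct_orthogonal:
  assumes "i \<in> Hom C A S" "j \<in> Hom C B S" "p \<in> Hom C S A" "q \<in> Hom C S B"
    "p \<cdot> i = Ident C A" "q \<cdot> j = Ident C B" "Add C (i \<cdot> p) (j \<cdot> q) = Ident C S"
  shows "p \<cdot> j = Zero C B A" "q \<cdot> i = Zero C A B"
proof -
  have ob: "A \<in> Ob C" "B \<in> Ob C" "S \<in> Ob C" using assms by auto
  have reass: "\<And>x. \<lbrakk>x \<in> Arr C; Cod C x = A\<rbrakk> \<Longrightarrow> p \<cdot> (i \<cdot> x) = x"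
    "\<And>x. \<lbrakk>x \<in> Arr C; Cod C x = B\<rbrakk> \<Longrightarrow> q \<cdot> (j \<cdot> x) = x"
    using assms assoc[of _ i p] assoc[of _ j q] by auto
  have "j = Add C (i \<cdot> p) (j \<cdot> q) \<cdot> j" using assms by simp
  also have "\<dots> = Add C (i \<cdot> (p \<cdot> j)) j" using assms(1-6) by simp
  finally have "j = Add C (i \<cdot> (p \<cdot> j)) j" .
  then have "i \<cdot> (p \<cdot> j) = Zero C B S"
    using assms(1-6) ob Add_right_cancel[of "i \<cdot> (p \<cdot> j)" B S "Zero C B S" j] by simp
  then have "p \<cdot> (i \<cdot> (p \<cdot> j)) = Zero C B A" using assms(1-6) ob by simp
  then show "p \<cdot> j = Zero C B A" using assms(1-6) reass(1)[of "p \<cdot> j"] by simp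
  have "q = q \<cdot> Add C (i \<cdot> p) (j \<cdot> q)" using assms by simp
  also have "\<dots> = Add C (q \<cdot> (i \<cdot> p)) q" using assms(1-6) reass(2)[of q] by simp
  finally have "q = Add C (q \<cdot> (i \<cdot> p)) q" .
  then have "q \<cdot> (i \<cdot> p) = Zero C S B"
    using assms(1-6) ob Add_right_cancel[of "q \<cdot> (i \<cdot> p)" S B "Zero C S B" q] by simp
  then have "(q \<cdot> (i \<cdot> p)) \<cdot> i = Zero C A B" using assms(1-6) ob by simp
  then show "q \<cdot> i = Zero C A B" using assms(1-6) by simp
qed

end

context abelian_category
begin

section \<open>Kernels, cokernels and images\<close>

definition ker :: "'b \<Rightarrow> 'b" where "ker f = (SOME k. is_kernel C k f)"
definition coker :: "'b \<Rightarrow> 'b" where "coker f = (SOME c. is_cokernel C c f)"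

lemma is_kernel_ker: "f \<in> Arr C \<Longrightarrow> is_kernel C (ker f) f"
  unfolding ker_def by (rule someI_ex[OF ex_kernel])

lemma is_cokernel_coker: "f \<in> Arr C \<Longrightarrow> is_cokernel C (coker f) f"
  unfolding coker_def by (rule someI_ex[OF ex_cokernel])

lemma ker_arr [simp]:
  assumes "f \<in> Arr C"
  shows "monic C (ker f)" "ker f \<in> Arr C" "Cod C (ker f) = Dom C f" "nul (f \<cdot> ker f)"
  using is_kernel_ker[OF assms] by (auto simp: is_kernel_iff)

lemma coker_arr [simp]:
  assumes "f \<in> Arr C"
  shows "epic C (coker f)" "coker f \<in> Arr C" "Dom C (coker f) = Cod C f" "nul (coker f \<cdot> f)"
  using is_cokernel_coker[OF assms] by (auto simp: is_cokernel_iff)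

lemma sub_le_nul:
  assumes "sub_le C x y" "y \<in> Arr C" "f \<in> Arr C" "Dom C f = Cod C y" "nul (f \<cdot> y)"
  shows "nul (f \<cdot> x)"
proof -
  obtain u where u: "u \<in> Arr C" "Dom C u = Dom C x" "Cod C u = Dom C y" "y \<cdot> u = x"
    using assms(1) by (rule sub_leE)
  have "nul ((f \<cdot> y) \<cdot> u)" by (rule nul_Comp_right) (use u assms in auto)
  then show ?thesis using u assms by simp
qed

lemma sub_le_ker_iff:
  assumes "f \<in> Arr C" "x \<in> Arr C" "Cod C x = Dom C f"
  shows "sub_le C x (ker f) \<longleftrightarrow> nul (f \<cdot> x)"
proof
  assume "sub_le C x (ker f)"
  then show "nul (f \<cdot> x)" by (rule sub_le_nul) (use assms in simp_all)
next
  assume "nul (f \<cdot> x)"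
  with is_kernel_ker[OF assms(1)] assms(2,3) show "sub_le C x (ker f)"
    unfolding is_kernel_iff by blast
qed

lemma ker_factorE:
  assumes "f \<in> Arr C" "x \<in> Arr C" "Cod C x = Dom C f" "nul (f \<cdot> x)"
  obtains u where "u \<in> Arr C" "Dom C u = Dom C x" "Cod C u = Dom C (ker f)" "ker f \<cdot> u = x"
  using assms sub_le_ker_iff sub_leE by metis

lemma coker_factorE:
  assumes "f \<in> Arr C" "x \<in> Arr C" "Dom C x = Cod C f" "nul (x \<cdot> f)"
  obtains u where "u \<in> Arr C" "Dom C u = Cod C (coker f)" "Cod C u = Cod C x" "u \<cdot> coker f = x"
  using is_cokernel_coker[OF assms(1)] assms unfolding is_cokernel_iff by blast

text \<open>By normality \<open>m\<close> is a kernel of some \<open>f\<close>, and \<open>f\<close>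
  factors through \<open>coker m\<close>. Hence what \<open>coker m\<close> kills is killed by
  \<open>f\<close> and factors through \<open>m\<close>. This turns containment in a subobject into
  the vanishing of an arrow.\<close>

lemma monic_sub_le_iff:
  assumes "monic C m" "x \<in> Arr C" "Cod C x = Cod C m"
  shows "sub_le C x m \<longleftrightarrow> nul (coker m \<cdot> x)"
proof
  assume "sub_le C x m"
  then show "nul (coker m \<cdot> x)" by (rule sub_le_nul) (use assms in auto)
next
  assume n: "nul (coker m \<cdot> x)"
  obtain f where f: "is_kernel C m f" using monic_normal assms(1) by blast
  then have f': "f \<in> Arr C" "Dom C f = Cod C m" "nul (f \<cdot> m)" by (auto simp: is_kernel_iff)
  obtain u where u: "u \<in> Arr C" "Dom C u = Cod C (coker m)" "u \<cdot> coker m = f"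
    by (rule coker_factorE[of m f]) (use f' assms in auto)
  have "nul (u \<cdot> (coker m \<cdot> x))" by (rule nul_Comp_left) (use u n assms in auto)
  then have "nul (f \<cdot> x)" using u assms assoc[of x "coker m" u] by simp
  then show "sub_le C x m" using f assms f' by (auto simp: is_kernel_iff)
qed

text \<open>Dually, \<open>e\<close> is a cokernel of some \<open>f\<close>, and \<open>f\<close>
  factors through \<open>ker e\<close>; so an arrow that kills \<open>ker e\<close> kills
  \<open>f\<close>.\<close>

lemma epic_factorE:
  assumes "epic C e" "x \<in> Arr C" "Dom C x = Dom C e" "nul (x \<cdot> ker e)"
  obtains u where "u \<in> Arr C" "Dom C u = Cod C e" "Cod C u = Cod C x" "u \<cdot> e = x"
proof -
  obtain f where f: "is_cokernel C e f" using epic_normal assms(1) by blast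
  then have f': "f \<in> Arr C" "Dom C e = Cod C f" "nul (e \<cdot> f)" by (auto simp: is_cokernel_iff)
  have "sub_le C f (ker e)" using f' assms by (simp add: sub_le_ker_iff)
  then have "nul (x \<cdot> f)" by (rule sub_le_nul) (use assms in auto)
  then show thesis using f assms f' that by (auto simp: is_cokernel_iff)
qed

lemma epic_if_coker_nul: "f \<in> Arr C \<Longrightarrow> nul (coker f) \<Longrightarrow> epic C f"
proof (rule epicI)
  fix x assume a: "f \<in> Arr C" "nul (coker f)" "x \<in> Arr C" "Dom C x = Cod C f" "nul (x \<cdot> f)"
  obtain u where "u \<in> Arr C" "Dom C u = Cod C (coker f)" "Cod C u = Cod C x" "u \<cdot> coker f = x"
    by (rule coker_factorE[of f x]) (use a in auto)
  then show "nul x" using a nul_Comp_left[of "coker f" u] by auto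
qed

lemma monic_if_ker_nul: "f \<in> Arr C \<Longrightarrow> nul (ker f) \<Longrightarrow> monic C f"
proof (rule monicI)
  fix x assume a: "f \<in> Arr C" "nul (ker f)" "x \<in> Arr C" "Cod C x = Dom C f" "nul (f \<cdot> x)"
  obtain u where "u \<in> Arr C" "Dom C u = Dom C x" "Cod C u = Dom C (ker f)" "ker f \<cdot> u = x"
    by (rule ker_factorE[of f x]) (use a in auto)
  then show "nul x" using a nul_Comp_right[of u "ker f"] by auto
qed

text \<open>An epimorphism has zero cokernel, so the identity of the codomain factors through
  \<open>m\<close>. The factor is a right inverse, and cancelling \<open>m\<close> makes it
  two-sided.\<close>

lemma monic_epic_inverse:
  assumes "monic C m" "epic C m"
  obtains h where "h \<in> Hom C (Cod C m) (Dom C m)" "m \<cdot> h = Ident C (Cod C m)"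
    "h \<cdot> m = Ident C (Dom C m)"
proof -
  have "nul (coker m)" by (rule epicD[OF assms(2)]) (use assms in auto)
  then have "sub_le C (Ident C (Cod C m)) m" using assms by (simp add: monic_sub_le_iff)
  then obtain h where h: "h \<in> Arr C" "Dom C h = Cod C m" "Cod C h = Dom C m"
    "m \<cdot> h = Ident C (Cod C m)"
    using assms by (auto elim!: sub_leE)
  have "m \<cdot> (h \<cdot> m) = (m \<cdot> h) \<cdot> m" using h(1-3) assms by simp
  also have "\<dots> = m \<cdot> Ident C (Dom C m)" using h assms by simp
  finally have "h \<cdot> m = Ident C (Dom C m)"
    by (rule monic_cancel[OF assms(1)]) (use h assms in auto)
  then show thesis using h that by auto
qed

text \<open>The image is the kernel of the cokernel. If \<open>g\<close> kills \<open>e\<close>,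
  then \<open>f\<close> already factors through the smaller subobject
  \<open>?m \<cdot> ker g\<close>. The cokernel of that subobject kills \<open>f\<close> and so
  factors through \<open>coker f\<close>, which puts \<open>?m\<close> below
  \<open>?m \<cdot> ker g\<close>. Thus \<open>ker g\<close> has a right inverse and
  \<open>g\<close> vanishes.\<close>

lemma image_factorization:
  assumes "f \<in> Arr C"
  obtains e m where "epic C e" "monic C m" "Dom C e = Dom C f" "Cod C e = Dom C m"
    "Cod C m = Cod C f" "m \<cdot> e = f"
proof -
  let ?m = "ker (coker f)"
  obtain e where e: "e \<in> Arr C" "Dom C e = Dom C f" "Cod C e = Dom C ?m" "?m \<cdot> e = f"
    by (rule ker_factorE[of "coker f" f]) (use assms in auto)
  have "epic C e"
  proof (rule epicI)
    fix g assume g: "g \<in> Arr C" "Dom C g = Cod C e" "nul (g \<cdot> e)"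
    let ?k = "ker g"
    obtain e' where e': "e' \<in> Arr C" "Dom C e' = Dom C e" "Cod C e' = Dom C ?k" "?k \<cdot> e' = e"
      by (rule ker_factorE[of g e]) (use g e in auto)
    let ?n = "?m \<cdot> ?k"
    have n: "monic C ?n" by (rule monic_Comp) (use assms g e in auto)
    have nD: "?n \<in> Arr C" "Dom C ?n = Dom C ?k" "Cod C ?n = Cod C f"
      using assms g e by auto
    have "sub_le C f ?n" by (rule sub_leI[of e']) (use e e' g assms in auto)
    then have nc: "nul (coker ?n \<cdot> f)" using n nD assms by (simp add: monic_sub_le_iff)
    obtain u where u: "u \<in> Arr C" "Dom C u = Cod C (coker f)" "Cod C u = Cod C (coker ?n)"
      "u \<cdot> coker f = coker ?n"
      by (rule coker_factorE[of f "coker ?n"]) (use nc nD assms in auto)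
    have "nul (u \<cdot> (coker f \<cdot> ?m))" by (rule nul_Comp_left) (use u assms in auto)
    moreover have "u \<cdot> (coker f \<cdot> ?m) = coker ?n \<cdot> ?m"
      using u assms assoc[of ?m "coker f" u] by simp
    ultimately have "sub_le C ?m ?n" using n nD assms by (simp add: monic_sub_le_iff)
    then obtain h where h: "h \<in> Arr C" "Dom C h = Dom C ?m" "Cod C h = Dom C ?k"
      "?n \<cdot> h = ?m" using nD by (auto elim!: sub_leE)
    have "?m \<cdot> (?k \<cdot> h) = ?m \<cdot> Ident C (Dom C ?m)"
      using h g e assms by simp
    then have kh: "?k \<cdot> h = Ident C (Dom C ?m)"
      by (rule monic_cancel[rotated]) (use h g e assms in auto)
    have "nul ((g \<cdot> ?k) \<cdot> h)" by (rule nul_Comp_right) (use g h in auto)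
    also have "(g \<cdot> ?k) \<cdot> h = g \<cdot> (?k \<cdot> h)" using g h by simp
    also have "\<dots> = g" using kh g e by simp
    finally show "nul g" .
  qed (rule e)
  then show thesis using e assms that[of e ?m] by auto
qed

section \<open>Pullbacks, pushouts and split subobjects\<close>

text \<open>The pullback is the kernel of \<open>d = e p - x q\<close> on the direct sum. If
  \<open>g\<close> kills its projection to the domain of \<open>x\<close>, then \<open>g q\<close>
  factors through \<open>d\<close> as \<open>h d\<close>. Restricting to the summand of
  \<open>e\<close> gives \<open>h e = g q i = 0\<close>, so \<open>h\<close> vanishes and with it
  \<open>g\<close>.\<close>

lemma epic_pullback:
  assumes "epic C e" "x \<in> Arr C" "Cod C x = Cod C e"
  obtains e' z where "epic C e'" "Cod C e' = Dom C x" "z \<in> Arr C" "Dom C z = Dom C e'"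
    "Cod C z = Dom C e" "e \<cdot> z = x \<cdot> e'"
proof -
  let ?A = "Dom C e" and ?W = "Dom C x"
  obtain S where "is_biproduct C ?A ?W S" using ex_biproduct assms by force
  then obtain i j p q where b: "i \<in> Hom C ?A S" "j \<in> Hom C ?W S" "p \<in> Hom C S ?A"
    "q \<in> Hom C S ?W" "p \<cdot> i = Ident C ?A" "q \<cdot> j = Ident C ?W" "Add C (i \<cdot> p) (j \<cdot> q) = Ident C S"
    by (rule is_biproductE)
  have o: "p \<cdot> j = Zero C ?W ?A" "q \<cdot> i = Zero C ?A ?W" by (rule biproduct_orthogonal[OF b])+
  define d where "d = dif (e \<cdot> p) (x \<cdot> q)"
  have d: "d \<in> Arr C" "Dom C d = S" "Cod C d = Cod C e" using assms b by (auto simp: d_def)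
  have di: "d \<cdot> i = e" using assms b o by (simp add: d_def)
  have "epic C (d \<cdot> i)" using di assms by simp
  then have de: "epic C d" by (rule epic_Comp_left) (use b d in auto)
  let ?k = "ker d"
  have k: "?k \<in> Arr C" "Cod C ?k = S" using d by auto
  have "nul (d \<cdot> ?k)" using d by simp
  moreover have "d \<cdot> ?k = dif (e \<cdot> (p \<cdot> ?k)) (x \<cdot> (q \<cdot> ?k))"
    using assms b k by (simp add: d_def)
  ultimately have eq: "e \<cdot> (p \<cdot> ?k) = x \<cdot> (q \<cdot> ?k)"
    using nul_dif[of "e \<cdot> (p \<cdot> ?k)" "x \<cdot> (q \<cdot> ?k)"] assms b k by simp
  have "epic C (q \<cdot> ?k)"
  proof (rule epicI)
    fix g assume g: "g \<in> Arr C" "Dom C g = Cod C (q \<cdot> ?k)" "nul (g \<cdot> (q \<cdot> ?k))"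
    have gW: "Dom C g = ?W" using g(1,2) b(4) k by simp
    obtain h where h: "h \<in> Arr C" "Dom C h = Cod C d" "Cod C h = Cod C (g \<cdot> q)" "h \<cdot> d = g \<cdot> q"
      by (rule epic_factorE[OF de, of "g \<cdot> q"]) (use g(1,3) gW b(1-4) k d in simp_all)
    have "h \<cdot> e = (h \<cdot> d) \<cdot> i" using h(1,2,3) d b di by simp
    also have "\<dots> = g \<cdot> (q \<cdot> i)" unfolding h(4) using g(1) gW b by simp
    finally have "nul (h \<cdot> e)" using o g(1) gW assms by simp
    then have "nul h" by (rule epicD[OF assms(1), rotated -1]) (use h d in auto)
    then have "nul (h \<cdot> d)" by (rule nul_Comp_right[rotated -1]) (use h d in auto)
    then have "nul (g \<cdot> q)" using h by simp
    then have "nul ((g \<cdot> q) \<cdot> j)" by (rule nul_Comp_right[rotated -1]) (use b g(1) gW in auto)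
    then show "nul g" using b g(1) gW by simp
  qed (use b k in auto)
  then show thesis using that[of "q \<cdot> ?k" "p \<cdot> ?k"] eq b k by simp
qed

text \<open>An arrow is a generalized element of its codomain; lifting it to a generalized element
  of the domain of \<open>w\<close> is possible only after passing to an epimorphic cover.\<close>

lemma epic_lift:
  assumes "w \<in> Arr C" "y \<in> Arr C" "Cod C y = Cod C w" "nul (coker w \<cdot> y)"
  obtains e z where "epic C e" "Cod C e = Dom C y" "z \<in> Arr C" "Dom C z = Dom C e"
    "Cod C z = Dom C w" "w \<cdot> z = y \<cdot> e"
proof -
  obtain f m where fm: "epic C f" "monic C m" "Dom C f = Dom C w" "Cod C f = Dom C m"
    "Cod C m = Cod C w" "m \<cdot> f = w"
    by (rule image_factorization[OF assms(1)])
  have "nul ((coker m \<cdot> m) \<cdot> f)" by (rule nul_Comp_right) (use fm in auto)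
  then have cm: "nul (coker m \<cdot> w)" using fm by simp
  obtain u where u: "u \<in> Arr C" "Dom C u = Cod C (coker w)" "Cod C u = Cod C (coker m)"
    "u \<cdot> coker w = coker m"
    by (rule coker_factorE[of w "coker m"]) (use cm fm assms in auto)
  have "nul (u \<cdot> (coker w \<cdot> y))" by (rule nul_Comp_left) (use u assms in auto)
  then have "nul (coker m \<cdot> y)" using u assms assoc[of y "coker w" u] by simp
  then have "sub_le C y m" using fm assms by (simp add: monic_sub_le_iff)
  then obtain y' where y': "y' \<in> Arr C" "Dom C y' = Dom C y" "Cod C y' = Dom C m" "m \<cdot> y' = y"
    by (auto elim!: sub_leE)
  obtain e z where ez: "epic C e" "Cod C e = Dom C y'" "z \<in> Arr C" "Dom C z = Dom C e"
    "Cod C z = Dom C f" "f \<cdot> z = y' \<cdot> e"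
    by (rule epic_pullback[OF fm(1), of y']) (use y' fm in auto)
  have "w \<cdot> z = m \<cdot> (f \<cdot> z)" using fm ez assoc[of z f m] by simp
  also have "\<dots> = (m \<cdot> y') \<cdot> e" using fm ez(1-5) y'(1-3) by (simp add: ez(6))
  finally have "w \<cdot> z = y \<cdot> e" using y' by simp
  then show thesis using ez y' fm that[of e z] by auto
qed

text \<open>The pushout is the cokernel of \<open>d = i m - j f\<close> into the direct sum. If it
  kills \<open>j x\<close>, then \<open>j x = d y\<close> for some \<open>y\<close>; projecting to
  the summand of \<open>m\<close> gives \<open>m y = p j x = 0\<close>, so \<open>y\<close> and
  hence \<open>x\<close> vanish.\<close>

lemma monic_pushout:
  assumes "monic C m" "f \<in> Arr C" "Dom C f = Dom C m"
  obtains k h where "monic C k" "Dom C k = Cod C f" "h \<in> Arr C" "Dom C h = Cod C m"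
    "Cod C h = Cod C k" "h \<cdot> m = k \<cdot> f"
proof -
  let ?A = "Cod C m" and ?W = "Cod C f"
  obtain S where "is_biproduct C ?A ?W S" using ex_biproduct assms by force
  then obtain i j p q where b: "i \<in> Hom C ?A S" "j \<in> Hom C ?W S" "p \<in> Hom C S ?A"
    "q \<in> Hom C S ?W" "p \<cdot> i = Ident C ?A" "q \<cdot> j = Ident C ?W" "Add C (i \<cdot> p) (j \<cdot> q) = Ident C S"
    by (rule is_biproductE)
  have o: "p \<cdot> j = Zero C ?W ?A" "q \<cdot> i = Zero C ?A ?W" by (rule biproduct_orthogonal[OF b])+
  have pi: "\<And>x. \<lbrakk>x \<in> Arr C; Cod C x = ?A\<rbrakk> \<Longrightarrow> p \<cdot> (i \<cdot> x) = x"
    using b assms assoc[of _ i p] by auto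
  have pj: "\<And>x. \<lbrakk>x \<in> Arr C; Cod C x = ?W\<rbrakk> \<Longrightarrow> p \<cdot> (j \<cdot> x) = Zero C (Dom C x) ?A"
    using b(1-4) o assms assoc[of _ j p] by auto
  have qj: "\<And>x. \<lbrakk>x \<in> Arr C; Cod C x = ?W\<rbrakk> \<Longrightarrow> q \<cdot> (j \<cdot> x) = x"
    using b assms assoc[of _ j q] by auto
  define d where "d = dif (i \<cdot> m) (j \<cdot> f)"
  have d: "d \<in> Arr C" "Dom C d = Dom C m" "Cod C d = S" using assms b by (auto simp: d_def)
  have pd: "p \<cdot> d = m" using assms b pi[of m] pj[of f] by (simp add: d_def)
  have "monic C (p \<cdot> d)" using pd assms by simp
  then have dm: "monic C d" by (rule monic_Comp_right) (use b d in auto)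
  let ?c = "coker d"
  have c: "?c \<in> Arr C" "Dom C ?c = S" using d by auto
  have "nul (?c \<cdot> d)" using d by simp
  moreover have "?c \<cdot> d = dif (?c \<cdot> (i \<cdot> m)) (?c \<cdot> (j \<cdot> f))"
    using assms b(1-4) c by (simp add: d_def)
  ultimately have eq: "?c \<cdot> (i \<cdot> m) = ?c \<cdot> (j \<cdot> f)"
    using nul_dif[of "?c \<cdot> (i \<cdot> m)" "?c \<cdot> (j \<cdot> f)"] assms b(1-4) c by simp
  have "monic C (?c \<cdot> j)"
  proof (rule monicI)
    fix x assume x: "x \<in> Arr C" "Cod C x = Dom C (?c \<cdot> j)" "nul ((?c \<cdot> j) \<cdot> x)"
    have xW: "Cod C x = ?W" using x(1,2) b(1-4) c by simp
    have "nul (?c \<cdot> (j \<cdot> x))" using x(1,3) xW b(2) c by simp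
    then have "sub_le C (j \<cdot> x) d" using dm monic_sub_le_iff[of d "j \<cdot> x"] b(1-4) x(1) xW d by simp
    then obtain y where y: "y \<in> Arr C" "Dom C y = Dom C x" "Cod C y = Dom C m" "d \<cdot> y = j \<cdot> x"
      using d x(1) xW b(1-4) by (auto elim!: sub_leE)
    have "m \<cdot> y = p \<cdot> (d \<cdot> y)" using pd y(1-3) d b(1-4) assoc[of y d p] by simp
    then have "nul (m \<cdot> y)" using pj[of x] x(1) xW y assms by simp
    then have "nul y" by (rule monicD[OF assms(1), rotated -1]) (use y in auto)
    then have "nul (d \<cdot> y)" by (rule nul_Comp_left[rotated -1]) (use y d in auto)
    then have "nul (q \<cdot> (d \<cdot> y))" by (rule nul_Comp_left[rotated -1]) (use y(1-3) d b in auto)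
    then show "nul x" using qj[of x] y x(1) xW by simp
  qed (use b c in auto)
  then show thesis using that[of "?c \<cdot> j" "?c \<cdot> i"] eq b(1-4) c assms by simp
qed

text \<open>The identity minus the idempotent \<open>k \<cdot> r\<close> is killed by
  \<open>r\<close>, so it factors through \<open>ker r\<close>. The factor is the projection to the
  second summand.\<close>

lemma retract_biproduct:
  assumes "k \<in> Hom C K E" "r \<in> Hom C E K" "r \<cdot> k = Ident C K"
  shows "is_biproduct C (Dom C (ker r)) K E"
proof -
  have ob: "K \<in> Ob C" "E \<in> Ob C" using assms by auto
  let ?j = "ker r"
  let ?d = "dif (Ident C E) (k \<cdot> r)"
  have kr: "\<And>x. \<lbrakk>x \<in> Arr C; Cod C x = K\<rbrakk> \<Longrightarrow> r \<cdot> (k \<cdot> x) = x"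
    using assms assoc[of _ k r] by auto
  have d: "?d \<in> Arr C" "Dom C ?d = E" "Cod C ?d = E" using assms ob by auto
  have "r \<cdot> ?d = Zero C E K" using assms ob kr[of r] by simp
  then have "nul (r \<cdot> ?d)" using ob by simp
  then obtain q where q: "q \<in> Arr C" "Dom C q = E" "Cod C q = Dom C ?j" "?j \<cdot> q = ?d"
    using ker_factorE[of r ?d] d assms by auto
  have rj: "r \<cdot> ?j = Zero C (Dom C ?j) K" using nulD[OF ker_arr(4)[of r]] assms by auto
  have "?j \<cdot> (q \<cdot> ?j) = ?d \<cdot> ?j" using assms q assoc[of ?j q ?j] by simp
  also have "\<dots> = ?j \<cdot> Ident C (Dom C ?j)" using assms(1,2) ob rj by simp
  finally have "q \<cdot> ?j = Ident C (Dom C ?j)"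
    by (rule monic_cancel[rotated]) (use q assms in auto)
  moreover have "Add C (?j \<cdot> q) (k \<cdot> r) = Ident C E"
    unfolding q(4) using assms ob by simp
  ultimately show ?thesis
    unfolding is_biproduct_def using assms q(1-3) ob
      ker_arr(2,3)[of r] by (metis Dom_in_Ob Hom_iff)
qed

end

section \<open>Small sets\<close>

lemma small_image:
  assumes "small U X" shows "small U (f ` X)"
  using assms card_of_image ordLeq_ordLess_trans unfolding small_def by blast

lemma small_subset:
  assumes "small U X" "Y \<subseteq> X" shows "small U Y"
  using assms card_of_mono1 ordLeq_ordLess_trans unfolding small_def by blast

lemma universe_type_infinite:
  fixes U :: "'u itself"
  assumes "universe_type U" shows "infinite (UNIV :: 'u set)"
proof -
  have "natLeq \<le>o |UNIV :: 'u set|"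
    using assms ordLess_imp_ordLeq unfolding universe_type_def by blast
  then show ?thesis using infinite_iff_natLeq_ordLeq by blast
qed

text \<open>Regularity of the cardinality of \<open>'u\<close> enters through this fact.\<close>

lemma small_UN:
  fixes U :: "'u itself"
  assumes U: "universe_type U" and "small U I" and "\<And>i. i \<in> I \<Longrightarrow> small U (A i)"
  shows "small U (\<Union>i \<in> I. A i)"
proof -
  have "Cinfinite |UNIV :: 'u set|"
    using universe_type_infinite[OF U] card_of_Card_order by (simp add: cinfinite_def Field_card_of)
  then show ?thesis
    using card_of_UNION_ordLess_infinite_Field_regularCard assms
    unfolding small_def universe_type_def by blast
qed

lemma small_finite:
  assumes "universe_type U" "finite X" shows "small U X"
  using assms finite_iff_ordLess_natLeq[of X] ordLess_transitive
  unfolding small_def universe_type_def by blast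

text \<open>Sequences are small because the cardinality of \<open>'u\<close> is strictly above that
  of the natural numbers; this admits direct limits of countable towers.\<close>

lemma small_nat:
  assumes "universe_type U" shows "small U (X :: nat set)"
proof -
  have "|X| \<le>o natLeq"
    using card_of_mono1[of X UNIV] card_of_nat ordLeq_ordIso_trans by blast
  then show ?thesis
    using assms ordLeq_ordLess_trans unfolding small_def universe_type_def by blast
qed

lemma small_Un:
  assumes "universe_type U" "small U X" "small U Y" shows "small U (X \<union> Y)"
proof -
  have "small U (\<Union>b \<in> {True, False}. if b then X else Y)"
    by (rule small_UN) (use assms small_finite[OF assms(1), of "{True, False}"] in auto)
  then show ?thesis by (simp add: Un_commute)
qed

lemma small_Times:
  assumes "universe_type U" "small U X" "small U Y" shows "small U (X \<times> Y)"
proof -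
  have "X \<times> Y = (\<Union>x \<in> X. Pair x ` Y)" by auto
  then show ?thesis using small_UN[OF assms(1,2), of "\<lambda>x. Pair x ` Y"] small_image[OF assms(3)] by metis
qed

text \<open>Each size is handled by induction, and the sizes form a small set. For the full power
  set a strong limit cardinal would be required, so only finite subsets serve as indices
  later.\<close>

lemma small_Fpow:
  assumes U: "universe_type U" and "small U X" shows "small U (Fpow X)"
proof -
  define P where "P n = {F. F \<subseteq> X \<and> finite F \<and> card F = n}" for n
  have "small U (P n)" for n
  proof (induction n)
    case 0
    have "P 0 = {{}}" by (auto simp: P_def)
    then show ?case using small_finite[OF U, of "{{}}"] by simp
  next
    case (Suc n)
    have "P (Suc n) \<subseteq> (\<lambda>(x, F). insert x F) ` (X \<times> P n)"
    proof
      fix F assume F: "F \<in> P (Suc n)"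
      then obtain x G where "F = insert x G" "x \<notin> G" "card G = n" "finite G"
        by (auto simp: P_def card_Suc_eq)
      then show "F \<in> (\<lambda>(x, F). insert x F) ` (X \<times> P n)"
        using F by (auto simp: P_def intro!: image_eqI[of _ _ "(x, G)"])
    qed
    then show ?case
      using small_subset small_image small_Times[OF U assms(2) Suc] by blast
  qed
  then have "small U (\<Union>n. P n)" by (intro small_UN U small_nat) auto
  moreover have "Fpow X \<subseteq> (\<Union>n. P n)" by (auto simp: Fpow_def P_def)
  ultimately show ?thesis by (rule small_subset)
qed

text \<open>Coproducts and exactness of direct limits are postulated for index sets inside
  \<open>'u\<close>; this injection transports index sets of any type there.\<close>

lemma small_imp_inj:
  fixes U :: "'u itself"
  assumes "small U X"
  obtains \<phi> :: "'a \<Rightarrow> 'u" where "inj_on \<phi> X"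
proof -
  have "|X| \<le>o |UNIV :: 'u set|" using assms ordLess_imp_ordLeq unfolding small_def by blast
  then show thesis using that card_of_ordLeq[of X "UNIV :: 'u set"] by blast
qed

section \<open>Direct limits\<close>

lemma directed_setD:
  assumes "directed_set I lq"
  shows "I \<noteq> {}" "\<And>i. i \<in> I \<Longrightarrow> lq i i"
    "\<And>i j k. \<lbrakk>i \<in> I; j \<in> I; k \<in> I; lq i j; lq j k\<rbrakk> \<Longrightarrow> lq i k"
    "\<And>i j. \<lbrakk>i \<in> I; j \<in> I\<rbrakk> \<Longrightarrow> \<exists>k \<in> I. lq i k \<and> lq j k"
  using assms unfolding directed_set_def by blast+

lemma directed_systemD:
  assumes "directed_system C I lq D d"
  shows "directed_set I lq" "\<And>i. i \<in> I \<Longrightarrow> D i \<in> Ob C"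
    "\<And>i j. \<lbrakk>i \<in> I; j \<in> I; lq i j\<rbrakk> \<Longrightarrow> d i j \<in> Hom C (D i) (D j)"
    "\<And>i. i \<in> I \<Longrightarrow> d i i = Ident C (D i)"
    "\<And>i j k. \<lbrakk>i \<in> I; j \<in> I; k \<in> I; lq i j; lq j k\<rbrakk> \<Longrightarrow> d j k \<cdot>\<^bsub>C\<^esub> d i j = d i k"
  using assms unfolding directed_system_def by blast+

lemma is_direct_limitD:
  assumes "is_direct_limit C I lq D d L l"
  shows "L \<in> Ob C" "\<And>i. i \<in> I \<Longrightarrow> l i \<in> Hom C (D i) L"
    "\<And>i j. \<lbrakk>i \<in> I; j \<in> I; lq i j\<rbrakk> \<Longrightarrow> l j \<cdot>\<^bsub>C\<^esub> d i j = l i"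
    "\<And>X f. \<lbrakk>X \<in> Ob C; \<And>i. i \<in> I \<Longrightarrow> f i \<in> Hom C (D i) X;
        \<And>i j. \<lbrakk>i \<in> I; j \<in> I; lq i j\<rbrakk> \<Longrightarrow> f j \<cdot>\<^bsub>C\<^esub> d i j = f i\<rbrakk> \<Longrightarrow>
        \<exists>!u. u \<in> Hom C L X \<and> (\<forall>i \<in> I. u \<cdot>\<^bsub>C\<^esub> l i = f i)"
  using assms unfolding is_direct_limit_def by blast+

lemma directed_system_reindex:
  assumes "\<And>i. i \<in> I \<Longrightarrow> \<psi> (\<phi> i) = i" "directed_system C I lq D d"
  shows "directed_system C (\<phi> ` I) (\<lambda>a b. lq (\<psi> a) (\<psi> b)) (\<lambda>a. D (\<psi> a)) (\<lambda>a b. d (\<psi> a) (\<psi> b))"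
proof -
  note d = directed_systemD[OF assms(2)]
  note dir = directed_setD[OF d(1)]
  have "directed_set (\<phi> ` I) (\<lambda>a b. lq (\<psi> a) (\<psi> b))"
    unfolding directed_set_def
  proof (intro conjI ballI impI)
    fix a b assume "a \<in> \<phi> ` I" "b \<in> \<phi> ` I"
    then obtain i j where "i \<in> I" "j \<in> I" "a = \<phi> i" "b = \<phi> j" by blast
    moreover then obtain k where "k \<in> I" "lq i k" "lq j k" using dir(4) by blast
    ultimately show "\<exists>k \<in> \<phi> ` I. lq (\<psi> a) (\<psi> k) \<and> lq (\<psi> b) (\<psi> k)"
      using assms(1) by (intro bexI[of _ "\<phi> k"]) auto
  next
    fix a b c assume abc: "a \<in> \<phi> ` I" "b \<in> \<phi> ` I" "c \<in> \<phi> ` I"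
      "lq (\<psi> a) (\<psi> b) \<and> lq (\<psi> b) (\<psi> c)"
    then have "\<psi> a \<in> I" "\<psi> b \<in> I" "\<psi> c \<in> I" using assms(1) by auto
    then show "lq (\<psi> a) (\<psi> c)" using abc(4) dir(3) by blast
  qed (use dir(1,2) assms(1) in auto)
  then show ?thesis
    unfolding directed_system_def
  proof (intro conjI ballI impI)
    fix a b c assume abc: "a \<in> \<phi> ` I" "b \<in> \<phi> ` I" "c \<in> \<phi> ` I"
      "lq (\<psi> a) (\<psi> b) \<and> lq (\<psi> b) (\<psi> c)"
    then have "\<psi> a \<in> I" "\<psi> b \<in> I" "\<psi> c \<in> I" using assms(1) by auto
    then show "d (\<psi> b) (\<psi> c) \<cdot>\<^bsub>C\<^esub> d (\<psi> a) (\<psi> b) = d (\<psi> a) (\<psi> c)" using abc(4) d(5) by blast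
  qed (use d(2-4) assms(1) in auto)
qed

lemma is_direct_limit_reindex:
  assumes \<psi>: "\<And>i. i \<in> I \<Longrightarrow> \<psi> (\<phi> i) = i" and L: "is_direct_limit C I lq D d L l"
  shows "is_direct_limit C (\<phi> ` I) (\<lambda>a b. lq (\<psi> a) (\<psi> b)) (\<lambda>a. D (\<psi> a)) (\<lambda>a b. d (\<psi> a) (\<psi> b))
    L (\<lambda>a. l (\<psi> a))"
  unfolding is_direct_limit_def
proof (intro conjI ballI allI impI)
  fix X f
  assume "X \<in> Ob C" and f: "(\<forall>i\<in>\<phi> ` I. f i \<in> Hom C (D (\<psi> i)) X) \<and>
    (\<forall>i\<in>\<phi> ` I. \<forall>j\<in>\<phi> ` I. lq (\<psi> i) (\<psi> j) \<longrightarrow> f j \<cdot>\<^bsub>C\<^esub> d (\<psi> i) (\<psi> j) = f i)"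
  then have "\<exists>!u. u \<in> Hom C L X \<and> (\<forall>i \<in> I. u \<cdot>\<^bsub>C\<^esub> l i = f (\<phi> i))"
    by (intro is_direct_limitD(4)[OF L]) (auto simp: \<psi>)
  then show "\<exists>!u. u \<in> Hom C L X \<and> (\<forall>i\<in>\<phi> ` I. u \<cdot>\<^bsub>C\<^esub> l (\<psi> i) = f i)"
    by (simp add: \<psi>)
qed (use is_direct_limitD[OF L] \<psi> in auto)

text \<open>Generators are left to later locales, because two different generating sets of the same
  category will be used.\<close>

locale grothendieck = abelian_category C for C :: "('o, 'm) category" (structure) +
  fixes U :: "'u itself"
  assumes universe: "universe_type U"
    and small_coproducts: "has_small_coproducts U C"
    and exact_limits: "exact_direct_limits U C"
begin

text \<open>Uniqueness of induced arrows is recorded in its additive form: an arrow that vanishes on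
  all injections vanishes.\<close>

lemma ex_coproduct:
  assumes "small U I" "\<And>i. i \<in> I \<Longrightarrow> D i \<in> Ob C"
  obtains S \<iota> where "S \<in> Ob C" "\<And>i. i \<in> I \<Longrightarrow> \<iota> i \<in> Hom C (D i) S"
    "\<And>X f. \<lbrakk>X \<in> Ob C; \<And>i. i \<in> I \<Longrightarrow> f i \<in> Hom C (D i) X\<rbrakk>
      \<Longrightarrow> \<exists>u \<in> Hom C S X. \<forall>i \<in> I. u \<cdot> \<iota> i = f i"
    "\<And>g. \<lbrakk>g \<in> Arr C; Dom C g = S; \<And>i. i \<in> I \<Longrightarrow> nul (g \<cdot> \<iota> i)\<rbrakk> \<Longrightarrow> nul g"
proof -
  obtain \<phi> :: "'a \<Rightarrow> 'u" where \<phi>: "inj_on \<phi> I" using small_imp_inj[OF assms(1)] .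
  define \<psi> where "\<psi> = inv_into I \<phi>"
  have \<psi>: "\<And>i. i \<in> I \<Longrightarrow> \<psi> (\<phi> i) = i" using \<phi> by (simp add: \<psi>_def)
  have "small U (\<phi> ` I)" "\<forall>a \<in> \<phi> ` I. D (\<psi> a) \<in> Ob C"
    using small_image[OF assms(1)] assms(2) \<psi> by auto
  then obtain S \<iota>' where cp: "is_coproduct C (\<phi> ` I) (\<lambda>a. D (\<psi> a)) S \<iota>'"
    using small_coproducts[unfolded has_small_coproducts_def, rule_format,
      of "\<phi> ` I" "\<lambda>a. D (\<psi> a)"] by blast
  define \<iota> where "\<iota> i = \<iota>' (\<phi> i)" for i
  have S: "S \<in> Ob C" and \<iota>: "\<And>i. i \<in> I \<Longrightarrow> \<iota> i \<in> Hom C (D i) S"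
    using cp \<psi> by (auto simp: is_coproduct_def \<iota>_def)
  have uni: "\<exists>!u. u \<in> Hom C S X \<and> (\<forall>i \<in> I. u \<cdot> \<iota> i = f i)"
    if "X \<in> Ob C" "\<And>i. i \<in> I \<Longrightarrow> f i \<in> Hom C (D i) X" for X f
  proof -
    have 1: "\<forall>a \<in> \<phi> ` I. f (\<psi> a) \<in> Hom C (D (\<psi> a)) X" using that(2) \<psi> by auto
    have 2: "\<forall>f. (\<forall>a \<in> \<phi> ` I. f a \<in> Hom C (D (\<psi> a)) X) \<longrightarrow>
      (\<exists>!u. u \<in> Hom C S X \<and> (\<forall>a \<in> \<phi> ` I. u \<cdot> \<iota>' a = f a))"
      using cp that(1) unfolding is_coproduct_def by (simp del: Hom_iff)
    have "\<exists>!u. u \<in> Hom C S X \<and> (\<forall>a \<in> \<phi> ` I. u \<cdot> \<iota>' a = f (\<psi> a))"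
      by (rule mp[OF spec[OF 2, of "\<lambda>a. f (\<psi> a)"] 1])
    then show ?thesis by (simp add: \<psi> \<iota>_def)
  qed
  show thesis
  proof (rule that[OF S \<iota>])
    fix X f assume "X \<in> Ob C" "\<And>i. i \<in> I \<Longrightarrow> f i \<in> Hom C (D i) X"
    then show "\<exists>u \<in> Hom C S X. \<forall>i \<in> I. u \<cdot> \<iota> i = f i" using uni by blast
  next
    fix g assume g: "g \<in> Arr C" "Dom C g = S" "\<And>i. i \<in> I \<Longrightarrow> nul (g \<cdot> \<iota> i)"
    let ?z = "Zero C S (Cod C g)"
    have z: "g \<cdot> \<iota> i = Zero C (D i) (Cod C g)" "?z \<cdot> \<iota> i = Zero C (D i) (Cod C g)"
      if "i \<in> I" for i
      using nulD[OF g(3)[OF that], of "D i" "Cod C g"] \<iota>[OF that] g S by auto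
    have "\<exists>!u. u \<in> Hom C S (Cod C g) \<and> (\<forall>i \<in> I. u \<cdot> \<iota> i = Zero C (D i) (Cod C g))"
      by (rule uni) (use g assms in auto)
    moreover have "g \<in> Hom C S (Cod C g)" "?z \<in> Hom C S (Cod C g)" using g S by auto
    ultimately have "g = ?z" using z by metis
    then show "nul g" using g S by (metis nul_Zero Cod_in_Ob)
  qed
qed

section \<open>Simultaneous cokernels and images of small families\<close>

text \<open>This is the cokernel of the arrow that the family induces on the coproduct of its
  domains; the members of \<open>F\<close> serve as their own indices.\<close>

lemma family_coker:
  assumes "small U F" "B \<in> Ob C" "\<And>x. x \<in> F \<Longrightarrow> x \<in> Arr C \<and> Cod C x = B"
  obtains c where "epic C c" "Dom C c = B" "\<And>x. x \<in> F \<Longrightarrow> nul (c \<cdot> x)"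
    "\<And>g. \<lbrakk>g \<in> Arr C; Dom C g = B; \<And>x. x \<in> F \<Longrightarrow> nul (g \<cdot> x)\<rbrakk>
      \<Longrightarrow> \<exists>u \<in> Hom C (Cod C c) (Cod C g). u \<cdot> c = g"
proof -
  obtain S \<iota> where S: "S \<in> Ob C" "\<And>x. x \<in> F \<Longrightarrow> \<iota> x \<in> Hom C (Dom C x) S"
    and ex: "\<And>X f. \<lbrakk>X \<in> Ob C; \<And>x. x \<in> F \<Longrightarrow> f x \<in> Hom C (Dom C x) X\<rbrakk>
      \<Longrightarrow> \<exists>u \<in> Hom C S X. \<forall>x \<in> F. u \<cdot> \<iota> x = f x"
    and nul: "\<And>g. \<lbrakk>g \<in> Arr C; Dom C g = S; \<And>x. x \<in> F \<Longrightarrow> nul (g \<cdot> \<iota> x)\<rbrakk> \<Longrightarrow> nul g"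
    by (rule ex_coproduct[of F "Dom C"]) (use assms in auto)
  obtain u where u: "u \<in> Hom C S B" "\<And>x. x \<in> F \<Longrightarrow> u \<cdot> \<iota> x = x"
    using ex[of B "\<lambda>x. x"] assms by auto
  show thesis
  proof (rule that[of "coker u"])
    fix x assume x: "x \<in> F"
    have "nul ((coker u \<cdot> u) \<cdot> \<iota> x)" by (rule nul_Comp_right) (use u(1) S(2)[OF x] in auto)
    then show "nul (coker u \<cdot> x)" using u(1) S(2)[OF x] by (simp add: u(2)[OF x])
  next
    fix g assume g: "g \<in> Arr C" "Dom C g = B" "\<And>x. x \<in> F \<Longrightarrow> nul (g \<cdot> x)"
    have "nul (g \<cdot> u)"
    proof (rule nul)
      fix x assume x: "x \<in> F"
      show "nul ((g \<cdot> u) \<cdot> \<iota> x)" using g(1,2) g(3)[OF x] u(1) u(2)[OF x] S(2)[OF x] by simp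
    qed (use g u in auto)
    then show "\<exists>v \<in> Hom C (Cod C (coker u)) (Cod C g). v \<cdot> coker u = g"
      using coker_factorE[of u g] g(1,2) u(1) by (metis Hom_iff)
  qed (use u in auto)
qed

text \<open>The sum of the images is the kernel of the simultaneous cokernel. The last clause says
  that the members of \<open>F\<close>, seen as arrows to the domain of \<open>s\<close>, cover it.
  If \<open>g\<close> kills them all, then they factor through \<open>s \<cdot> ker g\<close>; as
  for a single image, this puts \<open>s\<close> below \<open>s \<cdot> ker g\<close>.\<close>

lemma family_image:
  assumes "small U F" "B \<in> Ob C" "\<And>x. x \<in> F \<Longrightarrow> x \<in> Arr C \<and> Cod C x = B"
  obtains s where "monic C s" "Cod C s = B" "\<And>x. x \<in> F \<Longrightarrow> sub_le C x s"
    "\<And>g. \<lbrakk>g \<in> Arr C; Dom C g = Dom C s;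
      \<And>x u. \<lbrakk>x \<in> F; u \<in> Arr C; Dom C u = Dom C x; Cod C u = Dom C s; s \<cdot> u = x\<rbrakk> \<Longrightarrow> nul (g \<cdot> u)\<rbrakk> \<Longrightarrow> nul g"
proof -
  obtain c where c: "epic C c" "Dom C c = B" "\<And>x. x \<in> F \<Longrightarrow> nul (c \<cdot> x)"
    "\<And>g. \<lbrakk>g \<in> Arr C; Dom C g = B; \<And>x. x \<in> F \<Longrightarrow> nul (g \<cdot> x)\<rbrakk>
      \<Longrightarrow> \<exists>u \<in> Hom C (Cod C c) (Cod C g). u \<cdot> c = g"
    using family_coker[OF assms] by blast
  let ?s = "ker c"
  have s: "monic C ?s" "Cod C ?s = B" "?s \<in> Arr C" using c by auto
  show thesis
  proof (rule that[of ?s])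
    fix x assume x: "x \<in> F"
    then show "sub_le C x ?s" using sub_le_ker_iff[of c x] c assms by auto
  next
    fix g assume g: "g \<in> Arr C" "Dom C g = Dom C ?s"
      and 0: "\<And>x u. \<lbrakk>x \<in> F; u \<in> Arr C; Dom C u = Dom C x; Cod C u = Dom C ?s; ?s \<cdot> u = x\<rbrakk>
        \<Longrightarrow> nul (g \<cdot> u)"
    let ?t = "?s \<cdot> ker g"
    have t: "monic C ?t" "Cod C ?t = B" "Dom C ?t = Dom C (ker g)"
      using monic_Comp[of "ker g" ?s] s g by auto
    have le: "sub_le C x ?t" if x: "x \<in> F" for x
    proof -
      have xa: "x \<in> Arr C" "Cod C x = B" using assms(3)[OF x] by auto
      obtain u where u: "u \<in> Arr C" "Dom C u = Dom C x" "Cod C u = Dom C ?s" "?s \<cdot> u = x"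
        using ker_factorE[of c x] c x xa by auto
      then have "sub_le C u (ker g)" using 0[OF x u] g by (simp add: sub_le_ker_iff)
      then show ?thesis using sub_le_Comp_left[of u "ker g" ?s] u g s by simp
    qed
    have "\<exists>u \<in> Hom C (Cod C c) (Cod C (coker ?t)). u \<cdot> c = coker ?t"
    proof (rule c(4))
      fix x assume x: "x \<in> F"
      show "nul (coker ?t \<cdot> x)"
        using monic_sub_le_iff[OF t(1), of x] le[OF x] assms(3)[OF x] t(2) by simp
    qed (use t in simp_all)
    then obtain u where u: "u \<in> Hom C (Cod C c) (Cod C (coker ?t))" "u \<cdot> c = coker ?t" by blast
    have "nul (u \<cdot> (c \<cdot> ?s))" by (rule nul_Comp_left) (use u(1) c(1,2) in auto)
    also have "u \<cdot> (c \<cdot> ?s) = coker ?t \<cdot> ?s"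
      using u(1) c(1,2) s assoc[of ?s c u] by (simp add: u(2)[symmetric])
    finally have "sub_le C ?s ?t" using monic_sub_le_iff[OF t(1), of ?s] s t(2) by simp
    then obtain h where h: "h \<in> Arr C" "Dom C h = Dom C ?s" "Cod C h = Dom C (ker g)" "?t \<cdot> h = ?s"
      using t(3) by (auto elim!: sub_leE)
    have "?s \<cdot> (ker g \<cdot> h) = ?s \<cdot> Ident C (Dom C ?s)" using h s g by simp
    then have kh: "ker g \<cdot> h = Ident C (Dom C ?s)"
      by (rule monic_cancel[OF s(1)]) (use h(1-3) g s in auto)
    have "nul ((g \<cdot> ker g) \<cdot> h)" by (rule nul_Comp_right) (use g h(1-3) in auto)
    then show "nul g" using kh g h(1-3) by simp
  qed (use s in auto)
qed

section \<open>Construction and exactness of direct limits\<close>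

text \<open>The limit is the quotient of the coproduct by the differences \<open>r (i, j)\<close>
  between each injection and its detour through a later index.\<close>

lemma ex_direct_limit:
  assumes sm: "small U I" and sys: "directed_system C I lq D d"
  obtains L l where "is_direct_limit C I lq D d L l"
proof -
  note dir = directed_setD[OF directed_systemD(1)[OF sys]] and sysD = directed_systemD(2-5)[OF sys]
  obtain S \<iota> where S: "S \<in> Ob C" and \<iota>: "\<And>i. i \<in> I \<Longrightarrow> \<iota> i \<in> Hom C (D i) S"
    and ex: "\<And>X f. \<lbrakk>X \<in> Ob C; \<And>i. i \<in> I \<Longrightarrow> f i \<in> Hom C (D i) X\<rbrakk>
      \<Longrightarrow> \<exists>u \<in> Hom C S X. \<forall>i \<in> I. u \<cdot> \<iota> i = f i"
    and nul: "\<And>g. \<lbrakk>g \<in> Arr C; Dom C g = S; \<And>i. i \<in> I \<Longrightarrow> nul (g \<cdot> \<iota> i)\<rbrakk> \<Longrightarrow> nul g"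
    by (rule ex_coproduct[of I D, OF sm sysD(1)]) blast+
  define r where "r = (\<lambda>(i, j). dif (\<iota> j \<cdot> d i j) (\<iota> i))"
  define F where "F = r ` {(i, j) \<in> I \<times> I. lq i j}"
  have r: "\<iota> j \<cdot> d i j \<in> Hom C (D i) S" "r (i, j) \<in> Hom C (D i) S" if "i \<in> I" "j \<in> I" "lq i j" for i j
    using \<iota>[of i] \<iota>[of j] sysD(2)[of i j] that by (auto simp: r_def)
  have "small U F" unfolding F_def
    by (rule small_image, rule small_subset[OF small_Times[OF universe sm sm]]) auto
  then obtain c where c: "epic C c" "Dom C c = S" "\<And>x. x \<in> F \<Longrightarrow> nul (c \<cdot> x)"
    "\<And>g. \<lbrakk>g \<in> Arr C; Dom C g = S; \<And>x. x \<in> F \<Longrightarrow> nul (g \<cdot> x)\<rbrakk>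
      \<Longrightarrow> \<exists>u \<in> Hom C (Cod C c) (Cod C g). u \<cdot> c = g"
    by (rule family_coker[of F S]) (use r S in \<open>auto simp: F_def\<close>)
  define l where "l i = c \<cdot> \<iota> i" for i
  have l: "l i \<in> Hom C (D i) (Cod C c)" if "i \<in> I" for i
    using \<iota>[OF that] c by (simp add: l_def)
  have eq: "nul (g \<cdot> r (i, j)) \<longleftrightarrow> (g \<cdot> \<iota> j) \<cdot> d i j = g \<cdot> \<iota> i"
    if "i \<in> I" "j \<in> I" "lq i j" "g \<in> Arr C" "Dom C g = S" for g i j
    using r(1)[OF that(1-3)] \<iota>[OF that(1)] \<iota>[OF that(2)] sysD(2)[OF that(1-3)] that(4,5)
    by (simp add: r_def nul_dif)
  have "is_direct_limit C I lq D d (Cod C c) l"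
    unfolding is_direct_limit_def
  proof (intro conjI ballI allI impI)
    fix i j assume ij: "i \<in> I" "j \<in> I" "lq i j"
    then have "nul (c \<cdot> r (i, j))" using c(3) by (auto simp: F_def)
    then show "l j \<cdot> d i j = l i" using eq[OF ij] c(1,2) unfolding l_def by simp
  next
    fix X f assume X: "X \<in> Ob C" and f: "(\<forall>i\<in>I. f i \<in> Hom C (D i) X) \<and>
      (\<forall>i\<in>I. \<forall>j\<in>I. lq i j \<longrightarrow> f j \<cdot> d i j = f i)"
    then obtain g where g: "g \<in> Hom C S X" "\<And>i. i \<in> I \<Longrightarrow> g \<cdot> \<iota> i = f i" using ex[of X f] by blast
    have "\<exists>u \<in> Hom C (Cod C c) (Cod C g). u \<cdot> c = g"
    proof (rule c(4))
      fix x assume "x \<in> F"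
      then obtain i j where ij: "i \<in> I" "j \<in> I" "lq i j" "x = r (i, j)" by (auto simp: F_def)
      then show "nul (g \<cdot> x)" using eq[of i j g] g f by auto
    qed (use g in auto)
    then obtain u where u: "u \<in> Hom C (Cod C c) X" "u \<cdot> c = g" using g by auto
    show "\<exists>!u. u \<in> Hom C (Cod C c) X \<and> (\<forall>i\<in>I. u \<cdot> l i = f i)"
    proof (rule ex1I[of _ u], intro conjI ballI)
      fix i assume i: "i \<in> I"
      have "u \<cdot> l i = (u \<cdot> c) \<cdot> \<iota> i" using u(1) c(1,2) \<iota>[OF i] by (simp add: l_def)
      then show "u \<cdot> l i = f i" using u(2) g(2)[OF i] by simp
    next
      fix v assume v: "v \<in> Hom C (Cod C c) X \<and> (\<forall>i\<in>I. v \<cdot> l i = f i)"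
      have "nul (dif (v \<cdot> c) g)"
      proof (rule nul)
        fix i assume i: "i \<in> I"
        have "v \<cdot> (c \<cdot> \<iota> i) = g \<cdot> \<iota> i" using v g(2)[OF i] i by (auto simp: l_def)
        then show "nul (dif (v \<cdot> c) g \<cdot> \<iota> i)"
          using v g(1) c(1,2) \<iota>[OF i] X sysD(1)[OF i] by simp
      qed (use v g(1) c(1,2) in auto)
      then have "v \<cdot> c = u \<cdot> c" using nul_dif[of "v \<cdot> c" g] v g(1) u c(1,2) by auto
      then show "v = u" by (rule epic_cancel[OF c(1)]) (use u v in auto)
    qed (use u in auto)
  qed (use l c in auto)
  then show thesis by (rule that)
qed

text \<open>Exactness is postulated for short exact sequences, so the monomorphisms are completed by
  the system of their cokernels and its limit.\<close>

lemma direct_limit_monic: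
  assumes sm: "small U I"
    and D: "directed_system C I lq D d" and E: "directed_system C I lq E e"
    and L: "is_direct_limit C I lq D d L l" and M: "is_direct_limit C I lq E e M m"
    and \<alpha>: "system_morphism C I lq D d E e \<alpha>" "\<And>i. i \<in> I \<Longrightarrow> monic C (\<alpha> i)"
    and u: "u \<in> Hom C L M" "\<And>i. i \<in> I \<Longrightarrow> u \<cdot> l i = m i \<cdot> \<alpha> i"
  shows "monic C u"
proof -
  note Ed = directed_systemD[OF E] and Dd = directed_systemD[OF D]
  note dir = directed_setD[OF Ed(1)]
  have \<alpha>i: "\<alpha> i \<in> Hom C (D i) (E i)" if "i \<in> I" for i
    using \<alpha>(1) that unfolding system_morphism_def by blast
  have \<alpha>ij: "e i j \<cdot> \<alpha> i = \<alpha> j \<cdot> d i j" if "i \<in> I" "j \<in> I" "lq i j" for i j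
    using \<alpha>(1) that unfolding system_morphism_def by blast
  define \<beta> where "\<beta> i = coker (\<alpha> i)" for i
  define F where "F i = Cod C (\<beta> i)" for i
  have \<beta>: "\<beta> i \<in> Hom C (E i) (F i)" "epic C (\<beta> i)" "F i \<in> Ob C" if "i \<in> I" for i
    using \<alpha>i[OF that] by (auto simp: \<beta>_def F_def)
  have "\<exists>f. \<forall>i\<in>I. \<forall>j\<in>I. lq i j \<longrightarrow> f i j \<in> Hom C (F i) (F j) \<and> f i j \<cdot> \<beta> i = \<beta> j \<cdot> e i j"
  proof -
    have "\<exists>f. lq i j \<longrightarrow> f \<in> Hom C (F i) (F j) \<and> f \<cdot> \<beta> i = \<beta> j \<cdot> e i j" if ij: "i \<in> I" "j \<in> I" for i j
    proof (cases "lq i j")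
      case True
      have "nul ((\<beta> j \<cdot> \<alpha> j) \<cdot> d i j)"
        by (rule nul_Comp_right) (use Dd(3)[OF ij True] \<alpha>i[OF ij(2)] in \<open>auto simp: \<beta>_def\<close>)
      then have "nul ((\<beta> j \<cdot> e i j) \<cdot> \<alpha> i)"
        using Dd(3)[OF ij True] Ed(3)[OF ij True] \<alpha>i[OF ij(1)] \<alpha>i[OF ij(2)] \<beta>(1)[OF ij(2)]
        by (simp add: \<alpha>ij[OF ij True])
      then show ?thesis
        using coker_factorE[of "\<alpha> i" "\<beta> j \<cdot> e i j"] Ed(3)[OF ij True] \<alpha>i[OF ij(1)] \<beta>(1)[OF ij(1)] \<beta>(1)[OF ij(2)]
        by (metis Comp_arr(1,2,3) Hom_iff \<beta>_def coker_arr(3))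
    qed auto
    then show ?thesis by metis
  qed
  then obtain f where f: "\<And>i j. \<lbrakk>i \<in> I; j \<in> I; lq i j\<rbrakk> \<Longrightarrow> f i j \<in> Hom C (F i) (F j)"
    "\<And>i j. \<lbrakk>i \<in> I; j \<in> I; lq i j\<rbrakk> \<Longrightarrow> f i j \<cdot> \<beta> i = \<beta> j \<cdot> e i j" by blast
  have Fs: "directed_system C I lq F f"
    unfolding directed_system_def
  proof (intro conjI ballI impI)
    fix i assume i: "i \<in> I"
    note ii = dir(2)[OF i]
    have "f i i \<cdot> \<beta> i = Ident C (F i) \<cdot> \<beta> i"
      using f(2)[OF i i ii] Ed(4)[OF i] \<beta>[OF i] by simp
    then show "f i i = Ident C (F i)"
      by (rule epic_cancel[OF \<beta>(2)[OF i]]) (use f(1)[OF i i ii] \<beta>[OF i] in auto)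
  next
    fix i j k assume i: "i \<in> I" and j: "j \<in> I" and k: "k \<in> I" and jk: "lq i j \<and> lq j k"
    then have ij: "lq i j" and jk: "lq j k" and ik: "lq i k" using dir(3)[OF i j k] by auto
    have "(f j k \<cdot> f i j) \<cdot> \<beta> i = (f j k \<cdot> \<beta> j) \<cdot> e i j"
      using f[OF i j ij] f(1)[OF j k jk] \<beta>[OF i] \<beta>[OF j] Ed(3)[OF i j ij] by simp
    also have "\<dots> = \<beta> k \<cdot> (e j k \<cdot> e i j)"
      unfolding f(2)[OF j k jk] using \<beta>[OF k] Ed(3)[OF i j ij] Ed(3)[OF j k jk] by simp
    also have "\<dots> = f i k \<cdot> \<beta> i" using Ed(5)[OF i j k ij jk] f(2)[OF i k ik] by simp
    finally show "f j k \<cdot> f i j = f i k"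
      by (rule epic_cancel[OF \<beta>(2)[OF i]])
        (use f(1)[OF i j ij] f(1)[OF j k jk] f(1)[OF i k ik] \<beta>[OF i] in auto)
  qed (use f \<beta> Ed in auto)
  obtain N n where N: "is_direct_limit C I lq F f N n" using ex_direct_limit[OF sm Fs] .
  note Nd = is_direct_limitD[OF N] and Md = is_direct_limitD[OF M]
  have "\<exists>!v. v \<in> Hom C M N \<and> (\<forall>i \<in> I. v \<cdot> m i = n i \<cdot> \<beta> i)"
  proof (rule Md(4))
    fix i j assume ij: "i \<in> I" "j \<in> I" "lq i j"
    have "(n j \<cdot> \<beta> j) \<cdot> e i j = (n j \<cdot> f i j) \<cdot> \<beta> i"
      using Nd(2)[OF ij(2)] \<beta>[OF ij(1)] \<beta>[OF ij(2)] Ed(3)[OF ij] f[OF ij] by simp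
    then show "(n j \<cdot> \<beta> j) \<cdot> e i j = n i \<cdot> \<beta> i" using Nd(3)[OF ij] by simp
  next
    fix i assume "i \<in> I"
    then show "n i \<cdot> \<beta> i \<in> Hom C (E i) N" using Nd(2)[of i] \<beta>[of i] by simp
  qed (use Nd in auto)
  then obtain v where v: "v \<in> Hom C M N" "\<And>i. i \<in> I \<Longrightarrow> v \<cdot> m i = n i \<cdot> \<beta> i" by blast
  \<comment> \<open>From here on all three systems are reindexed along an injection of
    \<open>I\<close> into \<open>'u\<close>, where the exactness axiom applies.\<close>
  obtain \<phi> :: "'a \<Rightarrow> 'u" where \<phi>: "inj_on \<phi> I" using small_imp_inj[OF sm] .
  define \<psi> where "\<psi> = inv_into I \<phi>"
  have \<psi>: "\<And>i. i \<in> I \<Longrightarrow> \<psi> (\<phi> i) = i" using \<phi> by (simp add: \<psi>_def)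
  let ?lq = "\<lambda>a b. lq (\<psi> a) (\<psi> b)" and ?d = "\<lambda>a b. d (\<psi> a) (\<psi> b)" and ?e = "\<lambda>a b. e (\<psi> a) (\<psi> b)"
    and ?f = "\<lambda>a b. f (\<psi> a) (\<psi> b)" and ?D = "\<lambda>a. D (\<psi> a)" and ?E = "\<lambda>a. E (\<psi> a)" and ?F = "\<lambda>a. F (\<psi> a)"
  have se: "short_exact C (\<alpha> i) (\<beta> i)" if i: "i \<in> I" for i
    using \<alpha>(2)[OF i] \<alpha>i[OF i] \<beta>[OF i] is_cokernel_coker[of "\<alpha> i"] monic_sub_le_iff[OF \<alpha>(2)[OF i]]
    unfolding short_exact_def is_kernel_iff \<beta>_def by auto
  have "short_exact C u v"
  proof (rule exact_limits[unfolded exact_direct_limits_def, rule_format,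
        where I = "\<phi> ` I" and lq = ?lq and D = ?D and d = ?d and E = ?E and e = ?e and F = ?F and f = ?f
        and \<alpha> = "\<lambda>a. \<alpha> (\<psi> a)" and \<beta> = "\<lambda>a. \<beta> (\<psi> a)" and L = L and l = "\<lambda>a. l (\<psi> a)"
        and M = M and m = "\<lambda>a. m (\<psi> a)" and N = N and n = "\<lambda>a. n (\<psi> a)"], intro conjI)
    show "system_morphism C (\<phi> ` I) ?lq ?D ?d ?E ?e (\<lambda>a. \<alpha> (\<psi> a))"
      "system_morphism C (\<phi> ` I) ?lq ?E ?e ?F ?f (\<lambda>a. \<beta> (\<psi> a))"
      unfolding system_morphism_def using \<alpha>i \<alpha>ij \<beta>(1) f(2) \<psi> by auto
  qed (use small_image[OF sm] se u v \<psi> in \<open>auto intro!: directed_system_reindex[where \<psi> = \<psi>, OF \<psi>]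
      is_direct_limit_reindex[where \<psi> = \<psi>, OF \<psi>] simp del: Hom_iff intro: D E Fs L M N\<close>)
  then show ?thesis by (simp add: short_exact_def is_kernel_iff)
qed

end

section \<open>Directed covers and coproducts of monomorphisms\<close>

context grothendieck
begin

text \<open>Each transition arrow exists because the later quotient kills the kernel of the earlier
  one, and functoriality follows by cancelling the epimorphism \<open>c i\<close>.\<close>

lemma quotient_system:
  assumes dir: "directed_set I lq" and c: "\<And>i. i \<in> I \<Longrightarrow> epic C (c i) \<and> Dom C (c i) = B"
    and ex: "\<And>i j. \<lbrakk>i \<in> I; j \<in> I; lq i j\<rbrakk> \<Longrightarrow> nul (c j \<cdot> ker (c i))"
  obtains e where "directed_system C I lq (\<lambda>i. Cod C (c i)) e"
    "\<And>i j. \<lbrakk>i \<in> I; j \<in> I; lq i j\<rbrakk> \<Longrightarrow> e i j \<cdot> c i = c j"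
proof -
  note d = directed_setD[OF dir]
  have "\<exists>e. lq i j \<longrightarrow> e \<in> Hom C (Cod C (c i)) (Cod C (c j)) \<and> e \<cdot> c i = c j"
    if "i \<in> I" "j \<in> I" for i j
    using epic_factorE[of "c i" "c j"] ex[OF that] c[OF that(1)] c[OF that(2)]
    by (metis Hom_iff epic_arr)
  then obtain e where e: "\<And>i j. \<lbrakk>i \<in> I; j \<in> I; lq i j\<rbrakk> \<Longrightarrow> e i j \<in> Hom C (Cod C (c i)) (Cod C (c j))"
    "\<And>i j. \<lbrakk>i \<in> I; j \<in> I; lq i j\<rbrakk> \<Longrightarrow> e i j \<cdot> c i = c j" by metis
  have "directed_system C I lq (\<lambda>i. Cod C (c i)) e"
    unfolding directed_system_def
  proof (intro conjI ballI impI)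
    fix i assume i: "i \<in> I"
    have "e i i \<cdot> c i = Ident C (Cod C (c i)) \<cdot> c i" using e(2)[OF i i d(2)[OF i]] c[OF i] by simp
    then show "e i i = Ident C (Cod C (c i))"
      by (rule epic_cancel[rotated]) (use e(1)[OF i i d(2)[OF i]] c[OF i] in auto)
  next
    fix i j k assume i: "i \<in> I" and j: "j \<in> I" and k: "k \<in> I" and jk: "lq i j \<and> lq j k"
    then have ij: "lq i j" and jk: "lq j k" and ik: "lq i k" using d(3)[OF i j k] by auto
    have "(e j k \<cdot> e i j) \<cdot> c i = e i k \<cdot> c i"
      using e[OF i j ij] e[OF j k jk] e(2)[OF i k ik] c[OF i] by simp
    then show "e j k \<cdot> e i j = e i k"
      by (rule epic_cancel[rotated]) (use e(1)[OF i j ij] e(1)[OF j k jk] e(1)[OF i k ik] c[OF i] in auto)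
  qed (use dir e c in auto)
  then show thesis using e(2) that by blast
qed

text \<open>The inverse images under \<open>w\<close> of a directed cover of \<open>B\<close> cover the domain of \<open>w\<close>. The
  quotients of the domain by these inverse images embed into the quotients of \<open>B\<close>, whose direct
  limit is zero.\<close>

lemma directed_cover_pullback:
  assumes sm: "small U I" and dir: "directed_set I lq" and B: "B \<in> Ob C"
    and b: "\<And>i. i \<in> I \<Longrightarrow> b i \<in> Arr C \<and> Cod C (b i) = B"
    and le: "\<And>i j. \<lbrakk>i \<in> I; j \<in> I; lq i j\<rbrakk> \<Longrightarrow> nul (coker (b j) \<cdot> b i)"
    and cover: "\<And>g. \<lbrakk>g \<in> Arr C; Dom C g = B; \<And>i. i \<in> I \<Longrightarrow> nul (g \<cdot> b i)\<rbrakk> \<Longrightarrow> nul g"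
    and w: "w \<in> Arr C" "Cod C w = B" and g: "g \<in> Arr C" "Dom C g = Dom C w"
    and gk: "\<And>i k. \<lbrakk>i \<in> I; k \<in> Arr C; Cod C k = Dom C w; nul (coker (b i) \<cdot> (w \<cdot> k))\<rbrakk> \<Longrightarrow> nul (g \<cdot> k)"
  shows "nul g"
proof -
  note d = directed_setD[OF dir]
  define c where "c i = coker (b i)" for i
  have c: "epic C (c i) \<and> Dom C (c i) = B" if "i \<in> I" for i
    using b[OF that] by (simp add: c_def)
  have ck: "nul (c j \<cdot> ker (c i))" if ij: "i \<in> I" "j \<in> I" "lq i j" for i j
  proof -
    obtain u where u: "u \<in> Arr C" "Dom C u = Cod C (c i)" "u \<cdot> c i = c j"
      using coker_factorE[of "b i" "c j"] b[OF ij(1)] c[OF ij(2)] le[OF ij] unfolding c_def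
      by (metis epic_arr)
    have "nul (u \<cdot> (c i \<cdot> ker (c i)))" by (rule nul_Comp_left) (use u(1,2) c[OF ij(1)] in auto)
    then show ?thesis using u c[OF ij(1)] assoc[of "ker (c i)" "c i" u] by simp
  qed
  obtain e where e: "directed_system C I lq (\<lambda>i. Cod C (c i)) e"
    "\<And>i j. \<lbrakk>i \<in> I; j \<in> I; lq i j\<rbrakk> \<Longrightarrow> e i j \<cdot> c i = c j"
    by (rule quotient_system[of I lq c B, OF dir c ck]) (use that in blast)+
  \<comment> \<open>The quotient of the domain of \<open>w\<close> by the inverse image of
    \<open>b i\<close> is realised as the image of \<open>c i \<cdot> w\<close>, which comes with
    its embedding \<open>m i\<close> into the quotient of \<open>B\<close>.\<close>
  have "\<exists>f m. epic C f \<and> monic C m \<and> Dom C f = Dom C w \<and> Cod C f = Dom C m \<and> Cod C m = Cod C (c i)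
    \<and> m \<cdot> f = c i \<cdot> w" if "i \<in> I" for i
    by (rule image_factorization[of "c i \<cdot> w"]) (use c[OF that] w in auto)
  then obtain f m where fm: "\<And>i. i \<in> I \<Longrightarrow> epic C (f i) \<and> monic C (m i) \<and> Dom C (f i) = Dom C w \<and>
    Cod C (f i) = Dom C (m i) \<and> Cod C (m i) = Cod C (c i) \<and> m i \<cdot> f i = c i \<cdot> w" by metis
  have f: "epic C (f i) \<and> Dom C (f i) = Dom C w" if "i \<in> I" for i using fm[OF that] by simp
  have fk: "nul (f j \<cdot> ker (f i))" if ij: "i \<in> I" "j \<in> I" "lq i j" for i j
  proof -
    let ?k = "ker (f i)"
    note fi = fm[OF ij(1)] and fj = fm[OF ij(2)] and ci = c[OF ij(1)] and cj = c[OF ij(2)]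
    have k: "?k \<in> Arr C" "Cod C ?k = Dom C w" using fi by auto
    have eij: "e i j \<in> Hom C (Cod C (c i)) (Cod C (c j))" using directed_systemD(3)[OF e(1) ij] .
    have "nul ((e i j \<cdot> m i) \<cdot> (f i \<cdot> ?k))" by (rule nul_Comp_left) (use fi eij in auto)
    also have "(e i j \<cdot> m i) \<cdot> (f i \<cdot> ?k) = e i j \<cdot> ((m i \<cdot> f i) \<cdot> ?k)"
      using fi eij k assoc[of ?k "f i" "m i"] by simp
    also have "\<dots> = (e i j \<cdot> c i) \<cdot> (w \<cdot> ?k)" using fi eij k ci w by simp
    also have "\<dots> = (m j \<cdot> f j) \<cdot> ?k" using e(2)[OF ij] fj k cj w by simp
    also have "\<dots> = m j \<cdot> (f j \<cdot> ?k)" using fj k by (intro assoc) auto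
    finally show ?thesis by (rule monicD[rotated -1]) (use fj k in auto)
  qed
  obtain d' where d': "directed_system C I lq (\<lambda>i. Cod C (f i)) d'"
    "\<And>i j. \<lbrakk>i \<in> I; j \<in> I; lq i j\<rbrakk> \<Longrightarrow> d' i j \<cdot> f i = f j"
    by (rule quotient_system[of I lq f "Dom C w", OF dir f fk]) (use that in blast)+
  obtain Z where Z: "zero_object C Z" using ex_zero_object by blast
  then have ZOb: "Z \<in> Ob C" by (simp add: zero_object_iff)
  have limZ: "is_direct_limit C I lq (\<lambda>i. Cod C (c i)) e Z (\<lambda>i. Zero C (Cod C (c i)) Z)"
    unfolding is_direct_limit_def
  proof (intro conjI ballI allI impI)
    fix X h assume X: "X \<in> Ob C" and h: "(\<forall>i\<in>I. h i \<in> Hom C (Cod C (c i)) X) \<and>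
      (\<forall>i\<in>I. \<forall>j\<in>I. lq i j \<longrightarrow> h j \<cdot> e i j = h i)"
    have ha: "h i \<in> Arr C" "Dom C (h i) = Cod C (c i)" "Cod C (h i) = X" if "i \<in> I" for i
      using h that by auto
    have hc: "h j \<cdot> c j = h i \<cdot> c i" if ij: "i \<in> I" "j \<in> I" "lq i j" for i j
    proof -
      have "h i \<cdot> c i = (h j \<cdot> e i j) \<cdot> c i" using h ij by simp
      also have "\<dots> = h j \<cdot> (e i j \<cdot> c i)"
        using ha[OF ij(2)] directed_systemD(3)[OF e(1) ij] c[OF ij(1)] by (intro assoc) auto
      finally show ?thesis using e(2)[OF ij] by simp
    qed
    \<comment> \<open>By directedness, all members of a compatible family restrict to the same arrow
      on \<open>B\<close>. It kills every \<open>b j\<close>, so it vanishes; hence zero is a limit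
      of the quotients of \<open>B\<close>.\<close>
    have hn: "nul (h i)" if i: "i \<in> I" for i
    proof -
      have "nul (h i \<cdot> c i)"
      proof (rule cover)
        fix j assume j: "j \<in> I"
        obtain k where k: "k \<in> I" "lq i k" "lq j k" using d(4) i j by blast
        have "h i \<cdot> c i = h j \<cdot> c j" using hc[OF i k(1,2)] hc[OF j k(1,3)] by simp
        moreover have "nul (h j \<cdot> (c j \<cdot> b j))"
          by (rule nul_Comp_left) (use ha[OF j] c[OF j] b[OF j] in \<open>auto simp: c_def\<close>)
        ultimately show "nul ((h i \<cdot> c i) \<cdot> b j)" using ha[OF j] c[OF j] b[OF j] by simp
      qed (use ha[OF i] c[OF i] in auto)
      then show ?thesis by (rule epicD[rotated -1]) (use ha[OF i] c[OF i] in auto)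
    qed
    show "\<exists>!u. u \<in> Hom C Z X \<and> (\<forall>i\<in>I. u \<cdot> Zero C (Cod C (c i)) Z = h i)"
    proof (rule ex1I[of _ "Zero C Z X"])
      show "Zero C Z X \<in> Hom C Z X \<and> (\<forall>i\<in>I. Zero C Z X \<cdot> Zero C (Cod C (c i)) Z = h i)"
        using X ZOb nulD[OF hn] ha c by auto
    next
      fix u assume "u \<in> Hom C Z X \<and> (\<forall>i\<in>I. u \<cdot> Zero C (Cod C (c i)) Z = h i)"
      then show "u = Zero C Z X" using nul_from_zero_object[OF Z, of u] nulD[of u Z X] by auto
    qed
  next
    fix i j assume ij: "i \<in> I" "j \<in> I" "lq i j"
    show "Zero C (Cod C (c j)) Z \<cdot> e i j = Zero C (Cod C (c i)) Z"
      using directed_systemD(3)[OF e(1) ij] ZOb c[OF ij(2)] by simp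
  qed (use ZOb c in auto)
  obtain L l where L: "is_direct_limit C I lq (\<lambda>i. Cod C (f i)) d' L l"
    using ex_direct_limit[OF sm d'(1)] .
  note Ld = is_direct_limitD[OF L]
  have "monic C (Zero C L Z)"
  proof (rule direct_limit_monic[OF sm d'(1) e(1) L limZ])
    show "system_morphism C I lq (\<lambda>i. Cod C (f i)) d' (\<lambda>i. Cod C (c i)) e m"
      unfolding system_morphism_def
    proof (intro conjI ballI impI)
      fix i j assume ij: "i \<in> I" "j \<in> I" "lq i j"
      note fi = fm[OF ij(1)] and fj = fm[OF ij(2)] and ci = c[OF ij(1)] and cj = c[OF ij(2)]
      have eij: "e i j \<in> Hom C (Cod C (c i)) (Cod C (c j))" using directed_systemD(3)[OF e(1) ij] .
      have dij: "d' i j \<in> Hom C (Cod C (f i)) (Cod C (f j))" using directed_systemD(3)[OF d'(1) ij] .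
      have "(e i j \<cdot> m i) \<cdot> f i = e i j \<cdot> (m i \<cdot> f i)" using eij fi by (intro assoc) auto
      also have "\<dots> = (e i j \<cdot> c i) \<cdot> w" using eij fi ci w by simp
      also have "\<dots> = m j \<cdot> (d' i j \<cdot> f i)" using e(2)[OF ij] d'(2)[OF ij] fj by simp
      also have "\<dots> = (m j \<cdot> d' i j) \<cdot> f i" using dij fi fj by (intro assoc[symmetric]) auto
      finally show "e i j \<cdot> m i = m j \<cdot> d' i j"
        by (rule epic_cancel[rotated]) (use eij dij fi fj in auto)
    qed (use fm in auto)
    fix i assume i: "i \<in> I"
    show "Zero C L Z \<cdot> l i = Zero C (Cod C (c i)) Z \<cdot> m i"
      using Ld(1) Ld(2)[OF i] ZOb fm[OF i] c[OF i] by simp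
  qed (use fm Ld ZOb in auto)
  then have Lz: "zero_object C L"
    using zero_object_nul_monic[of "Zero C L Z"] Ld(1) ZOb by auto
  \<comment> \<open>Since \<open>g\<close> kills the inverse image of each \<open>b i\<close>, it
    descends to every quotient. The descended arrows are compatible and so factor through the limit
    \<open>L\<close>, which is zero.\<close>
  have "\<exists>h. h \<in> Hom C (Cod C (f i)) (Cod C g) \<and> h \<cdot> f i = g" if i: "i \<in> I" for i
  proof -
    let ?k = "ker (f i)"
    note fi = fm[OF i] and ci = c[OF i]
    have k: "?k \<in> Arr C" "Cod C ?k = Dom C w" using fi by auto
    have "nul (m i \<cdot> (f i \<cdot> ?k))" by (rule nul_Comp_left) (use fi in auto)
    also have "m i \<cdot> (f i \<cdot> ?k) = (m i \<cdot> f i) \<cdot> ?k"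
      using fi k by (intro assoc[symmetric]) auto
    also have "\<dots> = c i \<cdot> (w \<cdot> ?k)" using fi k ci w by simp
    finally have "nul (g \<cdot> ?k)" using gk[OF i k] by (simp add: c_def)
    then show ?thesis using epic_factorE[of "f i" g] fi g by (metis Hom_iff)
  qed
  then obtain h where h: "\<And>i. i \<in> I \<Longrightarrow> h i \<in> Hom C (Cod C (f i)) (Cod C g)"
    "\<And>i. i \<in> I \<Longrightarrow> h i \<cdot> f i = g" by metis
  have "\<exists>!u. u \<in> Hom C L (Cod C g) \<and> (\<forall>i\<in>I. u \<cdot> l i = h i)"
  proof (rule Ld(4))
    fix i j assume ij: "i \<in> I" "j \<in> I" "lq i j"
    have dij: "d' i j \<in> Hom C (Cod C (f i)) (Cod C (f j))" using directed_systemD(3)[OF d'(1) ij] .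
    have "(h j \<cdot> d' i j) \<cdot> f i = h i \<cdot> f i"
      using h[OF ij(1)] h[OF ij(2)] dij d'(2)[OF ij] f[OF ij(1)] by simp
    then show "h j \<cdot> d' i j = h i"
      by (rule epic_cancel[rotated]) (use h(1)[OF ij(1)] h(1)[OF ij(2)] dij f[OF ij(1)] in auto)
  qed (use h g in auto)
  then obtain u where u: "u \<in> Hom C L (Cod C g)" "\<And>i. i \<in> I \<Longrightarrow> u \<cdot> l i = h i" by blast
  obtain i where i: "i \<in> I" using d(1) by blast
  have "nul u" using nul_from_zero_object[OF Lz] u(1) by simp
  then have "nul (u \<cdot> l i)" by (rule nul_Comp_right[rotated -1]) (use u(1) Ld(2)[OF i] in auto)
  then have "nul (h i \<cdot> f i)"
    unfolding u(2)[OF i] by (rule nul_Comp_right[rotated -1]) (use h(1)[OF i] f[OF i] in auto)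
  then show "nul g" using h(2)[OF i] by simp
qed

section \<open>Coproducts of monomorphisms\<close>

text \<open>A coproduct is covered by its finite partial sums, which form a directed family, and an
  arrow into a finite partial sum is determined by its projections. So the part of \<open>w\<close>
  inside each partial sum vanishes.\<close>

lemma coproduct_projections_jointly_monic:
  assumes sm: "small U I" and S: "S \<in> Ob C"
    and \<iota>: "\<And>i. i \<in> I \<Longrightarrow> \<iota> i \<in> Hom C (D i) S"
    and cover: "\<And>g. \<lbrakk>g \<in> Arr C; Dom C g = S; \<And>i. i \<in> I \<Longrightarrow> nul (g \<cdot> \<iota> i)\<rbrakk> \<Longrightarrow> nul g"
    and p: "\<And>i. i \<in> I \<Longrightarrow> p i \<in> Hom C S (D i)"
      "\<And>i j. \<lbrakk>i \<in> I; j \<in> I\<rbrakk> \<Longrightarrow> p i \<cdot> \<iota> j = (if i = j then Ident C (D i) else Zero C (D j) (D i))"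
    and w: "w \<in> Arr C" "Cod C w = S" "\<And>i. i \<in> I \<Longrightarrow> nul (p i \<cdot> w)"
  shows "nul w"
proof -
  \<comment> \<open>\<open>P F e\<close> describes the idempotent \<open>e\<close> that projects
    \<open>S\<close> onto the partial sum over \<open>F\<close>, without finite sums of arrows: it
    fixes the injections in \<open>F\<close>, kills what the projections in \<open>F\<close> kill,
    and its image is covered by the injections in \<open>F\<close>.\<close>
  define P where "P F e \<longleftrightarrow> e \<in> Hom C S S \<and> (\<forall>i \<in> F. e \<cdot> \<iota> i = \<iota> i) \<and>
    (\<forall>x \<in> Arr C. Cod C x = S \<longrightarrow> (\<forall>i \<in> F. nul (p i \<cdot> x)) \<longrightarrow> nul (e \<cdot> x)) \<and>
    (\<forall>g \<in> Arr C. Dom C g = S \<longrightarrow> (\<forall>i \<in> F. nul (g \<cdot> \<iota> i)) \<longrightarrow> nul (g \<cdot> e))" for F e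
  have Dob: "D i \<in> Ob C" if "i \<in> I" for i using \<iota>[OF that] Dom_in_Ob by (metis Hom_iff)
  have "\<exists>e. P F e" if "finite F" "F \<subseteq> I" for F
    using that
  proof (induction F rule: finite_induct)
    case empty
    have "P {} (Zero C S S)" using S by (auto simp: P_def)
    then show ?case by blast
  next
    case (insert t F)
    then obtain e where e: "P F e" by auto
    let ?q = "\<iota> t \<cdot> p t" and ?e = "Add C e (\<iota> t \<cdot> p t)"
    have tI: "t \<in> I" and FI: "\<And>i. i \<in> F \<Longrightarrow> i \<in> I \<and> i \<noteq> t" using insert by auto
    note it = \<iota>[OF tI] and pt = p(1)[OF tI]
    have ea: "e \<in> Arr C" "Dom C e = S" "Cod C e = S" using e by (auto simp: P_def)
    have "P (insert t F) ?e"
      unfolding P_def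
    proof (intro conjI ballI impI)
      fix i assume "i \<in> insert t F"
      then consider "i = t" | "i \<in> F" by auto
      then show "?e \<cdot> \<iota> i = \<iota> i"
      proof cases
        case 1
        have "nul (p j \<cdot> \<iota> t)" if "j \<in> F" for j
          using p(2)[OF _ tI, of j] FI[OF that] Dob tI by simp
        then have "nul (e \<cdot> \<iota> t)" using e it by (simp add: P_def)
        then have "e \<cdot> \<iota> t = Zero C (D t) S" using nulD ea it by simp
        then show ?thesis using 1 p(2)[OF tI tI] ea it pt by simp
      next
        case 2
        have "e \<cdot> \<iota> i = \<iota> i" using e 2 by (simp add: P_def)
        then show ?thesis using p(2)[OF tI, of i] FI[OF 2] ea it pt \<iota>[of i] Dob by auto
      qed
    next
      fix x assume x: "x \<in> Arr C" "Cod C x = S" "\<forall>i \<in> insert t F. nul (p i \<cdot> x)"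
      have "nul (e \<cdot> x)" using e x by (simp add: P_def)
      then have 1: "e \<cdot> x = Zero C (Dom C x) S" using nulD ea x by simp
      have "p t \<cdot> x = Zero C (Dom C x) (D t)" using nulD[of "p t \<cdot> x"] x pt by simp
      then show "nul (?e \<cdot> x)" using 1 ea x(1,2) pt it S by simp
    next
      fix g assume g: "g \<in> Arr C" "Dom C g = S" "\<forall>i \<in> insert t F. nul (g \<cdot> \<iota> i)"
      have "nul (g \<cdot> e)" using e g by (simp add: P_def)
      then have 1: "g \<cdot> e = Zero C S (Cod C g)" using nulD[of "g \<cdot> e"] ea g by simp
      have "nul ((g \<cdot> \<iota> t) \<cdot> p t)" by (rule nul_Comp_right) (use g pt it in auto)
      then have "g \<cdot> ?q = Zero C S (Cod C g)"
        using nulD[of "g \<cdot> ?q"] g(1,2) pt it by simp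
      then show "nul (g \<cdot> ?e)" using 1 ea g(1,2) pt it S by simp
    qed (use ea it pt in auto)
    then show ?case by blast
  qed
  then have "\<exists>b. \<forall>F \<in> Fpow I. P F (b F)" by (intro bchoice) (auto simp: Fpow_def)
  then obtain b where b: "\<And>F. F \<in> Fpow I \<Longrightarrow> P F (b F)" by blast
  have ba: "b F \<in> Arr C" "Dom C (b F) = S" "Cod C (b F) = S" if "F \<in> Fpow I" for F
    using b[OF that] by (auto simp: P_def)
  have b1: "b F \<cdot> \<iota> i = \<iota> i" if "F \<in> Fpow I" "i \<in> F" for F i
    using b[OF that(1)] that(2) by (simp add: P_def)
  have b2: "nul (b F \<cdot> x)" if "F \<in> Fpow I" "x \<in> Arr C" "Cod C x = S" "\<And>i. i \<in> F \<Longrightarrow> nul (p i \<cdot> x)" for F x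
    using b[OF that(1)] that(2-) by (simp add: P_def)
  have b3: "nul (g \<cdot> b F)" if "F \<in> Fpow I" "g \<in> Arr C" "Dom C g = S" "\<And>i. i \<in> F \<Longrightarrow> nul (g \<cdot> \<iota> i)" for F g
    using b[OF that(1)] that(2-) by (simp add: P_def)
  have FI: "i \<in> I" if "F \<in> Fpow I" "i \<in> F" for F i using that by (auto simp: Fpow_def)
  show ?thesis
  proof (rule directed_cover_pullback[OF small_Fpow[OF universe sm] _ S, where lq = "(\<subseteq>)" and b = b])
    show "directed_set (Fpow I) (\<subseteq>)"
      unfolding directed_set_def
    proof (intro conjI ballI)
      fix F F' assume "F \<in> Fpow I" "F' \<in> Fpow I"
      then show "\<exists>k\<in>Fpow I. F \<subseteq> k \<and> F' \<subseteq> k" by (intro bexI[of _ "F \<union> F'"]) (auto simp: Fpow_def)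
    qed (auto simp: Fpow_not_empty)
  next
    fix F F' assume F: "F \<in> Fpow I" "F' \<in> Fpow I" "F \<subseteq> F'"
    show "nul (coker (b F') \<cdot> b F)"
    proof (rule b3[OF F(1)])
      fix i assume i: "i \<in> F"
      have "nul ((coker (b F') \<cdot> b F') \<cdot> \<iota> i)"
        by (rule nul_Comp_right) (use ba[OF F(2)] \<iota>[OF FI[OF F(1) i]] in auto)
      then show "nul (coker (b F') \<cdot> \<iota> i)"
        using ba[OF F(2)] \<iota>[OF FI[OF F(1) i]] b1[OF F(2)] i F(3) by auto
    qed (use ba[OF F(2)] in auto)
  next
    fix g assume g: "g \<in> Arr C" "Dom C g = S" "\<And>F. F \<in> Fpow I \<Longrightarrow> nul (g \<cdot> b F)"
    show "nul g"
    proof (rule cover[OF g(1,2)])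
      fix i assume i: "i \<in> I"
      then have F: "{i} \<in> Fpow I" by (simp add: Fpow_def)
      have "nul ((g \<cdot> b {i}) \<cdot> \<iota> i)" by (rule nul_Comp_right) (use g F ba[OF F] \<iota>[OF i] in auto)
      then show "nul (g \<cdot> \<iota> i)" using g(1,2) ba[OF F] \<iota>[OF i] b1[OF F] by simp
    qed
  next
    fix F k assume F: "F \<in> Fpow I" and k: "k \<in> Arr C" "Cod C k = Dom C w"
      and n: "nul (coker (b F) \<cdot> (w \<cdot> k))"
    let ?b = "b F" and ?y = "w \<cdot> k"
    note ba = ba[OF F]
    have y: "?y \<in> Arr C" "Cod C ?y = S" "Dom C ?y = Dom C k" using w k by auto
    obtain e z where ez: "epic C e" "Cod C e = Dom C ?y" "z \<in> Arr C" "Dom C z = Dom C e"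
      "Cod C z = Dom C ?b" "?b \<cdot> z = ?y \<cdot> e"
      by (rule epic_lift[of ?b ?y]) (use ba y n in auto)
    \<comment> \<open>After the cover \<open>e\<close>, the arrow \<open>?y\<close> comes from
      \<open>?b\<close> and is therefore fixed by the idempotent \<open>?b\<close>. But
      \<open>?b\<close> kills \<open>w\<close>, hence also \<open>?y\<close>.\<close>
    have "nul (dif ?b (Ident C S) \<cdot> ?b)"
    proof (rule b3[OF F])
      fix i assume i: "i \<in> F"
      show "nul (dif ?b (Ident C S) \<cdot> \<iota> i)"
        using ba S \<iota>[OF FI[OF F i]] b1[OF F i] Dob[OF FI[OF F i]] by simp
    qed (use ba S in auto)
    then have idem: "?b \<cdot> ?b = ?b" using ba S by (simp add: nul_dif)
    have "nul (?b \<cdot> w)" by (rule b2[OF F]) (use w FI[OF F] in auto)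
    then have "nul ((?b \<cdot> w) \<cdot> (k \<cdot> e))"
      by (rule nul_Comp_right[rotated -1]) (use ba w(1,2) k y ez in auto)
    also have "(?b \<cdot> w) \<cdot> (k \<cdot> e) = ?b \<cdot> (?b \<cdot> z)"
      using ba w(1,2) k y ez by simp
    also have "\<dots> = (?b \<cdot> ?b) \<cdot> z" using ba ez by (intro assoc[symmetric]) auto
    also have "\<dots> = ?y \<cdot> e" using idem ez by simp
    finally show "nul ?y" by (rule epicD[OF ez(1), rotated -1]) (use y ez in auto)
  qed (use ba w in auto)
qed

text \<open>This is the passage from AB5 to AB4. The projections satisfy
  \<open>q i \<mu> = m i p i\<close>, so an arrow killed by \<open>\<mu>\<close> has projections
  killed by the monomorphisms \<open>m i\<close>, and the projections are jointly monic.\<close>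

lemma coproduct_monic:
  assumes sm: "small U I" and m: "\<And>i. i \<in> I \<Longrightarrow> monic C (m i)"
  obtains \<mu> \<iota> \<kappa> where "monic C \<mu>"
    "\<And>i. i \<in> I \<Longrightarrow> \<iota> i \<in> Hom C (Dom C (m i)) (Dom C \<mu>)"
    "\<And>i. i \<in> I \<Longrightarrow> \<kappa> i \<in> Hom C (Cod C (m i)) (Cod C \<mu>)"
    "\<And>i. i \<in> I \<Longrightarrow> \<mu> \<cdot> \<iota> i = \<kappa> i \<cdot> m i"
    "\<And>X f. \<lbrakk>X \<in> Ob C; \<And>i. i \<in> I \<Longrightarrow> f i \<in> Hom C (Dom C (m i)) X\<rbrakk>
      \<Longrightarrow> \<exists>u \<in> Hom C (Dom C \<mu>) X. \<forall>i \<in> I. u \<cdot> \<iota> i = f i"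
proof -
  let ?D = "\<lambda>i. Dom C (m i)" and ?E = "\<lambda>i. Cod C (m i)"
  have ma: "m i \<in> Arr C" if "i \<in> I" for i using m[OF that] by simp
  obtain S \<iota> where S: "S \<in> Ob C" and \<iota>: "\<And>i. i \<in> I \<Longrightarrow> \<iota> i \<in> Hom C (?D i) S"
    and exS: "\<And>X f. \<lbrakk>X \<in> Ob C; \<And>i. i \<in> I \<Longrightarrow> f i \<in> Hom C (?D i) X\<rbrakk>
      \<Longrightarrow> \<exists>u \<in> Hom C S X. \<forall>i \<in> I. u \<cdot> \<iota> i = f i"
    and nulS: "\<And>g. \<lbrakk>g \<in> Arr C; Dom C g = S; \<And>i. i \<in> I \<Longrightarrow> nul (g \<cdot> \<iota> i)\<rbrakk> \<Longrightarrow> nul g"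
    by (rule ex_coproduct[of I ?D, OF sm]) (use ma in \<open>blast intro: Dom_in_Ob\<close>)+
  obtain T \<kappa> where T: "T \<in> Ob C" and \<kappa>: "\<And>i. i \<in> I \<Longrightarrow> \<kappa> i \<in> Hom C (?E i) T"
    and exT: "\<And>X f. \<lbrakk>X \<in> Ob C; \<And>i. i \<in> I \<Longrightarrow> f i \<in> Hom C (?E i) X\<rbrakk>
      \<Longrightarrow> \<exists>u \<in> Hom C T X. \<forall>i \<in> I. u \<cdot> \<kappa> i = f i"
    by (rule ex_coproduct[of I ?E, OF sm]) (use ma in \<open>blast intro: Cod_in_Ob\<close>)+
  obtain \<mu> where \<mu>: "\<mu> \<in> Hom C S T" "\<And>i. i \<in> I \<Longrightarrow> \<mu> \<cdot> \<iota> i = \<kappa> i \<cdot> m i"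
    using exS[OF T, of "\<lambda>i. \<kappa> i \<cdot> m i"] \<kappa> ma by auto
  let ?\<delta> = "\<lambda>A i j. if i = j then Ident C (A i) else Zero C (A j) (A i)"
  have "\<exists>p \<in> Hom C S (?D i). \<forall>j \<in> I. p \<cdot> \<iota> j = ?\<delta> ?D i j" if i: "i \<in> I" for i
    by (rule exS) (use i ma in auto)
  then obtain p where p: "\<And>i. i \<in> I \<Longrightarrow> p i \<in> Hom C S (?D i)"
    "\<And>i j. \<lbrakk>i \<in> I; j \<in> I\<rbrakk> \<Longrightarrow> p i \<cdot> \<iota> j = ?\<delta> ?D i j" by metis
  have "\<exists>q \<in> Hom C T (?E i). \<forall>j \<in> I. q \<cdot> \<kappa> j = ?\<delta> ?E i j" if i: "i \<in> I" for i
    by (rule exT) (use i ma in auto)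
  then obtain q where q: "\<And>i. i \<in> I \<Longrightarrow> q i \<in> Hom C T (?E i)"
    "\<And>i j. \<lbrakk>i \<in> I; j \<in> I\<rbrakk> \<Longrightarrow> q i \<cdot> \<kappa> j = ?\<delta> ?E i j" by metis
  have qm: "q i \<cdot> \<mu> = m i \<cdot> p i" if i: "i \<in> I" for i
  proof -
    have "nul (dif (q i \<cdot> \<mu>) (m i \<cdot> p i))"
    proof (rule nulS)
      fix j assume j: "j \<in> I"
      have "q i \<cdot> (\<mu> \<cdot> \<iota> j) = (q i \<cdot> \<kappa> j) \<cdot> m j"
        unfolding \<mu>(2)[OF j] using q(1)[OF i] \<kappa>[OF j] ma[OF j] by simp
      also have "\<dots> = (if i = j then m j else Zero C (?D j) (?E i))"
        unfolding q(2)[OF i j] using ma[OF i] ma[OF j] by auto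
      also have "\<dots> = m i \<cdot> (p i \<cdot> \<iota> j)"
        unfolding p(2)[OF i j] using ma[OF i] ma[OF j] by auto
      finally show "nul (dif (q i \<cdot> \<mu>) (m i \<cdot> p i) \<cdot> \<iota> j)"
        using q(1)[OF i] p(1)[OF i] \<mu>(1) \<iota>[OF j] ma[OF i] ma[OF j] by simp
    qed (use q(1)[OF i] p(1)[OF i] \<mu>(1) ma[OF i] in auto)
    then show ?thesis using q(1)[OF i] p(1)[OF i] \<mu>(1) ma[OF i] by (simp add: nul_dif)
  qed
  have "monic C \<mu>"
  proof (rule monicI)
    fix w assume w': "w \<in> Arr C" "Cod C w = Dom C \<mu>" "nul (\<mu> \<cdot> w)"
    then have w: "w \<in> Arr C" "Cod C w = S" "nul (\<mu> \<cdot> w)" using \<mu>(1) by auto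
    show "nul w"
    proof (rule coproduct_projections_jointly_monic[OF sm S \<iota> nulS p w(1,2)])
      fix i assume i: "i \<in> I"
      have "nul (q i \<cdot> (\<mu> \<cdot> w))" by (rule nul_Comp_left) (use q(1)[OF i] \<mu>(1) w in auto)
      also have "q i \<cdot> (\<mu> \<cdot> w) = (q i \<cdot> \<mu>) \<cdot> w"
        using q(1)[OF i] \<mu>(1) w by (intro assoc[symmetric]) auto
      also have "\<dots> = m i \<cdot> (p i \<cdot> w)" unfolding qm[OF i] using p(1)[OF i] w ma[OF i] by simp
      finally show "nul (p i \<cdot> w)" by (rule monicD[OF m[OF i], rotated -1]) (use p(1)[OF i] w in auto)
    qed
  qed (use \<mu> in auto)
  then show thesis using that[of \<mu> \<iota> \<kappa>] \<mu> \<iota> \<kappa> exS by auto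
qed

end

section \<open>Complements and essential extensions\<close>

lemma small_inj_on:
  assumes "small U B" "inj_on f A" "f ` A \<subseteq> B" shows "small U A"
proof -
  have "small U (inv_into A f ` (f ` A))" using assms small_subset small_image by blast
  then show ?thesis using assms(2) by simp
qed

context abelian_category
begin

text \<open>Trivial intersection of subobjects, stated through arrows that factor through both, so
  that no intersection has to be formed.\<close>

definition disj :: "'b \<Rightarrow> 'b \<Rightarrow> bool" where
  "disj k l \<longleftrightarrow> (\<forall>y \<in> Arr C. sub_le C y k \<longrightarrow> sub_le C y l \<longrightarrow> nul y)"

text \<open>Besides subobjects, \<open>w\<close> ranges over all non-zero arrows, as in the element
  form of essentiality: every non-zero element has a non-zero multiple in the subobject.\<close>

definition essential :: "'b \<Rightarrow> bool" where
  "essential m \<longleftrightarrow> monic C m \<and> (\<forall>w \<in> Arr C. Cod C w = Cod C m \<longrightarrow> \<not> nul w \<longrightarrow>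
    (\<exists>z \<in> Arr C. Cod C z = Dom C w \<and> sub_le C (w \<cdot> z) m \<and> \<not> nul (w \<cdot> z)))"

text \<open>A complement in the sense of module theory: maximal among the subobjects that meet
  \<open>k\<close> trivially, but \<open>k\<close> and \<open>l\<close> need not span the
  object.\<close>

definition is_complement :: "'b \<Rightarrow> 'b \<Rightarrow> bool" where
  "is_complement k l \<longleftrightarrow> monic C l \<and> Cod C l = Cod C k \<and> disj k l \<and>
    (\<forall>l'. monic C l' \<longrightarrow> Cod C l' = Cod C k \<longrightarrow> sub_le C l l' \<longrightarrow> disj k l' \<longrightarrow> sub_le C l' l)"

lemma disjD: "\<lbrakk>disj k l; y \<in> Arr C; sub_le C y k; sub_le C y l\<rbrakk> \<Longrightarrow> nul y"
  unfolding disj_def by blast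

lemma disj_sym: "disj k l \<Longrightarrow> disj l k"
  unfolding disj_def by blast

lemma disj_mono: "\<lbrakk>disj k' l; sub_le C k k'; k' \<in> Arr C\<rbrakk> \<Longrightarrow> disj k l"
  unfolding disj_def using sub_le_trans by blast

lemma essentialE:
  assumes "essential m" "w \<in> Arr C" "Cod C w = Cod C m" "\<not> nul w"
  obtains z a where "z \<in> Arr C" "Cod C z = Dom C w" "a \<in> Arr C" "Dom C a = Dom C z" "Cod C a = Dom C m"
    "w \<cdot> z = m \<cdot> a" "\<not> nul (w \<cdot> z)"
proof -
  obtain z where z: "z \<in> Arr C" "Cod C z = Dom C w" "sub_le C (w \<cdot> z) m" "\<not> nul (w \<cdot> z)"
    using assms unfolding essential_def by blast
  obtain a where "a \<in> Arr C" "Dom C a = Dom C (w \<cdot> z)" "Cod C a = Dom C m" "m \<cdot> a = w \<cdot> z"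
    using z(3) by (rule sub_leE)
  then show thesis using that[of z a] z assms by simp
qed

lemma is_complement_mono:
  assumes "is_complement k l" "sub_le C k k'" "k' \<in> Arr C" "Cod C k' = Cod C k" "disj k' l"
  shows "is_complement k' l"
  using assms disj_mono unfolding is_complement_def by metis

text \<open>Trivial intersection keeps \<open>k\<close> monic modulo \<open>l\<close>. For a
  non-zero \<open>w\<close> into the quotient, the inverse image of the image of \<open>w\<close>
  properly contains \<open>l\<close>; by maximality of \<open>l\<close> it meets \<open>k\<close>,
  and the common part supplies the required multiple of \<open>w\<close>.\<close>

lemma essential_mod_complement:
  assumes k: "monic C k" and l: "is_complement k l"
  shows "essential (coker l \<cdot> k)"
proof -
  let ?c = "coker l"
  have lm: "monic C l" "Cod C l = Cod C k" "disj k l" using l by (auto simp: is_complement_def)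
  have c: "epic C ?c" "?c \<in> Arr C" "Dom C ?c = Cod C k" using lm by auto
  have m: "monic C (?c \<cdot> k)"
  proof (rule monicI)
    fix x assume "x \<in> Arr C" "Cod C x = Dom C (?c \<cdot> k)" "nul ((?c \<cdot> k) \<cdot> x)"
    then have x: "x \<in> Arr C" "Cod C x = Dom C k" "nul (?c \<cdot> (k \<cdot> x))" using c k by auto
    then have "sub_le C (k \<cdot> x) l" using monic_sub_le_iff[OF lm(1), of "k \<cdot> x"] k lm by simp
    then have "nul (k \<cdot> x)"
      using disjD[OF lm(3)] x k sub_le_Comp_self[of k x] by simp
    then show "nul x" using x k monicD[OF k] by simp
  qed (use c k in auto)
  show ?thesis
    unfolding essential_def
  proof (intro conjI ballI impI m)
    fix w assume "w \<in> Arr C" "Cod C w = Cod C (?c \<cdot> k)" and nw: "\<not> nul w"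
    then have w: "w \<in> Arr C" "Cod C w = Cod C ?c" using c k by auto
    let ?q = "coker w"
    let ?l = "ker (?q \<cdot> ?c)"
    have q: "?q \<in> Arr C" "Dom C ?q = Cod C ?c" using w by auto
    have qc: "?q \<cdot> ?c \<in> Arr C" "Dom C (?q \<cdot> ?c) = Cod C k" using q c by auto
    have l': "monic C ?l" "Cod C ?l = Cod C k" using qc by auto
    have "nul (?q \<cdot> (?c \<cdot> l))" by (rule nul_Comp_left) (use q c lm in auto)
    then have "sub_le C l ?l" using sub_le_ker_iff[OF qc(1), of l] q c lm by simp
    \<comment> \<open>A lift \<open>t\<close> of \<open>w\<close> along \<open>?c\<close> factors
      through \<open>?l\<close>. If \<open>?l\<close> were contained in \<open>l\<close>, then
      \<open>?c\<close> would kill \<open>t\<close>, and \<open>w\<close> would vanish.\<close>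
    have "\<not> sub_le C ?l l"
    proof
      assume "sub_le C ?l l"
      then have n: "nul (?c \<cdot> ?l)" using monic_sub_le_iff[OF lm(1), of ?l] l' lm by simp
      obtain e t where et: "epic C e" "Cod C e = Dom C w" "t \<in> Arr C" "Dom C t = Dom C e"
        "Cod C t = Dom C ?c" "?c \<cdot> t = w \<cdot> e"
        by (rule epic_pullback[OF c(1), of w]) (use w in auto)
      have "nul ((?q \<cdot> w) \<cdot> e)" by (rule nul_Comp_right) (use w et in auto)
      then have "nul ((?q \<cdot> ?c) \<cdot> t)" using w q c et by simp
      then obtain s where s: "s \<in> Arr C" "Dom C s = Dom C t" "Cod C s = Dom C ?l" "?l \<cdot> s = t"
        using ker_factorE[of "?q \<cdot> ?c" t] qc et c by metis
      have "nul ((?c \<cdot> ?l) \<cdot> s)" by (rule nul_Comp_right) (use n s l' c in auto)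
      then have "nul (w \<cdot> e)" using s l' c et(6) by simp
      then show False using nw epicD[OF et(1), of w] w et by simp
    qed
    then have "\<not> disj k ?l" using l l' \<open>sub_le C l ?l\<close> unfolding is_complement_def by blast
    then obtain y where y: "y \<in> Arr C" "sub_le C y k" "sub_le C y ?l" "\<not> nul y"
      unfolding disj_def by blast
    obtain a where a: "a \<in> Arr C" "Dom C a = Dom C y" "Cod C a = Dom C k" "k \<cdot> a = y"
      using y(2) by (rule sub_leE)
    have ky: "Cod C y = Cod C k" using a k Comp_arr(3)[of a k] by simp
    have "nul ((?q \<cdot> ?c) \<cdot> y)" using y(3) sub_le_ker_iff[OF qc(1) y(1)] qc ky by simp
    then have "nul (?q \<cdot> (?c \<cdot> y))" using q c ky y(1) by simp
    then obtain e z where ez: "epic C e" "Cod C e = Dom C (?c \<cdot> y)" "z \<in> Arr C" "Dom C z = Dom C e"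
      "Cod C z = Dom C w" "w \<cdot> z = (?c \<cdot> y) \<cdot> e"
      using epic_lift[of w "?c \<cdot> y"] w c y(1) ky by (metis Comp_arr(1,3))
    have e: "Cod C e = Dom C y" using ez(2) c y(1) ky by simp
    have wz: "w \<cdot> z = (?c \<cdot> k) \<cdot> (a \<cdot> e)"
      unfolding ez(6) a(4)[symmetric] using a(1-3) c k e ez(1) by simp
    show "\<exists>z\<in>Arr C. Cod C z = Dom C w \<and> sub_le C (w \<cdot> z) (?c \<cdot> k) \<and> \<not> nul (w \<cdot> z)"
    proof (intro bexI conjI)
      show "sub_le C (w \<cdot> z) (?c \<cdot> k)"
        unfolding wz by (rule sub_le_Comp_self) (use a(1-3) c k e ez(1) in auto)
      show "\<not> nul (w \<cdot> z)"
      proof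
        assume "nul (w \<cdot> z)"
        then have "nul (a \<cdot> e)" using monicD[OF m, of "a \<cdot> e"] wz a(1-3) c k e ez(1) by simp
        then have "nul a" using epicD[OF ez(1), of a] a(1-3) e by simp
        then have "nul (k \<cdot> a)" using nul_Comp_left[of a k] a(1-3) k by simp
        then show False using y a by simp
      qed
    qed (use ez in auto)
  qed
qed

section \<open>Noetherian objects\<close>

lemma subobject_noetherian:
  assumes "noetherian_object C A" "monic C n" "Cod C n = A"
  shows "noetherian_object C (Dom C n)"
  unfolding noetherian_object_def
proof (intro conjI allI impI)
  fix m assume m: "\<forall>i. monic C (m i) \<and> Cod C (m i) = Dom C n \<and> sub_le C (m i) (m (Suc i))"
  have "\<exists>N. \<forall>i\<ge>N. sub_le C (n \<cdot> m i) (n \<cdot> m N)"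
    using assms(1)[unfolded noetherian_object_def, THEN conjunct2, rule_format, of "\<lambda>i. n \<cdot> m i"]
      m assms monic_Comp[of _ n] sub_le_Comp_left[of _ _ n] by auto
  then obtain N where N: "\<And>i. i \<ge> N \<Longrightarrow> sub_le C (n \<cdot> m i) (n \<cdot> m N)" by blast
  have "sub_le C (m i) (m N)" if i: "i \<ge> N" for i
  proof -
    have mi: "m j \<in> Arr C" "Cod C (m j) = Dom C n" for j using m by auto
    obtain u where u: "u \<in> Arr C" "Dom C u = Dom C (n \<cdot> m i)" "Cod C u = Dom C (n \<cdot> m N)"
      "(n \<cdot> m N) \<cdot> u = n \<cdot> m i" using N[OF i] by (rule sub_leE)
    have u': "Dom C u = Dom C (m i)" "Cod C u = Dom C (m N)" using u mi assms by auto
    have "n \<cdot> (m N \<cdot> u) = n \<cdot> m i" using u(1,4) u' mi assms(2) by simp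
    then have "m N \<cdot> u = m i" by (rule monic_cancel[OF assms(2)]) (use u(1) u' mi in auto)
    then show ?thesis using u(1) u' by (intro sub_leI[of u])
  qed
  then show "\<exists>N. \<forall>i\<ge>N. sub_le C (m i) (m N)" by blast
qed (use assms in auto)

text \<open>Repeated choice of a strictly larger member would give an ascending chain that never
  stops. Maximality is up to \<open>sub_le\<close>, since many monomorphisms represent the same
  subobject.\<close>

lemma noetherian_maximal:
  assumes A: "noetherian_object C A" and M: "M \<noteq> {}" "\<And>m. m \<in> M \<Longrightarrow> monic C m \<and> Cod C m = A"
  obtains m where "m \<in> M" "\<And>n. \<lbrakk>n \<in> M; sub_le C m n\<rbrakk> \<Longrightarrow> sub_le C n m"
proof (rule ccontr)
  assume "\<not> thesis"
  then have "\<forall>m \<in> M. \<exists>n. n \<in> M \<and> sub_le C m n \<and> \<not> sub_le C n m" using that by blast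
  then obtain f where f: "\<And>m. m \<in> M \<Longrightarrow> f m \<in> M \<and> sub_le C m (f m) \<and> \<not> sub_le C (f m) m" by metis
  obtain m0 where "m0 \<in> M" using M(1) by blast
  define s where "s i = (f ^^ i) m0" for i
  have sM: "s i \<in> M" for i by (induction i) (use f \<open>m0 \<in> M\<close> in \<open>auto simp: s_def\<close>)
  have sS: "s (Suc i) = f (s i)" for i by (simp add: s_def)
  have "\<exists>N. \<forall>i\<ge>N. sub_le C (s i) (s N)"
    using A[unfolded noetherian_object_def, THEN conjunct2, rule_format, of s] M(2)[OF sM] f[OF sM] sS
    by simp
  then obtain N where "sub_le C (s (Suc N)) (s N)" by (metis le_SucI order_refl)
  then show False using f[OF sM[of N]] sS by simp
qed

end

section \<open>Points from generators and existence of complements\<close>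

locale grothendieck_generators = grothendieck C U for C :: "('o, 'm) category" (structure) and U :: "'u itself" +
  fixes G :: "'o set"
  assumes generators: "generating C G" "small U G"
    and small_Hom: "\<And>X A. \<lbrakk>X \<in> G; A \<in> Ob C\<rbrakk> \<Longrightarrow> small U (Hom C X A)"
begin

text \<open>The substitute for the elements of \<open>B\<close>: a small set that detects zero
  arrows and containment of subobjects.\<close>

definition pts :: "'o \<Rightarrow> 'm set" where "pts B = {x \<in> Arr C. Dom C x \<in> G \<and> Cod C x = B}"

lemma G_Ob: "X \<in> G \<Longrightarrow> X \<in> Ob C" using generators(1) by (auto simp: generating_def)

lemma pts_iff: "x \<in> pts B \<longleftrightarrow> x \<in> Arr C \<and> Dom C x \<in> G \<and> Cod C x = B"
  by (simp add: pts_def)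

lemma small_pts:
  assumes "B \<in> Ob C" shows "small U (pts B)"
proof -
  have "pts B = (\<Union>X \<in> G. Hom C X B)" by (auto simp: pts_def)
  then show ?thesis using small_UN[OF universe generators(2), of "\<lambda>X. Hom C X B"] small_Hom assms by metis
qed

lemma nul_if_nul_pts:
  assumes "f \<in> Arr C" "\<And>x. x \<in> pts (Dom C f) \<Longrightarrow> nul (f \<cdot> x)"
  shows "nul f"
proof (rule ccontr)
  let ?z = "Zero C (Dom C f) (Cod C f)"
  assume "\<not> nul f"
  then have "f \<noteq> ?z" by (simp add: nul_def)
  moreover have "f \<in> Hom C (Dom C f) (Cod C f)" "?z \<in> Hom C (Dom C f) (Cod C f)"
    using assms(1) by auto
  ultimately obtain X h where h: "X \<in> G" "h \<in> Hom C X (Dom C f)" "f \<cdot> h \<noteq> ?z \<cdot> h"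
    using generators(1) unfolding generating_def by blast
  have "nul (f \<cdot> h)" using assms h by (auto simp: pts_def)
  then have "f \<cdot> h = Zero C X (Cod C f)" using nulD h assms by simp
  then show False using h assms by simp
qed

lemma ex_nonzero_pt:
  assumes "f \<in> Arr C" "\<not> nul f"
  obtains x where "x \<in> Arr C" "Dom C x \<in> G" "Cod C x = Dom C f" "\<not> nul (f \<cdot> x)"
  using nul_if_nul_pts assms pts_iff by metis

text \<open>By \<open>sec_subset_iff\<close> this embeds the subobjects of an object into the
  subsets of a small set, compatibly with the order; monomorphisms with equal sets represent the
  same subobject.\<close>

definition sec :: "'m \<Rightarrow> 'm set" where "sec m = {x \<in> pts (Cod C m). sub_le C x m}"

lemma sec_subset_iff:
  assumes "monic C m" "monic C n" "Cod C m = Cod C n"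
  shows "sec m \<subseteq> sec n \<longleftrightarrow> sub_le C m n"
proof
  assume s: "sec m \<subseteq> sec n"
  have "nul (coker n \<cdot> m)"
  proof (rule nul_if_nul_pts)
    fix x assume "x \<in> pts (Dom C (coker n \<cdot> m))"
    then have x: "x \<in> Arr C" "Dom C x \<in> G" "Cod C x = Dom C m" using assms by (auto simp: pts_iff)
    have "m \<cdot> x \<in> sec m" using x assms sub_le_Comp_self[of m x] by (simp add: sec_def pts_iff)
    then have "sub_le C (m \<cdot> x) n" using s by (auto simp: sec_def)
    then show "nul ((coker n \<cdot> m) \<cdot> x)"
      using monic_sub_le_iff[OF assms(2), of "m \<cdot> x"] x assms by simp
  qed (use assms in auto)
  then show "sub_le C m n" using monic_sub_le_iff[OF assms(2), of m] assms by simp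
next
  assume "sub_le C m n"
  then show "sec m \<subseteq> sec n" using assms sub_le_trans[of _ m n] by (auto simp: sec_def)
qed

text \<open>Zorn's lemma is applied to the sets of points of subobjects. A chain of these sets may
  fail to be small, but it has a small subchain with the same union.\<close>

lemma ex_complement:
  assumes k: "monic C k" and l0: "monic C l0" "Cod C l0 = Cod C k" "disj k l0"
  obtains l where "is_complement k l" "sub_le C l0 l"
proof -
  let ?Z = "Cod C k"
  define Q where "Q l \<longleftrightarrow> monic C l \<and> Cod C l = ?Z \<and> sub_le C l0 l \<and> disj k l" for l
  have Ql0: "Q l0" using l0 by (simp add: Q_def)
  have "\<exists>M \<in> sec ` Collect Q. \<forall>X \<in> sec ` Collect Q. M \<subseteq> X \<longrightarrow> X = M"
  proof (rule subset_Zorn)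
    fix \<C> assume ch: "subset.chain (sec ` Collect Q) \<C>"
    show "\<exists>V \<in> sec ` Collect Q. \<forall>X \<in> \<C>. X \<subseteq> V"
    proof (cases "\<C> = {}")
      case True
      then show ?thesis using Ql0 by blast
    next
      case False
      then obtain c0 where c0: "c0 \<in> \<C>" by blast
      have "\<forall>x \<in> \<Union>\<C>. \<exists>c \<in> \<C>. x \<in> c" by blast
      then obtain p where p: "\<And>x. x \<in> \<Union>\<C> \<Longrightarrow> p x \<in> \<C> \<and> x \<in> p x" by metis
      \<comment> \<open>Adding \<open>c0\<close> keeps the index set non-empty when the union of the
        chain is empty.\<close>
      define I where "I = insert c0 (p ` \<Union>\<C>)"
      have IC: "I \<subseteq> \<C>" using p c0 by (auto simp: I_def)
      have Csub: "c \<in> sec ` Collect Q" if "c \<in> \<C>" for c using ch that by (auto simp: subset.chain_def)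
      then have CZ: "\<Union>\<C> \<subseteq> pts ?Z" by (fastforce simp: sec_def Q_def)
      have "small U (\<Union>\<C>)" by (rule small_subset[OF small_pts CZ]) (use k in auto)
      then have "small U ({c0} \<union> p ` \<Union>\<C>)"
        by (intro small_Un[OF universe small_finite[OF universe]] small_image) auto
      then have smI: "small U I" by (simp add: I_def)
      have "\<forall>c \<in> \<C>. \<exists>l. Q l \<and> sec l = c" using Csub by blast
      then obtain l where l: "\<And>c. c \<in> \<C> \<Longrightarrow> Q (l c) \<and> sec (l c) = c" by metis
      have lm: "monic C (l c)" "Cod C (l c) = ?Z" "sub_le C l0 (l c)" "disj k (l c)" "sec (l c) = c"
        if "c \<in> I" for c
        using l IC that by (auto simp: Q_def)
      obtain s where s: "monic C s" "Cod C s = ?Z" and ls: "\<And>x. x \<in> l ` I \<Longrightarrow> sub_le C x s"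
        and cover: "\<And>g. \<lbrakk>g \<in> Arr C; Dom C g = Dom C s;
          \<And>x u. \<lbrakk>x \<in> l ` I; u \<in> Arr C; Dom C u = Dom C x; Cod C u = Dom C s; s \<cdot> u = x\<rbrakk> \<Longrightarrow> nul (g \<cdot> u)\<rbrakk> \<Longrightarrow> nul g"
        by (rule family_image[of "l ` I" ?Z, OF small_image[OF smI]]) (use lm k in auto)
      have "\<forall>c \<in> I. \<exists>b. b \<in> Arr C \<and> Dom C b = Dom C (l c) \<and> Cod C b = Dom C s \<and> s \<cdot> b = l c"
        using ls by (auto elim!: sub_leE)
      then obtain b where b: "\<And>c. c \<in> I \<Longrightarrow> b c \<in> Arr C \<and> Dom C (b c) = Dom C (l c) \<and> Cod C (b c) = Dom C s"
        and sb: "\<And>c. c \<in> I \<Longrightarrow> s \<cdot> b c = l c" by metis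
      have bm: "monic C (b c)" if "c \<in> I" for c
        by (rule monic_Comp_right[of s]) (use lm(1)[OF that] sb[OF that] b[OF that] s in auto)
      have "disj k s"
        unfolding disj_def
      proof (intro ballI impI)
        fix y assume y: "y \<in> Arr C" "sub_le C y k" "sub_le C y s"
        obtain w where w: "w \<in> Arr C" "Dom C w = Dom C y" "Cod C w = Dom C s" "s \<cdot> w = y"
          using y(3) by (rule sub_leE)
        \<comment> \<open>The members of the subchain cover \<open>s\<close>. The part of
          \<open>w\<close> inside any one of them also lies in \<open>k\<close>, to which that
          member is disjoint, so it vanishes.\<close>
        have "nul w"
        proof (rule directed_cover_pullback[OF smI, where lq = "(\<subseteq>)" and b = b and B = "Dom C s" and w = w])
          show "directed_set I (\<subseteq>)"
            unfolding directed_set_def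
          proof (intro conjI ballI)
            fix c c' assume c: "c \<in> I" "c' \<in> I"
            then have "c \<subseteq> c' \<or> c' \<subseteq> c" using ch IC unfolding subset_chain_def by blast
            then show "\<exists>d\<in>I. c \<subseteq> d \<and> c' \<subseteq> d" using c by blast
          qed (auto simp: I_def)
        next
          fix c c' assume c: "c \<in> I" "c' \<in> I" "c \<subseteq> c'"
          then have "sub_le C (l c) (l c')" using sec_subset_iff[of "l c" "l c'"] lm by simp
          then obtain h where h: "h \<in> Arr C" "Dom C h = Dom C (l c)" "Cod C h = Dom C (l c')" "l c' \<cdot> h = l c"
            by (rule sub_leE)
          have "s \<cdot> (b c' \<cdot> h) = (s \<cdot> b c') \<cdot> h" using h s b[OF c(2)] by simp
          also have "\<dots> = s \<cdot> b c" using sb[OF c(1)] sb[OF c(2)] h by simp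
          finally have bh: "b c' \<cdot> h = b c"
            by (rule monic_cancel[OF s(1)]) (use h b[OF c(1)] b[OF c(2)] in auto)
          have "nul ((coker (b c') \<cdot> b c') \<cdot> h)"
            by (rule nul_Comp_right) (use h b[OF c(2)] in auto)
          then show "nul (coker (b c') \<cdot> b c)" using bh h b[OF c(2)] by simp
        next
          fix g assume g: "g \<in> Arr C" "Dom C g = Dom C s" "\<And>c. c \<in> I \<Longrightarrow> nul (g \<cdot> b c)"
          show "nul g"
          proof (rule cover[OF g(1,2)])
            fix x u assume x: "x \<in> l ` I" and u: "u \<in> Arr C" "Dom C u = Dom C x" "Cod C u = Dom C s" "s \<cdot> u = x"
            obtain c where c: "c \<in> I" "x = l c" using x by blast
            have "s \<cdot> u = s \<cdot> b c" using u c sb by simp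
            then have "u = b c" by (rule monic_cancel[OF s(1)]) (use u(1-3) b[OF c(1)] c(2) in auto)
            then show "nul (g \<cdot> u)" using g(3)[OF c(1)] by simp
          qed
        next
          fix c v assume c: "c \<in> I" and v: "v \<in> Arr C" "Cod C v = Dom C w" "nul (coker (b c) \<cdot> (w \<cdot> v))"
          have "sub_le C (w \<cdot> v) (b c)"
            using monic_sub_le_iff[OF bm[OF c], of "w \<cdot> v"] v w b[OF c] by simp
          then have "sub_le C (s \<cdot> (w \<cdot> v)) (s \<cdot> b c)"
            by (rule sub_le_Comp_left) (use b[OF c] s in auto)
          then have "sub_le C (s \<cdot> (w \<cdot> v)) (l c)" using sb[OF c] by simp
          moreover have yv: "y \<cdot> v = s \<cdot> (w \<cdot> v)" using w(1-3) v(1,2) s assoc[of v w s] by (simp add: w(4))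
          moreover have "sub_le C (y \<cdot> v) k" by (rule sub_le_Comp[OF y(2)]) (use v w y k in auto)
          ultimately have "nul (y \<cdot> v)"
            using disjD[OF lm(4)[OF c], of "y \<cdot> v"] v(1,2) w(1-3) s by simp
          then show "nul (w \<cdot> v)"
            unfolding yv by (rule monicD[OF s(1), rotated -1]) (use v w(1-3) in auto)
        qed (use s w b in auto)
        then show "nul y" unfolding w(4)[symmetric] by (rule nul_Comp_left[rotated -1]) (use w(1-3) s in auto)
      qed
      moreover have c0I: "c0 \<in> I" by (simp add: I_def)
      moreover have "sub_le C l0 s"
        using sub_le_trans[OF lm(3)[OF c0I] ls] c0I s by simp
      ultimately have "Q s" using s by (simp add: Q_def)
      moreover have "X \<subseteq> sec s" if X: "X \<in> \<C>" for X
      proof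
        fix x assume x: "x \<in> X"
        then have px: "p x \<in> I" "x \<in> p x" using p X by (auto simp: I_def)
        then have "x \<in> sec (l (p x))" using lm(5) by simp
        moreover have "sec (l (p x)) \<subseteq> sec s"
          using sec_subset_iff[of "l (p x)" s] lm[OF px(1)] ls px(1) s by simp
        ultimately show "x \<in> sec s" by blast
      qed
      ultimately show ?thesis by blast
    qed
  qed
  then obtain l where l: "Q l" "\<And>l'. Q l' \<Longrightarrow> sec l \<subseteq> sec l' \<Longrightarrow> sec l' = sec l" by blast
  have "is_complement k l"
    unfolding is_complement_def
  proof (intro conjI allI impI)
    fix l' assume l': "monic C l'" "Cod C l' = ?Z" "sub_le C l l'" "disj k l'"
    then have "Q l'" using l(1) sub_le_trans[of l0 l l'] by (simp add: Q_def)
    then have "sec l' = sec l" using l(2) sec_subset_iff[of l l'] l' l(1) by (simp add: Q_def)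
    then show "sub_le C l' l" using sec_subset_iff[of l' l] l' l(1) by (simp add: Q_def)
  qed (use l(1) in \<open>auto simp: Q_def\<close>)
  then show thesis using that l(1) by (simp add: Q_def)
qed

lemma ex_complement0:
  assumes k: "monic C k"
  obtains l where "is_complement k l"
proof -
  obtain Z where Z: "zero_object C Z" using ex_zero_object by blast
  then have ZOb: "Z \<in> Ob C" by (simp add: zero_object_iff)
  let ?z = "Zero C Z (Cod C k)"
  have z: "?z \<in> Arr C" "Dom C ?z = Z" "Cod C ?z = Cod C k" using ZOb k by auto
  have "monic C ?z"
    by (rule monicI) (use z nul_to_zero_object[OF Z] in auto)
  moreover have "disj k ?z"
    unfolding disj_def
  proof (intro ballI impI)
    fix y assume "sub_le C y ?z"
    then obtain u where u: "u \<in> Arr C" "Dom C u = Dom C y" "Cod C u = Dom C ?z" "?z \<cdot> u = y"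
      by (rule sub_leE)
    show "nul y"
      unfolding u(4)[symmetric] by (rule nul_Comp_right[OF u(1)]) (use z(1) u(3) ZOb k in auto)
  qed
  ultimately show thesis using ex_complement[OF k, of ?z] z that by blast
qed

text \<open>The arrow \<open>k'\<close> is a maximal essential extension of \<open>k\<close> in \<open>E\<close>: take a complement of a
  complement of \<open>k\<close>.\<close>

lemma injective_hull_inside:
  assumes k: "monic C k" and E: "injective_object C (Cod C k)"
  obtains k' r a where "monic C k'" "Cod C k' = Cod C k" "r \<in> Hom C (Cod C k) (Dom C k')"
    "r \<cdot> k' = Ident C (Dom C k')" "essential a" "Dom C a = Dom C k" "Cod C a = Dom C k'" "k' \<cdot> a = k"
proof -
  let ?E = "Cod C k"
  obtain l where l: "is_complement k l" using ex_complement0[OF k] .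
  then have lm: "monic C l" "Cod C l = ?E" "disj k l" by (auto simp: is_complement_def)
  obtain k' where k': "is_complement l k'" "sub_le C k k'"
    by (rule ex_complement[OF lm(1) k]) (use lm disj_sym in auto)
  have km: "monic C k'" "Cod C k' = ?E" "disj l k'" using k'(1) lm by (auto simp: is_complement_def)
  have l': "is_complement k' l"
    by (rule is_complement_mono[OF l k'(2)]) (use km disj_sym in auto)
  let ?c = "coker l"
  have c: "epic C ?c" "?c \<in> Arr C" "Dom C ?c = ?E" using lm by auto
  have ess: "essential (?c \<cdot> k)" "essential (?c \<cdot> k')"
    using essential_mod_complement k l km l' by auto
  have ckm: "monic C (?c \<cdot> k')" using ess(2) by (simp add: essential_def)
  \<comment> \<open>Injectivity extends \<open>k'\<close> along its embedding into the quotient by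
    \<open>l\<close>. By essentiality \<open>g\<close> is monic and disjoint from \<open>l\<close>,
    so maximality of \<open>k'\<close> puts \<open>g\<close> inside \<open>k'\<close>; composed with
    \<open>?c\<close>, this is the retraction.\<close>
  obtain g where g: "g \<in> Arr C" "Dom C g = Cod C ?c" "Cod C g = ?E" "g \<cdot> (?c \<cdot> k') = k'"
    using E[unfolded injective_object_def, THEN conjunct2, rule_format, OF ckm, of k'] c km by auto
  \<comment> \<open>Essentiality in the form that serves both for \<open>g\<close> being monic and
    for its disjointness from \<open>l\<close>: it is enough to test the multiples of
    \<open>g \<cdot> x\<close> that lie in \<open>k'\<close>.\<close>
  have gn: "nul x" if x: "x \<in> Arr C" "Cod C x = Cod C ?c" and
    gx: "\<And>z. \<lbrakk>z \<in> Arr C; Cod C z = Dom C x; sub_le C ((g \<cdot> x) \<cdot> z) k'\<rbrakk> \<Longrightarrow> nul ((g \<cdot> x) \<cdot> z)" for x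
  proof (rule ccontr)
    assume "\<not> nul x"
    then obtain z a where za: "z \<in> Arr C" "Cod C z = Dom C x" "a \<in> Arr C" "Dom C a = Dom C z"
      "Cod C a = Dom C (?c \<cdot> k')" "x \<cdot> z = (?c \<cdot> k') \<cdot> a" "\<not> nul (x \<cdot> z)"
      using essentialE[OF ess(2) x(1)] x c km by auto
    have a: "Cod C a = Dom C k'" using za(5) c km by simp
    have "(g \<cdot> x) \<cdot> z = g \<cdot> (x \<cdot> z)" using g(1-3) x za(1,2) by simp
    also have "\<dots> = (g \<cdot> (?c \<cdot> k')) \<cdot> a" unfolding za(6) using g(1-3) c km za(3) a by simp
    finally have e: "(g \<cdot> x) \<cdot> z = k' \<cdot> a" using g(4) by simp
    have "sub_le C (k' \<cdot> a) k'" by (rule sub_le_Comp_self) (use km za(3) a in auto)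
    then have "nul (k' \<cdot> a)" using gx[OF za(1,2)] e by simp
    then have "nul a" by (rule monicD[OF km(1), rotated -1]) (use za(3) a in auto)
    then have "nul ((?c \<cdot> k') \<cdot> a)" by (rule nul_Comp_left[rotated -1]) (use za(3) a c km in auto)
    then show False using za by simp
  qed
  have gm: "monic C g"
  proof (rule monicI)
    fix x assume x: "x \<in> Arr C" "Cod C x = Dom C g" "nul (g \<cdot> x)"
    show "nul x"
    proof (rule gn)
      fix z assume z: "z \<in> Arr C" "Cod C z = Dom C x"
      show "nul ((g \<cdot> x) \<cdot> z)" by (rule nul_Comp_right) (use x g z in auto)
    qed (use x g in auto)
  qed (rule g)
  have "sub_le C k' g" by (rule sub_leI[of "?c \<cdot> k'"]) (use g c km in auto)
  moreover have "disj l g"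
    unfolding disj_def
  proof (intro ballI impI)
    fix y assume y: "y \<in> Arr C" "sub_le C y l" "sub_le C y g"
    obtain x where x: "x \<in> Arr C" "Dom C x = Dom C y" "Cod C x = Dom C g" "g \<cdot> x = y"
      using y(3) by (rule sub_leE)
    have "nul x"
    proof (rule gn)
      fix z assume z: "z \<in> Arr C" "Cod C z = Dom C x" "sub_le C ((g \<cdot> x) \<cdot> z) k'"
      have "sub_le C (y \<cdot> z) l" by (rule sub_le_Comp[OF y(2)]) (use z x(2) lm in auto)
      then show "nul ((g \<cdot> x) \<cdot> z)"
        using disjD[OF km(3), of "y \<cdot> z"] z x(2,4) y(1) by simp
    qed (use x g in auto)
    then show "nul y" unfolding x(4)[symmetric] by (rule nul_Comp_left[rotated -1]) (use x(1-3) g in auto)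
  qed
  ultimately have "sub_le C g k'"
    using k'(1) gm g lm(2) unfolding is_complement_def by simp
  then obtain h where h: "h \<in> Arr C" "Dom C h = Cod C ?c" "Cod C h = Dom C k'" "k' \<cdot> h = g"
    using g by (auto elim!: sub_leE)
  let ?r = "h \<cdot> ?c"
  have "k' \<cdot> (?r \<cdot> k') = (k' \<cdot> h) \<cdot> (?c \<cdot> k')" using h(1-3) c km by simp
  also have "\<dots> = k' \<cdot> Ident C (Dom C k')" unfolding h(4) g(4) using km by simp
  finally have rk: "?r \<cdot> k' = Ident C (Dom C k')"
    by (rule monic_cancel[OF km(1)]) (use h(1-3) c km in auto)
  obtain a where a: "a \<in> Arr C" "Dom C a = Dom C k" "Cod C a = Dom C k'" "k' \<cdot> a = k"
    using k'(2) by (rule sub_leE)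
  have am: "monic C a" by (rule monic_Comp_right[of k']) (use a km k in auto)
  \<comment> \<open>\<open>k\<close> is essential already in the quotient by \<open>l\<close>, into
    which \<open>k'\<close> embeds by \<open>ckm\<close>.\<close>
  have "essential a"
    unfolding essential_def
  proof (intro conjI ballI impI am)
    fix w assume w0: "w \<in> Arr C" "Cod C w = Cod C a" "\<not> nul w"
    then have w: "w \<in> Arr C" "Cod C w = Dom C k'" using a by auto
    let ?w = "(?c \<cdot> k') \<cdot> w"
    have "\<not> nul ?w" using monicD[OF ckm, of w] w w0(3) c km by auto
    then obtain z y where zy: "z \<in> Arr C" "Cod C z = Dom C ?w" "y \<in> Arr C" "Dom C y = Dom C z"
      "Cod C y = Dom C (?c \<cdot> k)" "?w \<cdot> z = (?c \<cdot> k) \<cdot> y" "\<not> nul (?w \<cdot> z)"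
      using essentialE[OF ess(1), of ?w] w c km k by auto
    have z: "Cod C z = Dom C w" "Cod C y = Dom C k" using zy(2,5) w c km k by auto
    have "(?c \<cdot> k') \<cdot> (w \<cdot> z) = ?w \<cdot> z" using w c km zy(1) z by simp
    also have "\<dots> = ?c \<cdot> (k \<cdot> y)" unfolding zy(6) using zy(3) z(2) c k by simp
    also have "k \<cdot> y = k' \<cdot> (a \<cdot> y)"
      using assoc[of y a k'] zy(3) z(2) a km by simp
    also have "?c \<cdot> (k' \<cdot> (a \<cdot> y)) = (?c \<cdot> k') \<cdot> (a \<cdot> y)"
      using zy(3) z(2) a(1-3) c km by simp
    finally have "w \<cdot> z = a \<cdot> y"
      by (rule monic_cancel[OF ckm]) (use zy(1,3,4) z a(1-3) c km w in auto)
    moreover have "\<not> nul (w \<cdot> z)"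
    proof
      assume "nul (w \<cdot> z)"
      then have "nul ((?c \<cdot> k') \<cdot> (w \<cdot> z))"
        by (rule nul_Comp_left[rotated -1]) (use w c km zy(1) z in auto)
      then show False using zy(1,7) w c km z by simp
    qed
    ultimately show "\<exists>z\<in>Arr C. Cod C z = Dom C w \<and> sub_le C (w \<cdot> z) a \<and> \<not> nul (w \<cdot> z)"
      using zy(1,3,4) z a(1-3) sub_le_Comp_self[of a y] by (intro bexI[of _ z]) auto
  qed
  then show thesis using that[of k' ?r a] km h(1-3) c rk a by simp
qed

end

section \<open>Enough injective objects\<close>

context grothendieck_generators
begin

section \<open>Finite generation and Baer's criterion\<close>

text \<open>Among the subobjects generated by finite sets of points take a maximal one. Adding one
  more point does not enlarge it, so it contains all points.\<close>

lemma noetherian_finite_cover: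
  assumes A: "noetherian_object C A"
  obtains F where "finite F" "F \<subseteq> pts A"
    "\<And>g. \<lbrakk>g \<in> Arr C; Dom C g = A; \<And>x. x \<in> F \<Longrightarrow> nul (g \<cdot> x)\<rbrakk> \<Longrightarrow> nul g"
proof -
  have AOb: "A \<in> Ob C" using A by (simp add: noetherian_object_def)
  define R where "R F s \<longleftrightarrow> monic C s \<and> Cod C s = A \<and> (\<forall>x \<in> F. sub_le C x s) \<and>
    (\<forall>g \<in> Arr C. Dom C g = Dom C s \<longrightarrow>
      (\<forall>x \<in> F. \<forall>u \<in> Arr C. Dom C u = Dom C x \<longrightarrow> Cod C u = Dom C s \<longrightarrow> s \<cdot> u = x \<longrightarrow> nul (g \<cdot> u)) \<longrightarrow> nul g)"
    for F s
  have "\<exists>s. R F s" if F: "F \<in> Fpow (pts A)" for F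
    unfolding R_def
    by (rule family_image[of F A, OF small_finite[OF universe] AOb])
      (use F in \<open>auto simp: Fpow_def pts_iff\<close>)
  then obtain s where sR: "\<And>F. F \<in> Fpow (pts A) \<Longrightarrow> R F (s F)" by metis
  have s: "monic C (s F)" "Cod C (s F) = A" "\<And>x. x \<in> F \<Longrightarrow> sub_le C x (s F)"
    if "F \<in> Fpow (pts A)" for F
    using sR[OF that] by (auto simp: R_def)
  have kill: "nul (g \<cdot> s F)" if F: "F \<in> Fpow (pts A)" and g: "g \<in> Arr C" "Dom C g = A"
    and n: "\<And>x. x \<in> F \<Longrightarrow> nul (g \<cdot> x)" for F g
  proof -
    have "nul ((g \<cdot> s F) \<cdot> u)" if "x \<in> F" "u \<in> Arr C" "Cod C u = Dom C (s F)" "s F \<cdot> u = x" for x u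
      using n[OF that(1)] that(2-) g s[OF F] by simp
    then show ?thesis using sR[OF F] g s[OF F] unfolding R_def by simp
  qed
  have "s ` Fpow (pts A) \<noteq> {}" by (simp add: Fpow_not_empty)
  then obtain m where m: "m \<in> s ` Fpow (pts A)"
    "\<And>n. \<lbrakk>n \<in> s ` Fpow (pts A); sub_le C m n\<rbrakk> \<Longrightarrow> sub_le C n m"
    by (rule noetherian_maximal[OF A]) (use s in auto)
  then obtain F where F: "F \<in> Fpow (pts A)" "m = s F" by blast
  show thesis
  proof (rule that[of F])
    fix g assume g: "g \<in> Arr C" "Dom C g = A" "\<And>x. x \<in> F \<Longrightarrow> nul (g \<cdot> x)"
    show "nul g"
    proof (rule nul_if_nul_pts[OF g(1)])
      fix x assume x: "x \<in> pts (Dom C g)"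
      let ?F = "insert x F"
      have F': "?F \<in> Fpow (pts A)" using F x g by (auto simp: Fpow_def)
      have sc: "s ?F \<in> Arr C" "Cod C (s ?F) = A" using s[OF F'] by auto
      have "nul (coker (s ?F) \<cdot> s F)"
      proof (rule kill[OF F(1)])
        fix y assume y: "y \<in> F"
        have "y \<in> Arr C" "Cod C y = A" using F y by (auto simp: Fpow_def pts_iff)
        then show "nul (coker (s ?F) \<cdot> y)"
          using monic_sub_le_iff[OF s(1)[OF F'], of y] s(3)[OF F', of y] y sc by simp
      qed (use sc in auto)
      then have "sub_le C (s F) (s ?F)"
        using monic_sub_le_iff[OF s(1)[OF F'], of "s F"] s[OF F(1)] sc by simp
      then have "sub_le C (s ?F) (s F)" using m(2) F F' by blast
      moreover have "sub_le C x (s ?F)" using s(3)[OF F'] by simp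
      ultimately have "sub_le C x (s F)" using sub_le_trans s[OF F(1)] by (metis monic_arr)
      then show "nul (g \<cdot> x)"
        by (rule sub_le_nul) (use kill[OF F(1) g] s[OF F(1)] g in auto)
    qed
  qed (use F in \<open>auto simp: Fpow_def\<close>)
qed

text \<open>An arrow out of \<open>A\<close> is determined by its finite graph on a finite set of
  points that covers \<open>A\<close>, and these graphs form a small set. So noetherian generators
  inherit the smallness condition from any generating set that has it.\<close>

lemma small_Hom_noetherian:
  assumes A: "noetherian_object C A" and B: "B \<in> Ob C"
  shows "small U (Hom C A B)"
proof -
  have AOb: "A \<in> Ob C" using A by (simp add: noetherian_object_def)
  obtain F where F: "finite F" "F \<subseteq> pts A"
    "\<And>g. \<lbrakk>g \<in> Arr C; Dom C g = A; \<And>x. x \<in> F \<Longrightarrow> nul (g \<cdot> x)\<rbrakk> \<Longrightarrow> nul g"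
    using noetherian_finite_cover[OF A] by blast
  have x: "x \<in> Arr C" "Cod C x = A" "Dom C x \<in> G" if "x \<in> F" for x using F(2) that by (auto simp: pts_iff)
  define gr where "gr f = (\<lambda>x. (x, f \<cdot> x)) ` F" for f
  show ?thesis
  proof (rule small_inj_on[of _ "Fpow (pts A \<times> pts B)" gr])
    show "small U (Fpow (pts A \<times> pts B))"
      by (intro small_Fpow small_Times universe small_pts AOb B)
    show "gr ` Hom C A B \<subseteq> Fpow (pts A \<times> pts B)"
      using F(1,2) x by (auto simp: gr_def Fpow_def pts_iff)
    show "inj_on gr (Hom C A B)"
    proof (rule inj_onI)
      fix f g assume fg: "f \<in> Hom C A B" "g \<in> Hom C A B" "gr f = gr g"
      have "nul (dif f g)"
      proof (rule F(3))
        fix y assume y: "y \<in> F"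
        have "(y, f \<cdot> y) \<in> gr f" using y by (simp add: gr_def)
        then have "(y, f \<cdot> y) \<in> gr g" by (simp add: fg(3))
        then have "f \<cdot> y = g \<cdot> y" by (auto simp: gr_def)
        then show "nul (dif f g \<cdot> y)" using fg(1,2) x[OF y] B G_Ob by simp
      qed (use fg in auto)
      then show "f = g" using fg(1,2) by (simp add: nul_dif)
    qed
  qed
qed

text \<open>The extension problem is reduced to showing that an essential extension \<open>q\<close>
  of \<open>E\<close> is epic. If a point \<open>x\<close> is not in its image, let \<open>i\<close>
  be the part of the generator that \<open>x\<close> maps into \<open>E\<close>, and let
  \<open>y\<close> extend the resulting partial arrow. Then \<open>x - q y\<close> is non-zero, so
  some non-zero multiple \<open>(x - q y) v\<close> lies in \<open>E\<close>. But then
  \<open>x v\<close> lies in \<open>E\<close> too, \<open>v\<close> factors through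
  \<open>i\<close>, and there \<open>x\<close> and \<open>q y\<close> agree.\<close>

lemma baer_criterion:
  assumes E: "E \<in> Ob C"
    and ext: "\<And>i f. \<lbrakk>monic C i; Cod C i \<in> G; f \<in> Hom C (Dom C i) E\<rbrakk> \<Longrightarrow> \<exists>g \<in> Hom C (Cod C i) E. g \<cdot> i = f"
  shows "injective_object C E"
  unfolding injective_object_def
proof (intro conjI allI impI ballI E)
  fix m f assume m: "monic C m" and f: "f \<in> Hom C (Dom C m) E"
  obtain k h where kh: "monic C k" "Dom C k = E" "h \<in> Arr C" "Dom C h = Cod C m"
    "Cod C h = Cod C k" "h \<cdot> m = k \<cdot> f"
    by (rule monic_pushout[OF m, of f]) (use f in auto)
  obtain l where l: "is_complement k l" using ex_complement0[OF kh(1)] .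
  then have lm: "monic C l" "Cod C l = Cod C k" by (auto simp: is_complement_def)
  \<comment> \<open>Dividing by a complement of \<open>k\<close> makes the pushout an essential
    extension of \<open>E\<close>.\<close>
  let ?c = "coker l"
  define q where "q = ?c \<cdot> k"
  have c: "?c \<in> Arr C" "Dom C ?c = Cod C k" using lm by auto
  have ess: "essential q" unfolding q_def by (rule essential_mod_complement[OF kh(1) l])
  have km: "monic C q" using ess by (simp add: essential_def)
  have k: "q \<in> Arr C" "Dom C q = E" "Cod C q = Cod C ?c" using c kh by (auto simp: q_def)
  define d where "d = coker q"
  have d: "d \<in> Arr C" "Dom C d = Cod C ?c" "nul (d \<cdot> q)" using k by (auto simp: d_def)
  have "nul d"
  proof (rule ccontr)
    assume "\<not> nul d"
    then obtain x where x: "x \<in> Arr C" "Dom C x \<in> G" "Cod C x = Cod C ?c" "\<not> nul (d \<cdot> x)"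
      using ex_nonzero_pt[OF d(1)] d(2) by metis
    define i where "i = ker (d \<cdot> x)"
    have dx: "d \<cdot> x \<in> Arr C" "Dom C (d \<cdot> x) = Dom C x" using d x by auto
    have i: "monic C i" "i \<in> Arr C" "Cod C i = Dom C x" using dx by (auto simp: i_def)
    have "nul ((d \<cdot> x) \<cdot> i)" using dx by (simp add: i_def del: assoc)
    then have "sub_le C (x \<cdot> i) q" using monic_sub_le_iff[OF km, of "x \<cdot> i"] k(1,3) d(1,2) x(1-3) i by (simp add: d_def)
    then obtain f' where f': "f' \<in> Arr C" "Dom C f' = Dom C (x \<cdot> i)" "Cod C f' = Dom C q" "q \<cdot> f' = x \<cdot> i"
      by (rule sub_leE)
    have f't: "Dom C f' = Dom C i" "Cod C f' = E" using f' x i k by auto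
    have "\<exists>g \<in> Hom C (Cod C i) E. g \<cdot> i = f'"
      by (rule ext[OF i(1)]) (unfold i(3), use x(2) f'(1) f't in simp_all)
    then obtain y where y: "y \<in> Hom C (Dom C x) E" "y \<cdot> i = f'" unfolding i(3) by blast
    let ?z = "dif x (q \<cdot> y)"
    have z: "?z \<in> Arr C" "Dom C ?z = Dom C x" "Cod C ?z = Cod C ?c" using x y(1) k by auto
    have "\<not> nul ?z"
    proof
      assume z0: "nul ?z"
      have xk: "q \<cdot> y = x"
        by (rule nul_dif[THEN iffD1, OF _ _ _ _ z0, symmetric]) (use x(1,3) y(1) k(1-3) in auto)
      have "nul ((d \<cdot> q) \<cdot> y)" by (rule nul_Comp_right) (use d k y(1) in auto)
      also have "(d \<cdot> q) \<cdot> y = d \<cdot> (q \<cdot> y)" by (rule assoc) (use d k y(1) in auto)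
      finally show False using x(4) xk by simp
    qed
    then obtain v a where va: "v \<in> Arr C" "Cod C v = Dom C ?z" "a \<in> Arr C" "Dom C a = Dom C v"
      "Cod C a = Dom C q" "?z \<cdot> v = q \<cdot> a" "\<not> nul (?z \<cdot> v)"
      using essentialE[OF ess z(1)] z(3) k(3) by metis
    have v: "Cod C v = Dom C x" and a: "Cod C a = E" using va(2,5) z(2) k(2) by auto
    have dz: "d \<cdot> ?z = d \<cdot> x"
    proof -
      have "nul ((d \<cdot> q) \<cdot> y)" by (rule nul_Comp_right) (use d k y(1) in auto)
      then have "d \<cdot> (q \<cdot> y) = Zero C (Dom C x) (Cod C d)"
        using nulD d(1,2) k y(1) by simp
      then show ?thesis using d x y(1) k by (simp del: assoc)
    qed
    have "nul ((d \<cdot> q) \<cdot> a)" by (rule nul_Comp_right) (use d k va(3) a in auto)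
    then have "nul (d \<cdot> (?z \<cdot> v))" unfolding va(6) using d k va(3) a by simp
    then have "nul ((d \<cdot> x) \<cdot> v)" using dz d z va(1) v assoc[of v ?z d] by (metis va(2))
    then obtain h' where h': "h' \<in> Arr C" "Dom C h' = Dom C v" "Cod C h' = Dom C i" "i \<cdot> h' = v"
      using ker_factorE[OF dx(1), of v] va(1) v dx(2) unfolding i_def by metis
    have "x \<cdot> v = (x \<cdot> i) \<cdot> h'" using h' x i by simp
    also have "\<dots> = (q \<cdot> y) \<cdot> (i \<cdot> h')"
      unfolding f'(4)[symmetric] y(2)[symmetric] using h'(1-3) k y(1) i by simp
    finally have "x \<cdot> v = (q \<cdot> y) \<cdot> v" using h'(4) by simp
    then have "nul (?z \<cdot> v)" using x(1,3) va(1) v y(1) k c(1) by (simp del: assoc)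
    then show False using va(7) by simp
  qed
  then have "epic C q" using epic_if_coker_nul k by (simp add: d_def)
  then obtain t where t: "t \<in> Hom C (Cod C q) (Dom C q)" "t \<cdot> q = Ident C (Dom C q)"
    using monic_epic_inverse[OF km] by metis
  have t': "t \<in> Arr C" "Dom C t = Cod C ?c" "Cod C t = E" using t(1) k by auto
  have "(t \<cdot> (?c \<cdot> h)) \<cdot> m = t \<cdot> (?c \<cdot> (h \<cdot> m))" using t' c kh(1-5) m by simp
  also have "\<dots> = (t \<cdot> q) \<cdot> f" unfolding kh(6) q_def using t' c kh(1-5) m f by simp
  also have "\<dots> = f" using t(2) k f by simp
  finally show "\<exists>g \<in> Hom C (Cod C m) E. g \<cdot> m = f"
    using t' c kh(1-5) by (intro bexI[of _ "t \<cdot> (?c \<cdot> h)"]) auto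
qed

end

section \<open>Simultaneous extension of partial arrows\<close>

locale noetherian_generators = grothendieck_generators C U G
  for C :: "('o, 'm) category" (structure) and U :: "'u itself" and G :: "'o set" +
  assumes noetherian: "X \<in> G \<Longrightarrow> noetherian_object C X"
begin

text \<open>A partial arrow from a generator \<open>X\<close> to \<open>M\<close>, that is, an arrow \<open>f\<close> to \<open>M\<close> from a subobject
  \<open>i\<close> of \<open>X\<close>, is determined by a finite set of points of its graph, so up to restriction there is
  only a small set of them. All are extended at once along a coproduct of the inclusions \<open>i\<close>.\<close>

lemma ex_one_step_extension:
  assumes M: "M \<in> Ob C"
  obtains j where "monic C j" "Dom C j = M"
    "\<And>i f. \<lbrakk>monic C i; Cod C i \<in> G; f \<in> Hom C (Dom C i) M\<rbrakk> \<Longrightarrow>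
      \<exists>g \<in> Hom C (Cod C i) (Cod C j). g \<cdot> i = j \<cdot> f"
proof -
  define P where "P = (\<Union>X \<in> G. pts X) \<times> pts M"
  \<comment> \<open>\<open>F\<close> is a finite part of the graph of the partial arrow
    \<open>(i, f)\<close>: each of its pairs consists of the images under \<open>i\<close> and
    \<open>f\<close> of one arrow into the domain of \<open>i\<close>.\<close>
  define R where "R = (\<lambda>(X, F) (i, f). monic C i \<and> Cod C i = X \<and> f \<in> Hom C (Dom C i) M \<and>
    (\<forall>(a, b) \<in> F. \<exists>y \<in> Arr C. Cod C y = Dom C i \<and> i \<cdot> y = a \<and> f \<cdot> y = b))"
  define I where "I = {XF \<in> G \<times> Fpow P. Ex (R XF)}"
  have "small U (\<Union>X \<in> G. pts X)" by (intro small_UN universe generators small_pts G_Ob)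
  then have "small U P" unfolding P_def by (intro small_Times universe small_pts M)
  then have "small U (G \<times> Fpow P)" by (intro small_Times small_Fpow universe generators)
  then have smI: "small U I" by (rule small_subset) (auto simp: I_def)
  have "\<forall>XF \<in> I. \<exists>p. R XF p" by (auto simp: I_def)
  \<comment> \<open>For each finite part of a graph, only one partial arrow containing it is
    chosen.\<close>
  then obtain r where "\<And>XF. XF \<in> I \<Longrightarrow> R XF (r XF)" by metis
  then have r: "R XF (fst (r XF), snd (r XF))" if "XF \<in> I" for XF using that by simp
  define m where "m XF = fst (r XF)" for XF
  define \<phi> where "\<phi> XF = snd (r XF)" for XF
  have m: "monic C (m (X, F))" "Cod C (m (X, F)) = X" "\<phi> (X, F) \<in> Hom C (Dom C (m (X, F))) M"
    "\<And>a b. (a, b) \<in> F \<Longrightarrow> \<exists>y \<in> Arr C. Cod C y = Dom C (m (X, F)) \<and> m (X, F) \<cdot> y = a \<and> \<phi> (X, F) \<cdot> y = b"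
    if "(X, F) \<in> I" for X F
    using r[OF that] by (auto simp: R_def m_def \<phi>_def)
  obtain \<mu> \<iota> \<kappa> where \<mu>: "monic C \<mu>"
    and \<iota>: "\<And>i. i \<in> I \<Longrightarrow> \<iota> i \<in> Hom C (Dom C (m i)) (Dom C \<mu>)"
    and \<kappa>: "\<And>i. i \<in> I \<Longrightarrow> \<kappa> i \<in> Hom C (Cod C (m i)) (Cod C \<mu>)"
    and \<mu>\<iota>: "\<And>i. i \<in> I \<Longrightarrow> \<mu> \<cdot> \<iota> i = \<kappa> i \<cdot> m i"
    and ex: "\<And>X f. \<lbrakk>X \<in> Ob C; \<And>i. i \<in> I \<Longrightarrow> f i \<in> Hom C (Dom C (m i)) X\<rbrakk>
      \<Longrightarrow> \<exists>u \<in> Hom C (Dom C \<mu>) X. \<forall>i \<in> I. u \<cdot> \<iota> i = f i"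
    by (rule coproduct_monic[of I m, OF smI]) (use m in auto)
  obtain u where u: "u \<in> Hom C (Dom C \<mu>) M" "\<And>i. i \<in> I \<Longrightarrow> u \<cdot> \<iota> i = \<phi> i"
    using ex[OF M, of \<phi>] m by auto
  obtain k h where kh: "monic C k" "Dom C k = M" "h \<in> Arr C" "Dom C h = Cod C \<mu>"
    "Cod C h = Cod C k" "h \<cdot> \<mu> = k \<cdot> u"
    by (rule monic_pushout[OF \<mu>, of u]) (use u in auto)
  show thesis
  proof (rule that[OF kh(1,2)])
    fix i f assume i: "monic C i" "Cod C i \<in> G" and f: "f \<in> Hom C (Dom C i) M"
    obtain F where F: "finite F" "F \<subseteq> pts (Dom C i)"
      "\<And>g. \<lbrakk>g \<in> Arr C; Dom C g = Dom C i; \<And>x. x \<in> F \<Longrightarrow> nul (g \<cdot> x)\<rbrakk> \<Longrightarrow> nul g"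
      using noetherian_finite_cover[OF subobject_noetherian[OF noetherian[OF i(2)] i(1)]] by blast
    have x: "x \<in> Arr C" "Cod C x = Dom C i" "Dom C x \<in> G" if "x \<in> F" for x
      using F(2) that by (auto simp: pts_iff)
    let ?F = "(\<lambda>x. (i \<cdot> x, f \<cdot> x)) ` F"
    let ?t = "(Cod C i, ?F)"
    \<comment> \<open>The partial arrow chosen for \<open>?t\<close> may differ from
      \<open>(i, f)\<close>. Its graph contains the images of the points in \<open>F\<close>, which
      cover the domain of \<open>i\<close>, so it restricts to \<open>(i, f)\<close>, and extending
      it extends \<open>f\<close>.\<close>
    have "R ?t (i, f)" using i f x by (auto simp: R_def)
    moreover have "?F \<subseteq> P" using i f x by (auto simp: P_def pts_iff)
    ultimately have t: "?t \<in> I" using i F(1) by (auto simp: I_def Fpow_def)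
    note mt = m[OF t]
    have ma: "m ?t \<in> Arr C" using mt by simp
    have y: "\<exists>y \<in> Arr C. Cod C y = Dom C (m ?t) \<and> m ?t \<cdot> y = i \<cdot> x \<and> \<phi> ?t \<cdot> y = f \<cdot> x" if "x \<in> F" for x
      using mt(4)[of "i \<cdot> x" "f \<cdot> x"] that by blast
    have "nul (coker (m ?t) \<cdot> i)"
    proof (rule F(3))
      fix z assume z: "z \<in> F"
      obtain y where y: "y \<in> Arr C" "Cod C y = Dom C (m ?t)" "m ?t \<cdot> y = i \<cdot> z" using y[OF z] by blast
      have "nul ((coker (m ?t) \<cdot> m ?t) \<cdot> y)" by (rule nul_Comp_right) (use ma y in auto)
      then show "nul ((coker (m ?t) \<cdot> i) \<cdot> z)" using ma y mt(2) i x[OF z] by simp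
    qed (use ma mt(2) i in auto)
    then have "sub_le C i (m ?t)" using monic_sub_le_iff[OF mt(1), of i] i mt(2) by simp
    then obtain e where e: "e \<in> Arr C" "Dom C e = Dom C i" "Cod C e = Dom C (m ?t)" "m ?t \<cdot> e = i"
      by (rule sub_leE)
    have "nul (dif (\<phi> ?t \<cdot> e) f)"
    proof (rule F(3))
      fix z assume z: "z \<in> F"
      obtain y where y: "y \<in> Arr C" "Cod C y = Dom C (m ?t)" "m ?t \<cdot> y = i \<cdot> z" "\<phi> ?t \<cdot> y = f \<cdot> z"
        using y[OF z] by blast
      have Dy: "Dom C y = Dom C z"
        using arg_cong[OF y(3), of "Dom C"] y(1,2) ma x[OF z] i by simp
      have "m ?t \<cdot> (e \<cdot> z) = m ?t \<cdot> y"
        unfolding y(3) using assoc[of z e "m ?t"] e x[OF z] ma by simp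
      then have "e \<cdot> z = y" by (rule monic_cancel[OF mt(1)]) (use e(1-3) x[OF z] y(1,2) Dy in auto)
      then have "\<phi> ?t \<cdot> (e \<cdot> z) = f \<cdot> z" using y(4) by simp
      then show "nul (dif (\<phi> ?t \<cdot> e) f \<cdot> z)" using e(1-3) x[OF z] mt(3) f M by (simp add: G_Ob)
    qed (use e(1-3) mt(3) f in auto)
    then have \<phi>e: "\<phi> ?t \<cdot> e = f" using e(1-3) mt(3) f by (simp add: nul_dif)
    have \<kappa>t: "\<kappa> ?t \<in> Arr C" "Dom C (\<kappa> ?t) = Cod C i" "Cod C (\<kappa> ?t) = Cod C \<mu>" using \<kappa>[OF t] mt(2) by auto
    have "(h \<cdot> \<kappa> ?t) \<cdot> i = h \<cdot> ((\<kappa> ?t \<cdot> m ?t) \<cdot> e)"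
      using \<kappa>t kh(3-5) e mt(2) ma i by simp
    also have "\<dots> = (h \<cdot> \<mu>) \<cdot> (\<iota> ?t \<cdot> e)"
      unfolding \<mu>\<iota>[OF t, symmetric] using \<iota>[OF t] kh(3-5) e(1-3) \<mu> by simp
    also have "\<dots> = k \<cdot> ((u \<cdot> \<iota> ?t) \<cdot> e)"
      unfolding kh(6) using \<iota>[OF t] kh(1,2) e(1-3) u(1) by simp
    also have "\<dots> = k \<cdot> f" using u(2)[OF t] \<phi>e by simp
    finally show "\<exists>g \<in> Hom C (Cod C i) (Cod C k). g \<cdot> i = k \<cdot> f"
      using \<kappa>t kh(3-5) by (intro bexI[of _ "h \<cdot> \<kappa> ?t"]) auto
  qed
qed

end

context noetherian_generators
begin

section \<open>The countable tower and its limit\<close>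

definition step :: "'o \<Rightarrow> 'm" where
  "step M = (SOME j. monic C j \<and> Dom C j = M \<and>
    (\<forall>i f. monic C i \<longrightarrow> Cod C i \<in> G \<longrightarrow> f \<in> Hom C (Dom C i) M \<longrightarrow>
      (\<exists>g \<in> Hom C (Cod C i) (Cod C j). g \<cdot> i = j \<cdot> f)))"

lemma step:
  assumes "M \<in> Ob C"
  shows "monic C (step M)" "Dom C (step M) = M"
    "\<lbrakk>monic C i; Cod C i \<in> G; f \<in> Hom C (Dom C i) M\<rbrakk> \<Longrightarrow>
      \<exists>g \<in> Hom C (Cod C i) (Cod C (step M)). g \<cdot> i = step M \<cdot> f"
proof -
  have "\<exists>j. monic C j \<and> Dom C j = M \<and>
    (\<forall>i f. monic C i \<longrightarrow> Cod C i \<in> G \<longrightarrow> f \<in> Hom C (Dom C i) M \<longrightarrow>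
      (\<exists>g \<in> Hom C (Cod C i) (Cod C j). g \<cdot> i = j \<cdot> f))"
    by (rule ex_one_step_extension[OF assms]) blast
  then have "monic C (step M) \<and> Dom C (step M) = M \<and>
    (\<forall>i f. monic C i \<longrightarrow> Cod C i \<in> G \<longrightarrow> f \<in> Hom C (Dom C i) M \<longrightarrow>
      (\<exists>g \<in> Hom C (Cod C i) (Cod C (step M)). g \<cdot> i = step M \<cdot> f))"
    unfolding step_def by (rule someI_ex)
  then show "monic C (step M)" "Dom C (step M) = M"
    "\<lbrakk>monic C i; Cod C i \<in> G; f \<in> Hom C (Dom C i) M\<rbrakk> \<Longrightarrow>
      \<exists>g \<in> Hom C (Cod C i) (Cod C (step M)). g \<cdot> i = step M \<cdot> f" by blast+
qed

primrec tower :: "'o \<Rightarrow> nat \<Rightarrow> 'o" where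
  "tower M 0 = M"
| "tower M (Suc n) = Cod C (step (tower M n))"

text \<open>Indexing by the starting stage and the number of steps gives a plain recursion;
  \<open>tower_arr\<close> translates to pairs of stages.\<close>

primrec climb :: "'o \<Rightarrow> nat \<Rightarrow> nat \<Rightarrow> 'm" where
  "climb M n 0 = Ident C (tower M n)"
| "climb M n (Suc k) = step (tower M (n + k)) \<cdot> climb M n k"

lemma tower_Ob: "M \<in> Ob C \<Longrightarrow> tower M n \<in> Ob C"
proof (induction n)
  case (Suc n)
  then have "monic C (step (tower M n))" using step(1) by blast
  then show ?case by simp
qed simp

lemma climb:
  assumes "M \<in> Ob C"
  shows "monic C (climb M n k) \<and> climb M n k \<in> Hom C (tower M n) (tower M (n + k))"
proof (induction k)
  case 0
  then show ?case using tower_Ob[OF assms] by simp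
next
  case (Suc k)
  then show ?case using step(1,2)[OF tower_Ob[OF assms, of "n + k"]] by (simp add: monic_Comp)
qed

lemma climb_add:
  assumes "M \<in> Ob C"
  shows "climb M (n + k) l \<cdot> climb M n k = climb M n (k + l)"
proof (induction l)
  case 0
  then show ?case using climb[OF assms, of n k] by simp
next
  case (Suc l)
  show ?case
    using climb[OF assms, of n k] climb[OF assms, of "n + k" l]
      step(1,2)[OF tower_Ob[OF assms, of "n + k + l"]] Suc
    by (simp add: add.assoc)
qed

definition tower_arr :: "'o \<Rightarrow> nat \<Rightarrow> nat \<Rightarrow> 'm" where "tower_arr M i j = climb M i (j - i)"

lemma tower_arr:
  assumes M: "M \<in> Ob C"
  shows "i \<le> j \<Longrightarrow> monic C (tower_arr M i j)" "i \<le> j \<Longrightarrow> tower_arr M i j \<in> Hom C (tower M i) (tower M j)"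
    "tower_arr M i i = Ident C (tower M i)"
    "\<lbrakk>i \<le> j; j \<le> k\<rbrakk> \<Longrightarrow> tower_arr M j k \<cdot> tower_arr M i j = tower_arr M i k"
    "tower_arr M i (Suc i) = step (tower M i)"
proof -
  show "i \<le> j \<Longrightarrow> monic C (tower_arr M i j)" "i \<le> j \<Longrightarrow> tower_arr M i j \<in> Hom C (tower M i) (tower M j)"
    using climb[OF M, of i "j - i"] by (auto simp: tower_arr_def)
  show "tower_arr M i i = Ident C (tower M i)" by (simp add: tower_arr_def)
  show "\<lbrakk>i \<le> j; j \<le> k\<rbrakk> \<Longrightarrow> tower_arr M j k \<cdot> tower_arr M i j = tower_arr M i k"
    using climb_add[OF M, of i "j - i" "k - j"] by (simp add: tower_arr_def)
  show "tower_arr M i (Suc i) = step (tower M i)"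
    using step[OF tower_Ob[OF M, of i]] tower_Ob[OF M, of i] by (simp add: tower_arr_def)
qed

lemma tower_system:
  assumes M: "M \<in> Ob C"
  shows "directed_system C UNIV (\<le>) (tower M) (tower_arr M)"
  unfolding directed_system_def directed_set_def
proof (intro conjI ballI impI)
  fix i j :: nat
  show "\<exists>k\<in>UNIV. i \<le> k \<and> j \<le> k" by (intro bexI[of _ "max i j"]) auto
qed (use tower_arr[OF M] tower_Ob[OF M] in auto)

text \<open>The arrow from stage \<open>n\<close> is the limit of the monomorphisms from the system that is
  constant from stage \<open>n\<close> onwards.\<close>

lemma tower_limit_monic:
  assumes M: "M \<in> Ob C" and L: "is_direct_limit C UNIV (\<le>) (tower M) (tower_arr M) L l"
  shows "monic C (l n)"
proof -
  note t = tower_arr[OF M] and Ld = is_direct_limitD[OF L]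
  let ?D = "\<lambda>k. tower M (min k n)" and ?d = "\<lambda>i j. tower_arr M (min i n) (min j n)"
  have D: "directed_system C UNIV (\<le>) ?D ?d"
    unfolding directed_system_def directed_set_def
  proof (intro conjI ballI impI)
    fix i j :: nat
    show "\<exists>k\<in>UNIV. i \<le> k \<and> j \<le> k" by (intro bexI[of _ "max i j"]) auto
  next
    fix i j :: nat assume "i \<le> j"
    then show "?d i j \<in> Hom C (?D i) (?D j)" by (intro t(2)) auto
  next
    fix i j k :: nat assume "i \<le> j \<and> j \<le> k"
    then show "?d j k \<cdot> ?d i j = ?d i k" by (intro t(4)) auto
  qed (use t tower_Ob[OF M] in auto)
  have lim: "is_direct_limit C UNIV (\<le>) ?D ?d (tower M n) (\<lambda>k. tower_arr M (min k n) n)"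
    unfolding is_direct_limit_def
  proof (intro conjI ballI allI impI)
    fix i show "tower_arr M (min i n) n \<in> Hom C (?D i) (tower M n)" by (intro t(2)) auto
  next
    fix i j :: nat assume "i \<le> j"
    then show "tower_arr M (min j n) n \<cdot> ?d i j = tower_arr M (min i n) n" by (intro t(4)) auto
  next
    fix X f assume X: "X \<in> Ob C" and f: "(\<forall>i\<in>UNIV. f i \<in> Hom C (?D i) X) \<and>
      (\<forall>i\<in>UNIV. \<forall>j\<in>UNIV. i \<le> j \<longrightarrow> f j \<cdot> ?d i j = f i)"
    have fH: "f i \<in> Hom C (?D i) X" for i using f by blast
    have fe: "f j \<cdot> ?d i j = f i" if "i \<le> j" for i j using f that by blast
    have fn: "f n \<in> Hom C (tower M n) X" using fH[of n] by simp
    show "\<exists>!u. u \<in> Hom C (tower M n) X \<and> (\<forall>i\<in>UNIV. u \<cdot> tower_arr M (min i n) n = f i)"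
    proof (rule ex1I[of _ "f n"], intro conjI ballI fn)
      fix i show "f n \<cdot> tower_arr M (min i n) n = f i"
      proof (cases "i \<le> n")
        case True
        then show ?thesis using fe[of i n] by simp
      next
        case False
        then have "f i \<cdot> Ident C (tower M n) = f n" using fe[of n i] t(3) by simp
        moreover have "f i \<cdot> Ident C (tower M n) = f i" using fH[of i] False by simp
        ultimately show ?thesis using False t(3) fn by simp
      qed
    next
      fix u assume u: "u \<in> Hom C (tower M n) X \<and> (\<forall>i\<in>UNIV. u \<cdot> tower_arr M (min i n) n = f i)"
      then have "u \<cdot> Ident C (tower M n) = f n" using t(3) by (metis UNIV_I min.idem)
      then show "u = f n" using u by simp
    qed
  qed (use tower_Ob[OF M] in auto)
  show ?thesis
  proof (rule direct_limit_monic[OF small_nat[OF universe] D tower_system[OF M] lim L])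
    show "system_morphism C UNIV (\<le>) ?D ?d (tower M) (tower_arr M) (\<lambda>k. tower_arr M (min k n) k)"
      unfolding system_morphism_def
    proof (intro conjI ballI impI)
      fix i show "tower_arr M (min i n) i \<in> Hom C (?D i) (tower M i)" by (intro t(2)) auto
    next
      fix i j :: nat assume "i \<le> j"
      then show "tower_arr M i j \<cdot> tower_arr M (min i n) i = tower_arr M (min j n) j \<cdot> ?d i j"
        using t(4)[of "min i n" i j] t(4)[of "min i n" "min j n" j] by simp
    qed
  next
    fix i :: nat
    have "l n \<cdot> tower_arr M (min i n) n = l (min i n)" by (rule Ld(3)) auto
    also have "\<dots> = l i \<cdot> tower_arr M (min i n) i" by (rule Ld(3)[symmetric]) auto
    finally show "l n \<cdot> tower_arr M (min i n) n = l i \<cdot> tower_arr M (min i n) i" .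
  qed (use t(1) Ld(2) in auto)
qed

text \<open>The inverse images \<open>p n\<close> of the stages ascend in \<open>A\<close>, so they
  stop growing at some \<open>N\<close>. As they cover \<open>A\<close>, all of \<open>A\<close> is
  mapped into stage \<open>N\<close>.\<close>

lemma noetherian_factors_tower_limit:
  assumes M: "M \<in> Ob C" and L: "is_direct_limit C UNIV (\<le>) (tower M) (tower_arr M) L l"
    and A: "noetherian_object C A" and f: "f \<in> Hom C A L"
  obtains n where "sub_le C f (l n)"
proof -
  note t = tower_arr[OF M] and Ld = is_direct_limitD[OF L]
  have lm: "monic C (l n)" "l n \<in> Arr C" "Dom C (l n) = tower M n" "Cod C (l n) = L" for n
    using tower_limit_monic[OF M L] Ld(2)[of n] by auto
  define c where "c n = coker (l n)" for n
  have c: "c n \<in> Arr C" "Dom C (c n) = L" "nul (c n \<cdot> l n)" for n using lm by (auto simp: c_def)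
  have cle: "nul (c j \<cdot> l i)" if "i \<le> j" for i j
  proof -
    have "nul ((c j \<cdot> l j) \<cdot> tower_arr M i j)"
      by (rule nul_Comp_right) (use c lm t(2)[OF that] in auto)
    then show ?thesis using c lm t(2)[OF that] Ld(3)[of i j] that by simp
  qed
  have cmono: "nul (c j \<cdot> x)" if "i \<le> j" "x \<in> Arr C" "Cod C x = L" "nul (c i \<cdot> x)" for i j x
  proof -
    have "sub_le C x (l i)" using monic_sub_le_iff[OF lm(1)] that lm by (simp add: c_def)
    then show ?thesis by (rule sub_le_nul) (use lm c cle[OF that(1)] in auto)
  qed
  define p where "p n = ker (c n \<cdot> f)" for n
  have p: "monic C (p n)" "p n \<in> Arr C" "Cod C (p n) = A" "nul (c n \<cdot> (f \<cdot> p n))" for n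
  proof -
    have cf: "c n \<cdot> f \<in> Arr C" "Dom C (c n \<cdot> f) = A" using c f by auto
    then show P: "monic C (p n)" "p n \<in> Arr C" "Cod C (p n) = A" by (auto simp: p_def)
    have "nul ((c n \<cdot> f) \<cdot> p n)" using cf unfolding p_def by (simp del: assoc)
    then show "nul (c n \<cdot> (f \<cdot> p n))" using c f P by simp
  qed
  have pS: "sub_le C (p i) (p j)" if "i \<le> j" for i j
  proof -
    have "nul (c j \<cdot> (f \<cdot> p i))" by (rule cmono[OF that]) (use f p in auto)
    then show ?thesis using sub_le_ker_iff[of "c j \<cdot> f" "p i"] c f p by (simp add: p_def)
  qed
  have "\<exists>N. \<forall>n\<ge>N. sub_le C (p n) (p N)"
    using A[unfolded noetherian_object_def, THEN conjunct2, rule_format, of p] p pS by simp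
  then obtain N where N: "\<And>n. n \<ge> N \<Longrightarrow> sub_le C (p n) (p N)" by blast
  \<comment> \<open>What \<open>f\<close> sends into stage \<open>i\<close> lies in
    \<open>p (max i N)\<close>, hence in \<open>p N\<close>, where \<open>c N \<cdot> f\<close>
    vanishes.\<close>
  have "nul (c N \<cdot> f)"
  proof (rule directed_cover_pullback[OF small_nat[OF universe], where lq = "(\<le>)" and I = UNIV and b = l and B = L and w = f])
    show "directed_set UNIV ((\<le>) :: nat \<Rightarrow> nat \<Rightarrow> bool)"
      using directed_systemD(1)[OF tower_system[OF M]] .
  next
    fix i j :: nat assume "i \<le> j"
    then show "nul (coker (l j) \<cdot> l i)" using cle by (simp add: c_def)
  next
    fix g assume g: "g \<in> Arr C" "Dom C g = L" "\<And>i. i \<in> UNIV \<Longrightarrow> nul (g \<cdot> l i)"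
    have z: "g \<cdot> l i = Zero C (tower M i) (Cod C g)" for i
      using nulD[OF g(3), of i "tower M i" "Cod C g"] g(1,2) lm by simp
    have "\<exists>!u. u \<in> Hom C L (Cod C g) \<and> (\<forall>i\<in>UNIV. u \<cdot> l i = Zero C (tower M i) (Cod C g))"
    proof (rule Ld(4))
      fix i j :: nat assume "i \<le> j"
      then show "Zero C (tower M j) (Cod C g) \<cdot> tower_arr M i j = Zero C (tower M i) (Cod C g)"
        using t(2)[of i j] g by simp
    qed (use g tower_Ob[OF M] in auto)
    moreover have "g \<in> Hom C L (Cod C g)" using g by simp
    moreover have "Zero C L (Cod C g) \<in> Hom C L (Cod C g)"
      "\<And>i. Zero C L (Cod C g) \<cdot> l i = Zero C (tower M i) (Cod C g)"
      using g(1) Ld(1) lm by auto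
    ultimately have "g = Zero C L (Cod C g)" using z by metis
    then show "nul g" using g Ld(1) by (metis nul_Zero Cod_in_Ob)
  next
    fix i :: nat and k
    assume k: "k \<in> Arr C" "Cod C k = Dom C f" "nul (coker (l i) \<cdot> (f \<cdot> k))"
    have kA: "Cod C k = A" using k(2) f by simp
    have fk: "f \<cdot> k \<in> Arr C" "Cod C (f \<cdot> k) = L" using f k(1) kA by auto
    let ?m = "max i N"
    have "nul (c ?m \<cdot> (f \<cdot> k))"
      by (rule cmono[of i]) (use fk k(3) in \<open>auto simp: c_def\<close>)
    then have "sub_le C k (p ?m)"
      using sub_le_ker_iff[of "c ?m \<cdot> f" k] c f k(1) kA by (simp add: p_def)
    then have "sub_le C k (p N)" using sub_le_trans[OF _ N[of ?m]] p by simp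
    then show "nul ((c N \<cdot> f) \<cdot> k)"
      by (rule sub_le_nul) (use c f p in auto)
  qed (use Ld(1) lm f c in auto)
  then have "sub_le C f (l N)" using monic_sub_le_iff[OF lm(1), of f N] f lm by (simp add: c_def)
  then show thesis by (rule that)
qed

text \<open>By Baer's criterion only partial arrows from generators matter. Such an arrow lands in
  some stage, since its domain is noetherian, and the next stage extends it.\<close>

lemma ex_injective_extension:
  assumes M: "M \<in> Ob C"
  obtains k where "monic C k" "Dom C k = M" "injective_object C (Cod C k)"
proof -
  note t = tower_arr[OF M]
  obtain L l where L: "is_direct_limit C UNIV (\<le>) (tower M) (tower_arr M) L l"
    using ex_direct_limit[OF small_nat[OF universe] tower_system[OF M]] .
  note Ld = is_direct_limitD[OF L]
  have "injective_object C L"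
  proof (rule baer_criterion[OF Ld(1)])
    fix i f assume i: "monic C i" "Cod C i \<in> G" and f: "f \<in> Hom C (Dom C i) L"
    obtain n where "sub_le C f (l n)"
      using noetherian_factors_tower_limit[OF M L subobject_noetherian[OF noetherian[OF i(2)] i(1) refl] f] .
    then obtain f' where f': "f' \<in> Arr C" "Dom C f' = Dom C f" "Cod C f' = Dom C (l n)" "l n \<cdot> f' = f"
      by (rule sub_leE)
    have f'H: "f' \<in> Hom C (Dom C i) (tower M n)" using f' f Ld(2)[of n] by simp
    obtain g where g: "g \<in> Hom C (Cod C i) (tower M (Suc n))" "g \<cdot> i = tower_arr M n (Suc n) \<cdot> f'"
      using step(3)[OF tower_Ob[OF M] i f'H] t(5)[of n] by auto
    have "(l (Suc n) \<cdot> g) \<cdot> i = l (Suc n) \<cdot> (g \<cdot> i)"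
      using Ld(2)[of "Suc n"] g(1) i by simp
    also have "\<dots> = (l (Suc n) \<cdot> tower_arr M n (Suc n)) \<cdot> f'"
      unfolding g(2) using Ld(2)[of "Suc n"] t(2)[of n "Suc n"] f'H by simp
    also have "l (Suc n) \<cdot> tower_arr M n (Suc n) = l n" by (rule Ld(3)) auto
    finally show "\<exists>h \<in> Hom C (Cod C i) L. h \<cdot> i = f"
      using Ld(2)[of "Suc n"] g(1) f'(4) by (intro bexI[of _ "l (Suc n) \<cdot> g"]) auto
  qed
  then show thesis using that[of "l 0"] tower_limit_monic[OF M L, of 0] Ld(2)[of 0] by simp
qed

end

section \<open>Torsion theories\<close>

context preadditive_category
begin

section \<open>Isomorphisms\<close>

lemma isomorphicE:
  assumes "isomorphic C A B"
  obtains f g where "f \<in> Hom C A B" "g \<in> Hom C B A" "g \<cdot> f = Ident C A" "f \<cdot> g = Ident C B"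
    "monic C f" "monic C g"
proof -
  obtain f g where fg: "f \<in> Hom C A B" "g \<in> Hom C B A" "g \<cdot> f = Ident C A" "f \<cdot> g = Ident C B"
    and ob: "A \<in> Ob C" "B \<in> Ob C"
    using assms unfolding isomorphic_def by blast
  have "monic C f" by (rule monic_Comp_right[of g]) (use fg ob in auto)
  moreover have "monic C g" by (rule monic_Comp_right[of f]) (use fg ob in auto)
  ultimately show thesis using fg that by blast
qed

lemma isomorphic_refl: "A \<in> Ob C \<Longrightarrow> isomorphic C A A"
  unfolding isomorphic_def by (intro conjI bexI[of _ "Ident C A"]) auto

lemma isomorphic_sym: "isomorphic C A B \<Longrightarrow> isomorphic C B A"
  unfolding isomorphic_def by blast

lemma isomorphic_trans:
  assumes "isomorphic C A B" "isomorphic C B D" shows "isomorphic C A D"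
proof -
  obtain f g where fg: "f \<in> Hom C A B" "g \<in> Hom C B A" "g \<cdot> f = Ident C A" "f \<cdot> g = Ident C B"
    using isomorphicE[OF assms(1)] by metis
  obtain h k where hk: "h \<in> Hom C B D" "k \<in> Hom C D B" "k \<cdot> h = Ident C B" "h \<cdot> k = Ident C D"
    using isomorphicE[OF assms(2)] by metis
  have "(g \<cdot> k) \<cdot> (h \<cdot> f) = g \<cdot> ((k \<cdot> h) \<cdot> f)" using fg(1,2) hk(1,2) by simp
  also have "\<dots> = Ident C A" using fg hk(3) by simp
  finally have 1: "(g \<cdot> k) \<cdot> (h \<cdot> f) = Ident C A" .
  have "(h \<cdot> f) \<cdot> (g \<cdot> k) = h \<cdot> ((f \<cdot> g) \<cdot> k)" using fg(1,2) hk(1,2) by simp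
  also have "\<dots> = Ident C D" using fg(4) hk by simp
  finally have 2: "(h \<cdot> f) \<cdot> (g \<cdot> k) = Ident C D" .
  have "h \<cdot> f \<in> Hom C A D" "g \<cdot> k \<in> Hom C D A" using fg(1,2) hk(1,2) by auto
  then show ?thesis using 1 2 assms unfolding isomorphic_def by blast
qed

lemma injective_extendE:
  assumes "injective_object C E" "monic C m" "f \<in> Hom C (Dom C m) E"
  obtains g where "g \<in> Hom C (Cod C m) E" "g \<cdot> m = f"
  using assms unfolding injective_object_def by blast

lemma iso_class_eq_iff:
  assumes "A \<in> Ob C" "B \<in> Ob C"
  shows "iso_class C A = iso_class C B \<longleftrightarrow> isomorphic C A B"
  using assms isomorphic_refl isomorphic_sym isomorphic_trans unfolding iso_class_def by blast

lemma Hom_trivialD: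
  assumes "Hom C A B = {Zero C A B}" "f \<in> Arr C" "Dom C f = A" "Cod C f = B"
  shows "nul f"
proof -
  have "f \<in> Hom C A B" using assms(2-4) by simp
  then have "f = Zero C A B" unfolding assms(1) by simp
  then show ?thesis using assms(2-4) by (metis nul_Zero Cod_in_Ob Dom_in_Ob)
qed

section \<open>Torsion and torsionfree classes\<close>

lemma torsion_theoryD:
  assumes "torsion_theory C T F"
  shows "T \<subseteq> Ob C" "F \<subseteq> Ob C"
    "\<And>f. \<lbrakk>f \<in> Arr C; Dom C f \<in> T; Cod C f \<in> F\<rbrakk> \<Longrightarrow> nul f"
    "\<And>X. \<lbrakk>X \<in> Ob C; \<And>f. \<lbrakk>f \<in> Arr C; Dom C f = X; Cod C f \<in> F\<rbrakk> \<Longrightarrow> nul f\<rbrakk> \<Longrightarrow> X \<in> T"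
    "\<And>Y. \<lbrakk>Y \<in> Ob C; \<And>f. \<lbrakk>f \<in> Arr C; Dom C f \<in> T; Cod C f = Y\<rbrakk> \<Longrightarrow> nul f\<rbrakk> \<Longrightarrow> Y \<in> F"
    "\<And>m. \<lbrakk>monic C m; Cod C m \<in> T\<rbrakk> \<Longrightarrow> Dom C m \<in> T"
proof -
  note tt = assms[unfolded torsion_theory_def]
  show T: "T \<subseteq> Ob C" and F: "F \<subseteq> Ob C" using tt by auto
  show "nul f" if "f \<in> Arr C" "Dom C f \<in> T" "Cod C f \<in> F" for f
  proof -
    have "Hom C (Dom C f) (Cod C f) = {Zero C (Dom C f) (Cod C f)}" using tt that by blast
    then show ?thesis using Hom_trivialD that(1) by blast
  qed
  show "X \<in> T" if "X \<in> Ob C" "\<And>f. \<lbrakk>f \<in> Arr C; Dom C f = X; Cod C f \<in> F\<rbrakk> \<Longrightarrow> nul f" for X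
  proof -
    have "Hom C X Y = {Zero C X Y}" if "Y \<in> F" for Y
      using Hom_trivial_iff[of X Y] that F \<open>X \<in> Ob C\<close> \<open>\<And>f. \<lbrakk>f \<in> Arr C; Dom C f = X; Cod C f \<in> F\<rbrakk> \<Longrightarrow> nul f\<close> by auto
    then show ?thesis using tt that(1) by blast
  qed
  show "Y \<in> F" if "Y \<in> Ob C" "\<And>f. \<lbrakk>f \<in> Arr C; Dom C f \<in> T; Cod C f = Y\<rbrakk> \<Longrightarrow> nul f" for Y
  proof -
    have "Hom C X Y = {Zero C X Y}" if "X \<in> T" for X
      using Hom_trivial_iff[of X Y] that T \<open>Y \<in> Ob C\<close> \<open>\<And>f. \<lbrakk>f \<in> Arr C; Dom C f \<in> T; Cod C f = Y\<rbrakk> \<Longrightarrow> nul f\<close> by auto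
    then show ?thesis using tt that(1) by blast
  qed
  show "Dom C m \<in> T" if "monic C m" "Cod C m \<in> T" for m using tt that by blast
qed

text \<open>Two torsion classes with the same torsionfree class are both its left orthogonal, so the
  definite description in \<open>torsion_of\<close> denotes.\<close>

lemma torsion_of_eq:
  assumes "torsion_theory C T F" shows "torsion_of C F = T"
  unfolding torsion_of_def
proof (rule the_equality, rule assms)
  fix T' assume T': "torsion_theory C T' F"
  have "T1 \<subseteq> T2" if 1: "torsion_theory C T1 F" and 2: "torsion_theory C T2 F" for T1 T2
  proof
    fix X assume X: "X \<in> T1"
    show "X \<in> T2"
      by (rule torsion_theoryD(4)[OF 2]) (use X torsion_theoryD(1,3)[OF 1] in auto)
  qed
  then show "T' = T" using assms T' by blast
qed

lemma torsionfree_subobject: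
  assumes "torsion_theory C T F" "monic C m" "Cod C m \<in> F"
  shows "Dom C m \<in> F"
proof (rule torsion_theoryD(5)[OF assms(1)])
  fix f assume f: "f \<in> Arr C" "Dom C f \<in> T" "Cod C f = Dom C m"
  have "nul (m \<cdot> f)" by (rule torsion_theoryD(3)[OF assms(1)]) (use f assms in auto)
  then show "nul f" using monicD[OF assms(2)] f by blast
qed (use assms in auto)

text \<open>Isomorphic objects are subobjects of each other. This makes the map well defined on
  isomorphism classes.\<close>

lemma gen_torsionfree_isomorphic:
  assumes "isomorphic C A B" shows "gen_torsionfree C A = gen_torsionfree C B"
proof -
  obtain f g where "f \<in> Hom C A B" "g \<in> Hom C B A" "monic C f" "monic C g"
    using isomorphicE[OF assms] by metis
  then have "A \<in> F \<longleftrightarrow> B \<in> F" if "torsionfree_class C F" for F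
    using that torsionfree_subobject[of _ F f] torsionfree_subobject[of _ F g]
    unfolding torsionfree_class_def by auto
  then show ?thesis unfolding gen_torsionfree_def by (metis (mono_tags, lifting))
qed

end

context abelian_category
begin

text \<open>Let \<open>f\<close> be a non-zero arrow from a torsion object. The inverse image
  \<open>p\<close> of \<open>m\<close> under \<open>f\<close> is torsion by heredity, so
  \<open>f\<close> kills it; but by essentiality \<open>f\<close> has a non-zero multiple in
  \<open>m\<close>, which comes from \<open>p\<close>.\<close>

lemma torsionfree_essential:
  assumes tt: "torsion_theory C T F" and m: "essential m" "Dom C m \<in> F"
  shows "Cod C m \<in> F"
proof (rule torsion_theoryD(5)[OF tt])
  have mm: "monic C m" using m(1) by (simp add: essential_def)
  show "Cod C m \<in> Ob C" using mm by simp
  fix f assume f: "f \<in> Arr C" "Dom C f \<in> T" "Cod C f = Cod C m"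
  show "nul f"
  proof (rule ccontr)
    assume "\<not> nul f"
    then obtain z a where za: "z \<in> Arr C" "Cod C z = Dom C f" "a \<in> Arr C" "Dom C a = Dom C z"
      "Cod C a = Dom C m" "f \<cdot> z = m \<cdot> a" "\<not> nul (f \<cdot> z)"
      using essentialE[OF m(1) f(1) f(3)] by metis
    define p where "p = ker (coker m \<cdot> f)"
    have cf: "coker m \<cdot> f \<in> Arr C" "Dom C (coker m \<cdot> f) = Dom C f" using f mm by auto
    have p: "monic C p" "p \<in> Arr C" "Cod C p = Dom C f" using cf by (auto simp: p_def)
    have pT: "Dom C p \<in> T" by (rule torsion_theoryD(6)[OF tt p(1)]) (use p f in simp)
    have "nul ((coker m \<cdot> m) \<cdot> a)" by (rule nul_Comp_right) (use za mm in auto)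
    then have "nul ((coker m \<cdot> f) \<cdot> z)" using za(1-6) mm f by simp
    then have zp: "sub_le C z p" using sub_le_ker_iff[OF cf(1) za(1)] cf(2) za(2) by (simp add: p_def)
    have "nul ((coker m \<cdot> f) \<cdot> p)" using cf(1) unfolding p_def by (simp del: assoc)
    then have "sub_le C (f \<cdot> p) m" using monic_sub_le_iff[OF mm, of "f \<cdot> p"] f p mm by simp
    then obtain b where b: "b \<in> Arr C" "Dom C b = Dom C (f \<cdot> p)" "Cod C b = Dom C m" "m \<cdot> b = f \<cdot> p"
      by (rule sub_leE)
    have "nul b" by (rule torsion_theoryD(3)[OF tt b(1)]) (use b(2,3) f p pT m(2) in auto)
    then have "nul (m \<cdot> b)" by (rule nul_Comp_left[rotated -1]) (use b mm in auto)
    then have "nul (f \<cdot> z)" unfolding b(4) by (intro sub_le_nul[OF zp]) (use f p in auto)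
    then show False using za(7) by simp
  qed
qed

lemma gen_torsionfree_essential:
  assumes "essential m"
  shows "gen_torsionfree C (Dom C m) = gen_torsionfree C (Cod C m)"
proof -
  have "monic C m" using assms by (simp add: essential_def)
  then have "Dom C m \<in> F \<longleftrightarrow> Cod C m \<in> F" if "torsionfree_class C F" for F
    using that torsionfree_subobject[of _ F m] torsionfree_essential[of _ F m] assms
    unfolding torsionfree_class_def by auto
  then show ?thesis unfolding gen_torsionfree_def by (metis (mono_tags, lifting))
qed

section \<open>Torsion theories cogenerated by injective objects\<close>

definition tors :: "'a \<Rightarrow> 'a set" where
  "tors E = {X \<in> Ob C. \<forall>f \<in> Arr C. Dom C f = X \<longrightarrow> Cod C f = E \<longrightarrow> nul f}"

lemma tors_iff_Hom_trivial:
  "\<lbrakk>A \<in> Ob C; E \<in> Ob C\<rbrakk> \<Longrightarrow> A \<in> tors E \<longleftrightarrow> Hom C A E = {Zero C A E}"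
  using Hom_trivial_iff[of A E] by (auto simp: tors_def)

lemma torsD: "\<lbrakk>f \<in> Arr C; Dom C f \<in> tors E; Cod C f = E\<rbrakk> \<Longrightarrow> nul f"
  by (auto simp: tors_def)

text \<open>Heredity holds because arrows to \<open>E\<close> extend from subobjects. If a
  torsionfree class contains \<open>E\<close>, its torsion objects have no non-zero arrows to
  \<open>E\<close>, so its torsion class lies in \<open>tors E\<close>; hence the right orthogonal
  of \<open>tors E\<close> is the least torsionfree class containing \<open>E\<close>.\<close>

lemma injective_torsion_theory:
  assumes E: "injective_object C E"
  shows "torsion_theory C (tors E) (gen_torsionfree C E)"
proof -
  have EOb: "E \<in> Ob C" using E by (simp add: injective_object_def)
  define F where "F = {Y \<in> Ob C. \<forall>f \<in> Arr C. Dom C f \<in> tors E \<longrightarrow> Cod C f = Y \<longrightarrow> nul f}"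
  have EF: "E \<in> F" using EOb torsD by (auto simp: F_def)
  have tt: "torsion_theory C (tors E) F"
    unfolding torsion_theory_def
  proof (intro conjI ballI allI impI)
    fix X Y assume "X \<in> tors E" "Y \<in> F"
    then show "Hom C X Y = {Zero C X Y}" using Hom_trivial_iff[of X Y] by (auto simp: F_def tors_def)
  next
    fix X assume X: "X \<in> Ob C" "\<forall>Y \<in> F. Hom C X Y = {Zero C X Y}"
    then show "X \<in> tors E" using tors_iff_Hom_trivial EF EOb by blast
  next
    fix Y assume Y: "Y \<in> Ob C" "\<forall>X \<in> tors E. Hom C X Y = {Zero C X Y}"
    have "nul f" if f: "f \<in> Arr C" "Dom C f \<in> tors E" "Cod C f = Y" for f
      using Hom_trivialD Y f by blast
    then show "Y \<in> F" using Y(1) by (auto simp: F_def)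
  next
    fix m assume m: "monic C m \<and> Cod C m \<in> tors E"
    have "nul f" if f: "f \<in> Arr C" "Dom C f = Dom C m" "Cod C f = E" for f
    proof -
      obtain g where g: "g \<in> Hom C (Cod C m) E" "g \<cdot> m = f"
        by (rule injective_extendE[OF E, of m f]) (use m f in auto)
      have "nul g" using torsD[of g E] g(1) m by simp
      then have "nul (g \<cdot> m)" by (rule nul_Comp_right[rotated -1]) (use g m in auto)
      then show ?thesis using g by simp
    qed
    then show "Dom C m \<in> tors E" using m by (auto simp: tors_def)
  qed (auto simp: F_def tors_def)
  have "F \<subseteq> F'" if F': "torsionfree_class C F'" "E \<in> F'" for F'
  proof
    fix Y assume Y: "Y \<in> F"
    obtain T where T: "torsion_theory C T F'" using F' by (auto simp: torsionfree_class_def)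
    have "T \<subseteq> tors E" using torsion_theoryD(1,3)[OF T] F'(2) by (auto simp: tors_def)
    then show "Y \<in> F'" using torsion_theoryD(5)[OF T, of Y] Y by (auto simp: F_def)
  qed
  moreover have "torsionfree_class C F" using tt by (auto simp: torsionfree_class_def)
  ultimately have "gen_torsionfree C E = F" using EF unfolding gen_torsionfree_def by blast
  then show ?thesis using tt by simp
qed

lemma torsion_of_injective:
  "injective_object C E \<Longrightarrow> torsion_of C (gen_torsionfree C E) = tors E"
  using injective_torsion_theory torsion_of_eq by blast

lemma gen_torsion_subset_iff:
  assumes "torsion_theory C T F"
  shows "gen_torsion C A \<subseteq> T \<longleftrightarrow> A \<in> T"
  using assms unfolding gen_torsion_def torsion_class_def by blast

lemma retract_injective:
  assumes E: "injective_object C E" and k: "k \<in> Hom C K E" "r \<in> Hom C E K" "r \<cdot> k = Ident C K"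
  shows "injective_object C K"
  unfolding injective_object_def
proof (intro conjI allI impI ballI)
  show "K \<in> Ob C" using k by auto
  fix m f assume m: "monic C m" and f: "f \<in> Hom C (Dom C m) K"
  have "k \<cdot> f \<in> Hom C (Dom C m) E" using f k by simp
  then obtain g where g: "g \<in> Hom C (Cod C m) E" "g \<cdot> m = k \<cdot> f"
    using injective_extendE[OF E m] by metis
  have "(r \<cdot> g) \<cdot> m = (r \<cdot> k) \<cdot> f" using g m f k(1,2) by simp
  then show "\<exists>g \<in> Hom C (Cod C m) K. g \<cdot> m = f"
    using g(1) m f k by (intro bexI[of _ "r \<cdot> g"]) auto
qed

text \<open>The other summand \<open>ker r\<close> must vanish, so \<open>r\<close> is monic; a
  monic arrow with a right inverse is invertible.\<close>

lemma indecomposable_retract: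
  assumes E: "indecomposable_object C E" and k: "k \<in> Hom C K E" "r \<in> Hom C E K" "r \<cdot> k = Ident C K"
    and K: "\<not> zero_object C K"
  shows "k \<cdot> r = Ident C E"
proof -
  have ob: "K \<in> Ob C" "E \<in> Ob C" using k by auto
  have "is_biproduct C (Dom C (ker r)) K E" by (rule retract_biproduct[OF k])
  then have "zero_object C (Dom C (ker r))" using E K unfolding indecomposable_object_def by blast
  then have "nul (ker r)" using nul_from_zero_object k by simp
  then have rm: "monic C r" using monic_if_ker_nul k by simp
  have "r \<cdot> (k \<cdot> r) = (r \<cdot> k) \<cdot> r" using k(1,2) by simp
  also have "\<dots> = r \<cdot> Ident C E" using k ob by simp
  finally show ?thesis by (rule monic_cancel[OF rm]) (use k(1,2) ob in auto)
qed

end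

context grothendieck_generators
begin

section \<open>Uniformity of indecomposable injectives and torsion-critical objects\<close>

text \<open>The injective hull of \<open>k\<close> inside \<open>E\<close> is a non-zero retract of
  \<open>E\<close>, so it is all of \<open>E\<close>, and \<open>k\<close> is essential in
  it.\<close>

lemma indecomposable_injective_essential:
  assumes E: "E \<in> indec_injectives C" and k: "monic C k" "Cod C k = E" "\<not> nul k"
  shows "essential k"
proof -
  have Ei: "injective_object C (Cod C k)" "indecomposable_object C E"
    using E k by (auto simp: indec_injectives_def)
  obtain k' r a where h: "monic C k'" "Cod C k' = Cod C k" "r \<in> Hom C (Cod C k) (Dom C k')"
    "r \<cdot> k' = Ident C (Dom C k')" "essential a" "Dom C a = Dom C k" "Cod C a = Dom C k'" "k' \<cdot> a = k"
    using injective_hull_inside[OF k(1) Ei(1)] by metis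
  have am: "monic C a" using h(5) by (simp add: essential_def)
  have k'H: "k' \<in> Hom C (Dom C k') E" and rH: "r \<in> Hom C E (Dom C k')" using h(1-3) k(2) by auto
  have "\<not> zero_object C (Dom C k')"
  proof
    assume "zero_object C (Dom C k')"
    then have "nul k'" using nul_from_zero_object[of "Dom C k'" k'] h(1) by simp
    then have "nul (k' \<cdot> a)" by (rule nul_Comp_right[rotated -1]) (use h(1,7) am in auto)
    then show False using k(3) h(8) by simp
  qed
  then have kr: "k' \<cdot> r = Ident C E" using indecomposable_retract[OF Ei(2) k'H rH h(4)] by simp
  show ?thesis
    unfolding essential_def
  proof (intro conjI ballI impI k(1))
    fix w assume w0: "w \<in> Arr C" "Cod C w = Cod C k" and nw: "\<not> nul w"
    then have w: "w \<in> Arr C" "Cod C w = E" using k by auto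
    have kk: "k' \<cdot> (r \<cdot> x) = x" if "x \<in> Arr C" "Cod C x = E" for x
      using assoc[of x r k'] kr k'H rH that by simp
    have "\<not> nul (r \<cdot> w)"
      using nul_Comp_left[of "r \<cdot> w" k'] kk[OF w] nw k'H rH w by auto
    then obtain z y where zy: "z \<in> Arr C" "Cod C z = Dom C (r \<cdot> w)" "y \<in> Arr C" "Dom C y = Dom C z"
      "Cod C y = Dom C a" "(r \<cdot> w) \<cdot> z = a \<cdot> y" "\<not> nul ((r \<cdot> w) \<cdot> z)"
      using essentialE[OF h(5), of "r \<cdot> w"] w rH h(7) by auto
    have z: "Cod C z = Dom C w" using zy(2) w rH by simp
    have yk: "Cod C y = Dom C k" using zy(5) h(6) by simp
    have "w \<cdot> z = k' \<cdot> ((r \<cdot> w) \<cdot> z)" using kk[of "w \<cdot> z"] w zy(1) z rH by simp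
    also have "\<dots> = (k' \<cdot> a) \<cdot> y" unfolding zy(6) using zy(3,5) am h(1,7) by simp
    finally have wz: "w \<cdot> z = k \<cdot> y" using h(8) by simp
    have "\<not> nul (w \<cdot> z)"
      using nul_Comp_left[of "w \<cdot> z" r] zy(1,7) w z rH by auto
    then show "\<exists>z\<in>Arr C. Cod C z = Dom C w \<and> sub_le C (w \<cdot> z) k \<and> \<not> nul (w \<cdot> z)"
      using wz zy(1,3) z yk k(1) sub_le_Comp_self[of k y] by (intro bexI[of _ z]) auto
  qed
qed

lemma torsion_criticalD:
  assumes "torsion_critical C A" "monic C m" "Cod C m = A" "\<not> nul m"
  shows "Cod C (coker m) \<in> torsion_of C (gen_torsionfree C A)"
  using assms monic_nonzero_iff[OF assms(2)] is_cokernel_coker[of m]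
  unfolding torsion_critical_def by auto

text \<open>If \<open>w\<close> had no non-zero multiple in \<open>n\<close>, its image would embed
  into the quotient by \<open>n\<close>, which is torsion. Being also a subobject of the torsionfree
  object \<open>A\<close>, the image would vanish.\<close>

lemma torsion_critical_uniform:
  assumes A: "torsion_critical C A" "torsionfree_class C (gen_torsionfree C A)"
    and n: "monic C n" "Cod C n = A" "\<not> nul n"
  shows "essential n"
  unfolding essential_def
proof (intro conjI ballI impI n(1))
  fix w assume w0: "w \<in> Arr C" "Cod C w = Cod C n" and nw: "\<not> nul w"
  have w: "w \<in> Arr C" "Cod C w = A" using w0 n by auto
  obtain T where T: "torsion_theory C T (gen_torsionfree C A)"
    using A(2) by (auto simp: torsionfree_class_def)
  have AF: "A \<in> gen_torsionfree C A" by (auto simp: gen_torsionfree_def)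
  define c where "c = coker n"
  have c: "c \<in> Arr C" "Dom C c = A" "Cod C c \<in> T"
    using torsion_criticalD[OF A(1) n] torsion_of_eq[OF T] n by (auto simp: c_def)
  define m where "m = ker (c \<cdot> w)"
  have cw: "c \<cdot> w \<in> Arr C" "Dom C (c \<cdot> w) = Dom C w" using c w by auto
  have m: "monic C m" "m \<in> Arr C" "Cod C m = Dom C w" using cw by (auto simp: m_def)
  have "nul ((c \<cdot> w) \<cdot> m)" using cw(1) unfolding m_def by (simp del: assoc)
  then have wmn: "sub_le C (w \<cdot> m) n"
    using monic_sub_le_iff[OF n(1), of "w \<cdot> m"] w m n(2) c(1,2) by (simp add: c_def)
  have "\<not> nul (w \<cdot> m)"
  proof
    assume wm: "nul (w \<cdot> m)"
    obtain e i where ei: "epic C e" "monic C i" "Dom C e = Dom C w" "Cod C e = Dom C i"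
      "Cod C i = Cod C w" "i \<cdot> e = w"
      by (rule image_factorization[OF w(1)])
    have iA: "i \<in> Arr C" "Cod C i = A" using ei w by auto
    have "monic C (c \<cdot> i)"
    proof (rule monicI)
      fix x assume "x \<in> Arr C" "Cod C x = Dom C (c \<cdot> i)" "nul ((c \<cdot> i) \<cdot> x)"
      then have x: "x \<in> Arr C" "Cod C x = Dom C i" "nul (c \<cdot> (i \<cdot> x))" using c iA by auto
      obtain e' z where z: "epic C e'" "Cod C e' = Dom C x" "z \<in> Arr C" "Dom C z = Dom C e'"
        "Cod C z = Dom C e" "e \<cdot> z = x \<cdot> e'"
        by (rule epic_pullback[OF ei(1) x(1)]) (use x ei in auto)
      have zw: "Cod C z = Dom C w" using z(5) ei(3) by simp
      have wz: "w \<cdot> z = i \<cdot> (x \<cdot> e')"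
        unfolding ei(6)[symmetric] z(6)[symmetric] using ei(1,2,4) z(3,5) by simp
      have "nul ((c \<cdot> (i \<cdot> x)) \<cdot> e')" by (rule nul_Comp_right) (use c iA x z in auto)
      then have "nul ((c \<cdot> w) \<cdot> z)" using c iA x(1,2) z(1-3) w zw wz by simp
      then have "sub_le C z m" using sub_le_ker_iff[OF cw(1) z(3)] zw cw(2) by (simp add: m_def)
      then have "nul (w \<cdot> z)" by (rule sub_le_nul) (use wm m w in auto)
      then have "nul (x \<cdot> e')" unfolding wz
        by (rule monicD[OF ei(2), rotated -1]) (use x(1,2) z(1,2) in auto)
      then show "nul x" by (rule epicD[OF z(1), rotated -1]) (use x z in auto)
    qed (use c iA in auto)
    then have "Dom C (c \<cdot> i) \<in> T" by (rule torsion_theoryD(6)[OF T]) (use c iA in auto)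
    then have "Dom C i \<in> T" using c iA by simp
    then have "nul i" using torsion_theoryD(3)[OF T iA(1)] iA AF by simp
    then have "nul (i \<cdot> e)" by (rule nul_Comp_right[rotated -1]) (use ei in auto)
    then show False using nw ei by simp
  qed
  then show "\<exists>z\<in>Arr C. Cod C z = Dom C w \<and> sub_le C (w \<cdot> z) n \<and> \<not> nul (w \<cdot> z)"
    using wmn m by blast
qed

text \<open>Uniformity for arrows in place of subobjects: the image of \<open>y\<close> is
  essential, and a common multiple found there lifts to the domain of \<open>y\<close> after an
  epimorphic cover.\<close>

lemma torsion_critical_arrows_meet:
  assumes A: "torsion_critical C A" "torsionfree_class C (gen_torsionfree C A)"
    and y: "y \<in> Arr C" "Cod C y = A" "\<not> nul y" and w: "w \<in> Arr C" "Cod C w = A" "\<not> nul w"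
  obtains s z where "s \<in> Arr C" "Cod C s = Dom C y" "z \<in> Arr C" "Cod C z = Dom C w"
    "Dom C s = Dom C z" "w \<cdot> z = y \<cdot> s" "\<not> nul (w \<cdot> z)"
proof -
  obtain e n where en: "epic C e" "monic C n" "Dom C e = Dom C y" "Cod C e = Dom C n"
    "Cod C n = Cod C y" "n \<cdot> e = y"
    by (rule image_factorization[OF y(1)])
  have "\<not> nul n" using nul_Comp_right[of e n] en y(3) by auto
  then have ess: "essential n" using torsion_critical_uniform[OF A en(2)] en y by simp
  obtain z b where zb: "z \<in> Arr C" "Cod C z = Dom C w" "b \<in> Arr C" "Dom C b = Dom C z"
    "Cod C b = Dom C n" "w \<cdot> z = n \<cdot> b" "\<not> nul (w \<cdot> z)"
    using essentialE[OF ess w(1)] w en y by metis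
  obtain e' s where s: "epic C e'" "Cod C e' = Dom C b" "s \<in> Arr C" "Dom C s = Dom C e'"
    "Cod C s = Dom C e" "e \<cdot> s = b \<cdot> e'"
    by (rule epic_pullback[OF en(1) zb(3)]) (use zb en in auto)
  have ez: "Cod C e' = Dom C z" using s(2) zb(4) by simp
  have "w \<cdot> (z \<cdot> e') = (w \<cdot> z) \<cdot> e'" using w zb(1,2) s(1) ez by simp
  also have "\<dots> = n \<cdot> (e \<cdot> s)" unfolding zb(6) s(6) using en(2) zb(3,5) s(1,2) by simp
  also have "\<dots> = y \<cdot> s" using assoc[of s e n] en s by simp
  finally have eq: "w \<cdot> (z \<cdot> e') = y \<cdot> s" .
  have "\<not> nul (w \<cdot> (z \<cdot> e'))"
    using epicD[OF s(1), of "w \<cdot> z"] zb(1,2,7) w s(1) ez by auto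
  then show thesis using that[of s "z \<cdot> e'"] eq s en zb(1,2) w ez by simp
qed

end

context noetherian_generators
begin

text \<open>A non-zero arrow from a proper quotient of the image of \<open>f\<close> to
  \<open>E\<close> would compose to a non-zero arrow from the generator whose kernel is strictly
  larger than that of \<open>f\<close>. So there is none, and this is what torsion means for the
  class generated by \<open>E\<close>.\<close>

lemma ex_torsion_critical_subobject:
  assumes E: "E \<in> indec_injectives C"
  obtains m where "monic C m" "Cod C m = E" "\<not> nul m" "torsion_critical C (Dom C m)"
proof -
  have Ei: "injective_object C E" "E \<in> Ob C" "\<not> nul (Ident C E)"
    using E zero_object_Ident by (auto simp: indec_injectives_def indecomposable_object_def)
  obtain x where x: "x \<in> Arr C" "Dom C x \<in> G" "Cod C x = E" "\<not> nul x"
    using ex_nonzero_pt[of "Ident C E"] Ei by auto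
  let ?X = "Dom C x"
  let ?M = "ker ` {f \<in> Arr C. Dom C f = ?X \<and> Cod C f = E \<and> \<not> nul f}"
  obtain k where k: "k \<in> ?M" "\<And>n. \<lbrakk>n \<in> ?M; sub_le C k n\<rbrakk> \<Longrightarrow> sub_le C n k"
    by (rule noetherian_maximal[OF noetherian[OF x(2)], of ?M]) (use x in auto)
  obtain f where f: "f \<in> Arr C" "Dom C f = ?X" "Cod C f = E" "\<not> nul f" "k = ker f"
    using k(1) by auto
  obtain e m where em: "epic C e" "monic C m" "Dom C e = Dom C f" "Cod C e = Dom C m"
    "Cod C m = Cod C f" "m \<cdot> e = f"
    by (rule image_factorization[OF f(1)])
  have mE: "Cod C m = E" and eX: "Dom C e = ?X" using em f by auto
  have mn: "\<not> nul m" using nul_Comp_right[of e m] em f(4) by auto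
  have tE: "torsion_of C (gen_torsionfree C (Dom C m)) = tors E"
    using gen_torsionfree_essential[OF indecomposable_injective_essential[OF E em(2) mE mn]] mE
      torsion_of_injective[OF Ei(1)] by simp
  have "torsion_critical C (Dom C m)"
    unfolding torsion_critical_def tE
  proof (intro conjI allI impI)
    show "Dom C m \<in> Ob C" using em by simp
    show "\<not> zero_object C (Dom C m)" using monic_nonzero_iff[OF em(2)] mn by simp
    fix n c assume nc: "monic C n \<and> Cod C n = Dom C m \<and> \<not> zero_object C (Dom C n) \<and> is_cokernel C c n"
    then have n: "monic C n" "Cod C n = Dom C m" "\<not> nul n"
      using monic_nonzero_iff[of n] by auto
    have c: "epic C c" "c \<in> Arr C" "Dom C c = Dom C m" "nul (c \<cdot> n)"
      using nc by (auto simp: is_cokernel_iff)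
    have "nul g" if g: "g \<in> Arr C" "Dom C g = Cod C c" "Cod C g = E" for g
    proof (rule ccontr)
      assume gn: "\<not> nul g"
      define h where "h = g \<cdot> (c \<cdot> e)"
      have h: "h \<in> Arr C" "Dom C h = ?X" "Cod C h = E" using g c em(1,4) eX by (auto simp: h_def)
      have "\<not> nul h"
      proof
        assume "nul h"
        then have "nul ((g \<cdot> c) \<cdot> e)" using g c em(1,4) by (simp add: h_def)
        then have "nul (g \<cdot> c)" by (rule epicD[OF em(1), rotated -1]) (use g c em(1,4) in auto)
        then have "nul g" by (rule epicD[OF c(1), rotated -1]) (use g in auto)
        then show False using gn by simp
      qed
      then have hM: "ker h \<in> ?M" using h by blast
      have kf: "k \<in> Arr C" "Cod C k = ?X" "nul (f \<cdot> k)" using f by auto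
      have "m \<cdot> (e \<cdot> k) = f \<cdot> k" using assoc[of k e m] em(1,2,4,6) eX kf by simp
      then have "nul (e \<cdot> k)"
        using monicD[OF em(2), of "e \<cdot> k"] kf em(1,4) eX by simp
      then have "nul ((g \<cdot> c) \<cdot> (e \<cdot> k))"
        by (rule nul_Comp_left[rotated -1]) (use g c em(1,4) eX kf in auto)
      then have "nul (h \<cdot> k)" using g c em(1,4) eX kf by (simp add: h_def)
      then have "sub_le C k (ker h)" using sub_le_ker_iff[OF h(1) kf(1)] kf h by simp
      then have hk: "sub_le C (ker h) k" using k(2)[OF hM] by simp
      \<comment> \<open>A lift \<open>z\<close> of \<open>n\<close> to the generator is killed by
        \<open>h\<close>, so by maximality it is killed by \<open>f\<close>; this forces
        \<open>n\<close> to vanish.\<close>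
      obtain e' z where z: "epic C e'" "Cod C e' = Dom C n" "z \<in> Arr C" "Dom C z = Dom C e'"
        "Cod C z = Dom C e" "e \<cdot> z = n \<cdot> e'"
        by (rule epic_pullback[OF em(1), of n]) (use n em(4) in auto)
      have zX: "Cod C z = ?X" using z(5) eX by simp
      have "nul ((c \<cdot> n) \<cdot> e')" by (rule nul_Comp_right) (use c n z in auto)
      then have cez: "nul (c \<cdot> (e \<cdot> z))" unfolding z(6) using c n(1,2) z(1,2) by simp
      have "nul (g \<cdot> (c \<cdot> (e \<cdot> z)))"
        by (rule nul_Comp_left[OF _ _ _ cez]) (use g c em(1,4) z(3,5) in auto)
      then have "nul (h \<cdot> z)" using g c em(1,4) z(3) zX eX by (simp add: h_def)
      then have "sub_le C z (ker h)" using sub_le_ker_iff[OF h(1) z(3)] zX h by simp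
      then have "sub_le C z k" using hk sub_le_trans kf(1) by blast
      then have "nul (f \<cdot> z)" by (rule sub_le_nul) (use kf f in auto)
      also have "f \<cdot> z = m \<cdot> (n \<cdot> e')"
        unfolding z(6)[symmetric] using assoc[of z e m] em(1,2,4,6) z(3,5) by simp
      finally have "nul (n \<cdot> e')" by (rule monicD[OF em(2), rotated -1]) (use n(1,2) z(1,2) in auto)
      then have "nul n" by (rule epicD[OF z(1), rotated -1]) (use n z in auto)
      then show False using n(3) by simp
    qed
    then show "Cod C c \<in> tors E" using c by (auto simp: tors_def)
  qed
  then show thesis using that em(2) mE mn by blast
qed

section \<open>The bijection between the spectra\<close>

lemma gen_torsionfree_prime:
  assumes E: "E \<in> indec_injectives C"
  shows "gen_torsionfree C E \<in> prime_torsion_theories C"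
proof -
  obtain m where m: "monic C m" "Cod C m = E" "\<not> nul m" "torsion_critical C (Dom C m)"
    by (rule ex_torsion_critical_subobject[OF E])
  have "gen_torsionfree C E = gen_torsionfree C (Dom C m)"
    using gen_torsionfree_essential[OF indecomposable_injective_essential[OF E m(1-3)]] m(2) by simp
  moreover have "torsionfree_class C (gen_torsionfree C E)"
    using injective_torsion_theory E unfolding indec_injectives_def torsionfree_class_def by blast
  ultimately show ?thesis using m(4) unfolding prime_torsion_theories_def by auto
qed

text \<open>A torsion-critical subobject of \<open>E\<close> has a non-zero arrow \<open>f\<close>
  to \<open>E'\<close>, since it is not torsion. If \<open>f\<close> were not monic, it would factor
  through a proper quotient, which is torsion and has only zero arrows to \<open>E'\<close>.\<close>

lemma isomorphic_if_gen_torsionfree_eq: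
  assumes E: "E \<in> indec_injectives C" and E': "E' \<in> indec_injectives C"
    and eq: "gen_torsionfree C E = gen_torsionfree C E'"
  shows "isomorphic C E E'"
proof -
  have i: "injective_object C E" "injective_object C E'" "indecomposable_object C E'"
    and ob: "E \<in> Ob C" "E' \<in> Ob C" and nz: "\<not> zero_object C E"
    using E E' by (auto simp: indec_injectives_def indecomposable_object_def)
  have tors: "tors E = tors E'" using eq torsion_of_injective i by metis
  obtain m where m: "monic C m" "Cod C m = E" "\<not> nul m" "torsion_critical C (Dom C m)"
    by (rule ex_torsion_critical_subobject[OF E])
  have ess: "essential m" by (rule indecomposable_injective_essential[OF E m(1-3)])
  have tE: "torsion_of C (gen_torsionfree C (Dom C m)) = tors E"
    using gen_torsionfree_essential[OF ess] m(2) torsion_of_injective[OF i(1)] by simp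
  have "Dom C m \<notin> tors E'" unfolding tors[symmetric] using m by (auto simp: tors_def)
  then obtain f where f: "f \<in> Arr C" "Dom C f = Dom C m" "Cod C f = E'" "\<not> nul f"
    using m by (auto simp: tors_def)
  have fm: "monic C f"
  proof (rule monic_if_ker_nul[OF f(1)], rule ccontr)
    assume n: "\<not> nul (ker f)"
    let ?c = "coker (ker f)"
    have "Cod C ?c \<in> tors E'"
      using torsion_criticalD[OF m(4), of "ker f"] n f unfolding tE tors by simp
    moreover obtain u where u: "u \<in> Arr C" "Dom C u = Cod C ?c" "Cod C u = E'" "u \<cdot> ?c = f"
      using coker_factorE[of "ker f" f] f by (metis ker_arr(2,3,4))
    ultimately have "nul u" using torsD by simp
    then have "nul (u \<cdot> ?c)" by (rule nul_Comp_right[rotated -1]) (use u f in auto)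
    then show False using u f by simp
  qed
  have "f \<in> Hom C (Dom C m) E'" using f by simp
  then obtain g where g: "g \<in> Hom C E E'" "g \<cdot> m = f"
    using i(2) m(1) unfolding injective_object_def m(2)[symmetric] by blast
  \<comment> \<open>The restriction of \<open>g\<close> to the essential subobject \<open>m\<close>
    is the monomorphism \<open>f\<close>. Then \<open>g\<close> splits because \<open>E\<close> is
    injective, and a non-zero retract of the indecomposable \<open>E'\<close> is all of it.\<close>
  have gm: "monic C g"
  proof (rule monicI, goal_cases)
    case 1
    then show ?case using g by simp
  next
    case (2 x)
    then have x: "x \<in> Arr C" "Cod C x = E" "nul (g \<cdot> x)" using g by auto
    show "nul x"
    proof (rule ccontr)
      assume "\<not> nul x"
      then obtain z a where za: "z \<in> Arr C" "Cod C z = Dom C x" "a \<in> Arr C" "Dom C a = Dom C z"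
        "Cod C a = Dom C m" "x \<cdot> z = m \<cdot> a" "\<not> nul (x \<cdot> z)"
        using essentialE[OF ess x(1)] x(2) m(2) by metis
      have "nul ((g \<cdot> x) \<cdot> z)" by (rule nul_Comp_right) (use x g za in auto)
      also have "(g \<cdot> x) \<cdot> z = (g \<cdot> m) \<cdot> a" using x(1,2) g(1) za(1-3,5,6) m(1,2) by simp
      finally have "nul (f \<cdot> a)" using g by simp
      then have "nul a" by (rule monicD[OF fm, rotated -1]) (use za f in auto)
      then have "nul (m \<cdot> a)" by (rule nul_Comp_left[rotated -1]) (use za m in auto)
      then show False using za by simp
    qed
  qed
  have gE: "Dom C g = E" "Cod C g = E'" using g by auto
  have "Ident C E \<in> Hom C (Dom C g) E" using ob gE by simp
  then obtain r where r: "r \<in> Hom C E' E" "r \<cdot> g = Ident C E"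
    using i(1)[unfolded injective_object_def, THEN conjunct2, rule_format, OF gm, of "Ident C E"] gE by blast
  have "g \<cdot> r = Ident C E'" by (rule indecomposable_retract[OF i(3) g(1) r nz])
  then show ?thesis using g(1) r ob unfolding isomorphic_def by blast
qed

lemma prime_imp_gen_torsionfree:
  assumes "F \<in> prime_torsion_theories C"
  obtains E where "E \<in> indec_injectives C" "F = gen_torsionfree C E"
proof -
  obtain A where A: "torsion_critical C A" "torsionfree_class C (gen_torsionfree C A)"
    and F: "F = gen_torsionfree C A"
    using assms by (auto simp: prime_torsion_theories_def)
  have AOb: "A \<in> Ob C" "\<not> nul (Ident C A)"
    using A(1) zero_object_Ident by (auto simp: torsion_critical_def)
  obtain k where k: "monic C k" "Dom C k = A" "injective_object C (Cod C k)"
    using ex_injective_extension[OF AOb(1)] by metis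
  obtain k' r a where h: "monic C k'" "Cod C k' = Cod C k" "r \<in> Hom C (Cod C k) (Dom C k')"
    "r \<cdot> k' = Ident C (Dom C k')" "essential a" "Dom C a = Dom C k" "Cod C a = Dom C k'" "k' \<cdot> a = k"
    using injective_hull_inside[OF k(1,3)] by metis
  define E where "E = Dom C k'"
  have a: "monic C a" "Dom C a = A" "Cod C a = E" using h k by (auto simp: E_def essential_def)
  have k'H: "k' \<in> Hom C E (Cod C k)" "r \<in> Hom C (Cod C k) E" "r \<cdot> k' = Ident C E"
    using h by (auto simp: E_def)
  have inj: "injective_object C E" by (rule retract_injective[OF k(3) k'H])
  have EOb: "E \<in> Ob C" using inj by (simp add: injective_object_def)
  have "indecomposable_object C E"
    unfolding indecomposable_object_def
  proof (intro conjI allI impI EOb)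
    show "\<not> zero_object C E"
      using nul_to_zero_object[of E a] zero_object_nul_monic[of a] a A(1)
      by (auto simp: torsion_critical_def)
    fix P Q assume "is_biproduct C P Q E"
    then obtain i j p q where b: "i \<in> Hom C P E" "j \<in> Hom C Q E" "p \<in> Hom C E P" "q \<in> Hom C E Q"
      "p \<cdot> i = Ident C P" "q \<cdot> j = Ident C Q" "Add C (i \<cdot> p) (j \<cdot> q) = Ident C E"
      by (rule is_biproductE)
    have o: "p \<cdot> j = Zero C Q P" "q \<cdot> i = Zero C P Q" by (rule biproduct_orthogonal[OF b])+
    have ob: "P \<in> Ob C" "Q \<in> Ob C" using b by auto
    show "zero_object C P \<or> zero_object C Q"
    proof (rule ccontr)
      assume nz: "\<not> (zero_object C P \<or> zero_object C Q)"
      have im: "monic C i" by (rule monic_Comp_right[of p]) (use b(1-5) ob in auto)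
      have jm: "monic C j" by (rule monic_Comp_right[of q]) (use b(1-4,6) ob in auto)
      have "\<not> nul i" "\<not> nul j" using monic_nonzero_iff[OF im] monic_nonzero_iff[OF jm] nz b by auto
      \<comment> \<open>Both summands meet \<open>A\<close>, as \<open>a\<close> is essential.
        Uniformity of \<open>A\<close> yields a common non-zero multiple, which lies in both
        summands and is therefore killed by the projection \<open>q\<close>.\<close>
      then obtain x y where xy: "x \<in> Arr C" "Cod C x = P" "y \<in> Arr C" "Dom C y = Dom C x" "Cod C y = A"
        "i \<cdot> x = a \<cdot> y" "\<not> nul (i \<cdot> x)"
        using essentialE[OF h(5), of i] b(1) a by auto
      obtain x' y' where xy': "x' \<in> Arr C" "Cod C x' = Q" "y' \<in> Arr C" "Dom C y' = Dom C x'" "Cod C y' = A"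
        "j \<cdot> x' = a \<cdot> y'" "\<not> nul (j \<cdot> x')"
        using essentialE[OF h(5), of j] b(2) a \<open>\<not> nul j\<close> by auto
      have "\<not> nul y" using nul_Comp_left[of y a] xy a by auto
      moreover have "\<not> nul y'" using nul_Comp_left[of y' a] xy' a by auto
      ultimately obtain s z where sz: "s \<in> Arr C" "Cod C s = Dom C y" "z \<in> Arr C" "Cod C z = Dom C y'"
        "Dom C s = Dom C z" "y' \<cdot> z = y \<cdot> s" "\<not> nul (y' \<cdot> z)"
        using torsion_critical_arrows_meet[OF A, of y y'] xy xy' by metis
      have sx: "Cod C s = Dom C x" and zx: "Cod C z = Dom C x'" using sz(2,4) xy(4) xy'(4) by auto
      have "j \<cdot> (x' \<cdot> z) = (j \<cdot> x') \<cdot> z" using b(2) xy'(1,2) sz(3) zx by simp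
      also have "\<dots> = a \<cdot> (y' \<cdot> z)" unfolding xy'(6) using a xy'(3,5) sz(3,4) by simp
      also have "\<dots> = (a \<cdot> y) \<cdot> s" unfolding sz(6) using a xy(3,5) sz(1,2) by simp
      also have "\<dots> = i \<cdot> (x \<cdot> s)" unfolding xy(6)[symmetric] using b(1) xy(1,2) sz(1) sx by simp
      finally have ji: "j \<cdot> (x' \<cdot> z) = i \<cdot> (x \<cdot> s)" .
      have "x' \<cdot> z = (q \<cdot> j) \<cdot> (x' \<cdot> z)" using b(6) xy'(1,2) sz(3) zx by simp
      also have "\<dots> = q \<cdot> (j \<cdot> (x' \<cdot> z))" using b(2,4) xy'(1,2) sz(3) zx by (intro assoc) auto
      also have "\<dots> = (q \<cdot> i) \<cdot> (x \<cdot> s)" unfolding ji using b(1,4) xy(1,2) sz(1) sx by simp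
      finally have "nul (x' \<cdot> z)" using o xy(1,2) sz(1) sx ob by simp
      then have "nul (j \<cdot> (x' \<cdot> z))"
        by (rule nul_Comp_left[rotated -1]) (use b(2) xy'(1,2) sz(3) zx in auto)
      moreover have "j \<cdot> (x' \<cdot> z) = a \<cdot> (y' \<cdot> z)"
        using \<open>(j \<cdot> x') \<cdot> z = a \<cdot> (y' \<cdot> z)\<close> b(2) xy'(1,2) sz(3) zx by simp
      ultimately have "nul (y' \<cdot> z)"
        using monicD[OF a(1), of "y' \<cdot> z"] a xy'(3,5) sz(3,4) by simp
      then show False using sz by simp
    qed
  qed
  then have "E \<in> indec_injectives C" using inj by (simp add: indec_injectives_def)
  moreover have "F = gen_torsionfree C E"
    using gen_torsionfree_essential[OF h(5)] a F by simp
  ultimately show thesis by (rule that)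
qed

end

section \<open>The spectra\<close>

text \<open>\<open>topology\<close> has the intended open sets only if the unions of base sets
  satisfy \<open>istopology\<close>; closure of the base under binary intersections ensures
  this.\<close>

lemma openin_base:
  assumes "\<And>S T. \<lbrakk>P S; P T\<rbrakk> \<Longrightarrow> P (S \<inter> T)"
  shows "openin (topology (arbitrary union_of P)) W \<longleftrightarrow> (\<exists>\<U>. \<U> \<subseteq> Collect P \<and> W = \<Union>\<U>)"
  using istopology_base[of P] assms by (auto simp: topology_inverse' union_of_def arbitrary_def)

lemma topspace_base:
  assumes "\<And>S T. \<lbrakk>P S; P T\<rbrakk> \<Longrightarrow> P (S \<inter> T)"
  shows "topspace (topology (arbitrary union_of P)) = \<Union>(Collect P)"
proof -
  have op: "openin (topology (arbitrary union_of P)) W \<longleftrightarrow> (\<exists>\<U>. \<U> \<subseteq> Collect P \<and> W = \<Union>\<U>)" for W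
    using assms by (rule openin_base)
  show ?thesis
  proof (rule equalityI)
    show "topspace (topology (arbitrary union_of P)) \<subseteq> \<Union>(Collect P)"
      using openin_topspace[of "topology (arbitrary union_of P)", unfolded op] by blast
    show "\<Union>(Collect P) \<subseteq> topspace (topology (arbitrary union_of P))"
      by (rule openin_subset, unfold op) (rule exI[of _ "Collect P"], simp)
  qed
qed

text \<open>Injectivity makes images commute with intersections, so closure under intersections is
  inherited by the base of the codomain and has to be proved on one side only.\<close>

lemma homeomorphic_map_base:
  assumes P: "\<And>S T. \<lbrakk>P S; P T\<rbrakk> \<Longrightarrow> P (S \<inter> T)"
    and Q: "\<And>V. Q V \<longleftrightarrow> (\<exists>S. P S \<and> V = f ` S)"
    and inj: "inj_on f (\<Union>(Collect P))"
  shows "homeomorphic_map (topology (arbitrary union_of P)) (topology (arbitrary union_of Q)) f"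
proof -
  let ?X = "topology (arbitrary union_of P)" and ?Y = "topology (arbitrary union_of Q)"
  have Qi: "Q (f ` S)" if "P S" for S using that unfolding Q by blast
  have Qd: "\<exists>S. P S \<and> V = f ` S" if "Q V" for V using that unfolding Q .
  have Q': "Q (V \<inter> W)" if VW: "Q V" "Q W" for V W
  proof -
    obtain S T where S: "P S" "V = f ` S" and T: "P T" "W = f ` T" using Qd[OF VW(1)] Qd[OF VW(2)] by blast
    have "f ` (S \<inter> T) = f ` S \<inter> f ` T"
      by (rule inj_on_image_Int[OF inj]) (use S(1) T(1) in blast)+
    then show ?thesis using Qi[OF P[OF S(1) T(1)]] S(2) T(2) by simp
  qed
  have oX: "openin ?X W \<longleftrightarrow> (\<exists>\<U>. \<U> \<subseteq> Collect P \<and> W = \<Union>\<U>)" for W using P by (rule openin_base)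
  have oY: "openin ?Y W \<longleftrightarrow> (\<exists>\<U>. \<U> \<subseteq> Collect Q \<and> W = \<Union>\<U>)" for W using Q' by (rule openin_base)
  have tX: "topspace ?X = \<Union>(Collect P)" using P by (rule topspace_base)
  have tY: "topspace ?Y = \<Union>(Collect Q)" using Q' by (rule topspace_base)
  have im: "f ` topspace ?X = topspace ?Y" unfolding tX tY
  proof (intro equalityI subsetI)
    fix y assume "y \<in> f ` \<Union>(Collect P)"
    then show "y \<in> \<Union>(Collect Q)" using Qi by blast
  next
    fix y assume "y \<in> \<Union>(Collect Q)"
    then obtain V where V: "Q V" "y \<in> V" by blast
    show "y \<in> f ` \<Union>(Collect P)" using Qd[OF V(1)] V(2) by blast
  qed
  have op: "openin ?Y (f ` W)" if W: "openin ?X W" for W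
  proof -
    obtain \<U> where U: "\<U> \<subseteq> Collect P" "W = \<Union>\<U>" using W[unfolded oX] by blast
    have "(`) f ` \<U> \<subseteq> Collect Q" using U(1) Qi by blast
    moreover have "f ` W = \<Union>((`) f ` \<U>)" using U(2) by blast
    ultimately show ?thesis unfolding oY by (intro exI conjI)
  qed
  have cont: "openin ?X {x \<in> topspace ?X. f x \<in> V}" if V: "openin ?Y V" for V
  proof -
    obtain \<V> where \<V>: "\<V> \<subseteq> Collect Q" "V = \<Union>\<V>" using V[unfolded oY] by blast
    \<comment> \<open>By injectivity a base set is the full preimage of its image, so these base
      sets make up the preimage of \<open>V\<close>.\<close>
    define \<U> where "\<U> = {S. P S \<and> f ` S \<in> \<V>}"
    have "{x \<in> topspace ?X. f x \<in> V} = \<Union>\<U>"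
    proof (intro equalityI subsetI)
      fix x assume "x \<in> {x \<in> topspace ?X. f x \<in> V}"
      then obtain D where x: "x \<in> \<Union>(Collect P)" and D: "D \<in> \<V>" "f x \<in> D" using tX \<V>(2) by blast
      then obtain S where S: "P S" "D = f ` S" using \<V>(1) Qd by blast
      then have "x \<in> S" using inj_on_image_mem_iff[OF inj x, of S] D(2) by blast
      then show "x \<in> \<Union>\<U>" using S D(1) by (auto simp: \<U>_def)
    next
      fix x assume "x \<in> \<Union>\<U>"
      then show "x \<in> {x \<in> topspace ?X. f x \<in> V}" using tX \<V>(2) by (auto simp: \<U>_def)
    qed
    then show ?thesis unfolding oX by (intro exI[of _ \<U>]) (auto simp: \<U>_def)
  qed
  show ?thesis
  proof (rule bijective_open_imp_homeomorphic_map)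
    show "continuous_map ?X ?Y f" unfolding continuous_map_def using im cont by auto
    show "open_map ?X ?Y f" unfolding open_map_def using op by blast
    show "f ` topspace ?X = topspace ?Y" by (rule im)
    show "inj_on f (topspace ?X)" using inj tX by simp
  qed
qed

section \<open>Basic open sets and direct sums\<close>

lemma finitely_presentedD:
  fixes U :: "'u itself" and I :: "'u set"
  assumes "finitely_presented U C A" "small U I" "directed_system C I lq D d"
    "is_direct_limit C I lq D d L l"
  shows "f \<in> Hom C A L \<Longrightarrow> \<exists>i \<in> I. \<exists>g \<in> Hom C A (D i). l i \<cdot>\<^bsub>C\<^esub> g = f"
    "\<lbrakk>i \<in> I; j \<in> I; g \<in> Hom C A (D i); h \<in> Hom C A (D j); l i \<cdot>\<^bsub>C\<^esub> g = l j \<cdot>\<^bsub>C\<^esub> h\<rbrakk> \<Longrightarrow>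
      \<exists>k \<in> I. lq i k \<and> lq j k \<and> d i k \<cdot>\<^bsub>C\<^esub> g = d j k \<cdot>\<^bsub>C\<^esub> h"
  using assms unfolding finitely_presented_def by blast+

context preadditive_category
begin

text \<open>Arrows out of \<open>S\<close> are pairs of arrows out of \<open>A\<close> and
  \<open>B\<close>. The stages obtained for the two components are joined by directedness.\<close>

lemma finitely_presented_biproduct:
  fixes U :: "'u itself"
  assumes A: "finitely_presented U C A" and B: "finitely_presented U C B" and S: "is_biproduct C A B S"
  shows "finitely_presented U C S"
  unfolding finitely_presented_def
proof (intro conjI allI impI ballI)
  show SOb: "S \<in> Ob C" using S by (simp add: is_biproduct_def)
  obtain a b p q where bi: "a \<in> Hom C A S" "b \<in> Hom C B S" "p \<in> Hom C S A" "q \<in> Hom C S B"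
    and sum: "Add C (a \<cdot> p) (b \<cdot> q) = Ident C S"
    using S by (rule is_biproductE)
  have split: "f = Add C ((f \<cdot> a) \<cdot> p) ((f \<cdot> b) \<cdot> q)" if f: "f \<in> Arr C" "Dom C f = S" for f
  proof -
    have "f = f \<cdot> Add C (a \<cdot> p) (b \<cdot> q)" using f sum by simp
    also have "\<dots> = Add C ((f \<cdot> a) \<cdot> p) ((f \<cdot> b) \<cdot> q)" using f bi by simp
    finally show ?thesis .
  qed
  fix I :: "'u set" and lq D d L l
  assume H: "small U I \<and> directed_system C I lq D d \<and> is_direct_limit C I lq D d L l"
  then have sm: "small U I" and sys: "directed_system C I lq D d" and lim: "is_direct_limit C I lq D d L l"
    by auto
  note s = directed_systemD[OF sys] and Ld = is_direct_limitD[OF lim]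
  note dir = directed_setD[OF s(1)]
  note fA = finitely_presentedD[OF A sm sys lim] and fB = finitely_presentedD[OF B sm sys lim]
  {
    fix f assume f: "f \<in> Hom C S L"
    have "f \<cdot> a \<in> Hom C A L" "f \<cdot> b \<in> Hom C B L" using f bi by auto
    then obtain i g j h where g: "i \<in> I" "g \<in> Hom C A (D i)" "l i \<cdot> g = f \<cdot> a"
      and h: "j \<in> I" "h \<in> Hom C B (D j)" "l j \<cdot> h = f \<cdot> b"
      using fA(1) fB(1) by meson
    obtain k where k: "k \<in> I" "lq i k" "lq j k" using dir(4)[OF g(1) h(1)] by blast
    note dik = s(3)[OF g(1) k(1,2)] and djk = s(3)[OF h(1) k(1,3)]
    let ?e = "Add C (d i k \<cdot> (g \<cdot> p)) (d j k \<cdot> (h \<cdot> q))"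
    have e: "?e \<in> Hom C S (D k)" using dik djk g(2) h(2) bi by auto
    have "l k \<cdot> ?e = Add C (((l k \<cdot> d i k) \<cdot> g) \<cdot> p) (((l k \<cdot> d j k) \<cdot> h) \<cdot> q)"
      using dik djk g(2) h(2) bi Ld(2)[OF k(1)] by simp
    also have "\<dots> = Add C ((f \<cdot> a) \<cdot> p) ((f \<cdot> b) \<cdot> q)"
      unfolding Ld(3)[OF g(1) k(1,2)] Ld(3)[OF h(1) k(1,3)] g(3) h(3) ..
    also have "\<dots> = f" using split[of f] f by simp
    finally show "\<exists>i \<in> I. \<exists>g \<in> Hom C S (D i). l i \<cdot> g = f" using k(1) e by blast
  next
    fix i j g h assume ij: "i \<in> I" "j \<in> I" and gh: "g \<in> Hom C S (D i)" "h \<in> Hom C S (D j)"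
      and eq: "l i \<cdot> g = l j \<cdot> h"
    have lx: "l i \<cdot> (g \<cdot> x) = l j \<cdot> (h \<cdot> x)" if "x \<in> Arr C" "Cod C x = S" for x
      using assoc[of x g "l i"] assoc[of x h "l j"] that gh Ld(2)[OF ij(1)] Ld(2)[OF ij(2)] eq by simp
    obtain k1 where k1: "k1 \<in> I" "lq i k1" "lq j k1" "d i k1 \<cdot> (g \<cdot> a) = d j k1 \<cdot> (h \<cdot> a)"
      using fA(2)[OF ij, of "g \<cdot> a" "h \<cdot> a"] gh bi lx[of a] by auto
    obtain k2 where k2: "k2 \<in> I" "lq i k2" "lq j k2" "d i k2 \<cdot> (g \<cdot> b) = d j k2 \<cdot> (h \<cdot> b)"
      using fB(2)[OF ij, of "g \<cdot> b" "h \<cdot> b"] gh bi lx[of b] by auto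
    obtain k where k: "k \<in> I" "lq k1 k" "lq k2 k" using dir(4)[OF k1(1) k2(1)] by blast
    have ik: "lq i k" and jk: "lq j k"
      using dir(3)[OF ij(1) k1(1) k(1)] dir(3)[OF ij(2) k1(1) k(1)] k1 k by auto
    note dik = s(3)[OF ij(1) k(1) ik] and djk = s(3)[OF ij(2) k(1) jk]
    \<comment> \<open>An equality at stage \<open>m\<close> persists at the later stage
      \<open>k\<close>; this brings the agreements on both summands to a common stage.\<close>
    have up: "d i k \<cdot> (g \<cdot> x) = d j k \<cdot> (h \<cdot> x)"
      if x: "x \<in> Arr C" "Cod C x = S" and m: "m \<in> I" "lq i m" "lq j m" "lq m k"
        "d i m \<cdot> (g \<cdot> x) = d j m \<cdot> (h \<cdot> x)" for x m
    proof -
      note im = s(3)[OF ij(1) m(1,2)] and jm = s(3)[OF ij(2) m(1,3)] and mk = s(3)[OF m(1) k(1) m(4)]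
      have "d i k \<cdot> (g \<cdot> x) = d m k \<cdot> (d i m \<cdot> (g \<cdot> x))"
        unfolding s(5)[OF ij(1) m(1) k(1) m(2,4), symmetric] using im mk gh x by simp
      also have "\<dots> = d j k \<cdot> (h \<cdot> x)"
        unfolding m(5) s(5)[OF ij(2) m(1) k(1) m(3,4), symmetric] using jm mk gh x by simp
      finally show ?thesis .
    qed
    have ea: "d i k \<cdot> (g \<cdot> a) = d j k \<cdot> (h \<cdot> a)"
      by (rule up[of a k1]) (use bi k1 k in auto)
    have eb: "d i k \<cdot> (g \<cdot> b) = d j k \<cdot> (h \<cdot> b)"
      by (rule up[of b k2]) (use bi k2 k in auto)
    have ga: "(d i k \<cdot> g) \<cdot> a = (d j k \<cdot> h) \<cdot> a" using ea dik djk gh bi by simp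
    have gb: "(d i k \<cdot> g) \<cdot> b = (d j k \<cdot> h) \<cdot> b" using eb dik djk gh bi by simp
    have "d i k \<cdot> g = Add C (((d i k \<cdot> g) \<cdot> a) \<cdot> p) (((d i k \<cdot> g) \<cdot> b) \<cdot> q)"
      by (rule split) (use dik gh in auto)
    also have "\<dots> = d j k \<cdot> h" unfolding ga gb
      by (rule split[symmetric]) (use djk gh in auto)
    finally show "\<exists>k \<in> I. lq i k \<and> lq j k \<and> d i k \<cdot> g = d j k \<cdot> h" using k(1) ik jk by blast
  }
qed

lemma Hom_trivial_isomorphic:
  assumes "isomorphic C E E'" "A \<in> Ob C" "Hom C A E = {Zero C A E}"
  shows "Hom C A E' = {Zero C A E'}"
proof -
  obtain f g where fg: "f \<in> Hom C E E'" "g \<in> Hom C E' E" "monic C g"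
    using isomorphicE[OF assms(1)] by metis
  have "nul h" if h: "h \<in> Hom C A E'" for h
  proof -
    have "nul (g \<cdot> h)" by (rule Hom_trivialD[OF assms(3)]) (use fg h in auto)
    then show ?thesis by (rule monicD[OF fg(3), rotated -1]) (use fg h in auto)
  qed
  moreover have "E' \<in> Ob C" using fg by auto
  ultimately show ?thesis using Hom_trivial_iff[OF assms(2)] by blast
qed

text \<open>Vanishing of all arrows from \<open>A\<close> is invariant under isomorphism of the
  target, so it can be tested on any representative.\<close>

lemma iso_class_in_InjSpec_basic_iff:
  assumes "E \<in> indec_injectives C" "A \<in> Ob C"
  shows "iso_class C E \<in> InjSpec_basic C A \<longleftrightarrow> Hom C A E = {Zero C A E}"
proof
  assume "iso_class C E \<in> InjSpec_basic C A"
  then obtain E' where E': "E' \<in> indec_injectives C" "Hom C A E' = {Zero C A E'}" "iso_class C E = iso_class C E'"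
    by (auto simp: InjSpec_basic_def)
  have "isomorphic C E' E"
    using iso_class_eq_iff[of E' E] assms(1) E'(1,3) by (auto simp: indec_injectives_def injective_object_def)
  then show "Hom C A E = {Zero C A E}" by (rule Hom_trivial_isomorphic[OF _ assms(2) E'(2)])
qed (use assms in \<open>auto simp: InjSpec_basic_def simp del: Hom_iff\<close>)

lemma InjSpec_basic_biproduct:
  assumes "is_biproduct C A B S"
  shows "InjSpec_basic C S = InjSpec_basic C A \<inter> InjSpec_basic C B"
proof -
  obtain a b p q where bi: "a \<in> Hom C A S" "b \<in> Hom C B S" "p \<in> Hom C S A" "q \<in> Hom C S B"
    and id: "p \<cdot> a = Ident C A" "q \<cdot> b = Ident C B" and sum: "Add C (a \<cdot> p) (b \<cdot> q) = Ident C S"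
    using assms by (rule is_biproductE)
  have ob: "A \<in> Ob C" "B \<in> Ob C" "S \<in> Ob C" using bi by auto
  have "Hom C S E = {Zero C S E} \<longleftrightarrow> Hom C A E = {Zero C A E} \<and> Hom C B E = {Zero C B E}"
    if E: "E \<in> Ob C" for E
  proof (intro iffI conjI)
    assume z: "Hom C S E = {Zero C S E}"
    have "nul f" if f: "f \<in> Hom C A E" for f
    proof -
      have "nul (f \<cdot> p)" by (rule Hom_trivialD[OF z]) (use f bi in auto)
      then have "nul ((f \<cdot> p) \<cdot> a)" by (rule nul_Comp_right[rotated -1]) (use f bi in auto)
      then show ?thesis using f bi id by simp
    qed
    then show "Hom C A E = {Zero C A E}" using Hom_trivial_iff[OF ob(1) E] by blast
    have "nul f" if f: "f \<in> Hom C B E" for f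
    proof -
      have "nul (f \<cdot> q)" by (rule Hom_trivialD[OF z]) (use f bi in auto)
      then have "nul ((f \<cdot> q) \<cdot> b)" by (rule nul_Comp_right[rotated -1]) (use f bi in auto)
      then show ?thesis using f bi id by simp
    qed
    then show "Hom C B E = {Zero C B E}" using Hom_trivial_iff[OF ob(2) E] by blast
  next
    assume z: "Hom C A E = {Zero C A E} \<and> Hom C B E = {Zero C B E}"
    have "nul f" if f: "f \<in> Hom C S E" for f
    proof -
      have "nul (f \<cdot> a)" by (rule Hom_trivialD[OF z[THEN conjunct1]]) (use f bi in auto)
      then have fa: "f \<cdot> a = Zero C A E" using nulD f bi by simp
      have "nul (f \<cdot> b)" by (rule Hom_trivialD[OF z[THEN conjunct2]]) (use f bi in auto)
      then have fb: "f \<cdot> b = Zero C B E" using nulD f bi by simp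
      have "f = f \<cdot> Add C (a \<cdot> p) (b \<cdot> q)" using f sum by simp
      also have "\<dots> = Add C ((f \<cdot> a) \<cdot> p) ((f \<cdot> b) \<cdot> q)" using f bi by simp
      also have "\<dots> = Zero C S E" unfolding fa fb using bi ob E by simp
      finally show ?thesis using ob E by simp
    qed
    then show "Hom C S E = {Zero C S E}" using Hom_trivial_iff[OF ob(3) E] by blast
  qed
  then have mem: "iso_class C E \<in> InjSpec_basic C S \<longleftrightarrow>
      iso_class C E \<in> InjSpec_basic C A \<and> iso_class C E \<in> InjSpec_basic C B"
    if "E \<in> indec_injectives C" for E
    using iso_class_in_InjSpec_basic_iff[OF that] ob that
    by (simp add: indec_injectives_def injective_object_def)
  have sub: "\<exists>E \<in> indec_injectives C. c = iso_class C E" if "c \<in> InjSpec_basic C X" for c X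
    using that by (auto simp: InjSpec_basic_def)
  show ?thesis using mem sub by (intro equalityI subsetI) (metis Int_iff)+
qed

end

context noetherian_generators
begin

lemma InjSpec_homeomorphic_TorSpec:
  "\<exists>\<Phi>. (\<forall>E \<in> indec_injectives C. \<Phi> (iso_class C E) = gen_torsionfree C E) \<and>
    homeomorphic_map (InjSpec U C) (TorSpec U C) \<Phi>"
proof -
  have Ob: "E \<in> Ob C" and inj: "injective_object C E" if "E \<in> indec_injectives C" for E
    using that by (auto simp: indec_injectives_def injective_object_def)
  \<comment> \<open>A representative of the class is chosen; the value does not depend on it, by
    \<open>gen_torsionfree_isomorphic\<close>.\<close>
  define \<Phi> where "\<Phi> c = gen_torsionfree C (SOME E. E \<in> indec_injectives C \<and> iso_class C E = c)" for c
  have \<Phi>: "\<Phi> (iso_class C E) = gen_torsionfree C E" if E: "E \<in> indec_injectives C" for E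
  proof -
    let ?E = "SOME E'. E' \<in> indec_injectives C \<and> iso_class C E' = iso_class C E"
    have "?E \<in> indec_injectives C \<and> iso_class C ?E = iso_class C E"
      by (rule someI[of _ E]) (use E in auto)
    then show ?thesis
      unfolding \<Phi>_def using gen_torsionfree_isomorphic iso_class_eq_iff[of ?E E] Ob E by blast
  qed
  have basic: "TorSpec_basic C (gen_torsion C A) = \<Phi> ` InjSpec_basic C A" if A: "A \<in> Ob C" for A
  proof -
    have iff: "gen_torsionfree C E \<in> TorSpec_basic C (gen_torsion C A) \<longleftrightarrow> Hom C A E = {Zero C A E}"
      if E: "E \<in> indec_injectives C" for E
      using gen_torsionfree_prime[OF E] torsion_of_injective[OF inj[OF E]]
        gen_torsion_subset_iff[OF injective_torsion_theory[OF inj[OF E]], of A]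
        tors_iff_Hom_trivial[OF A Ob[OF E]]
      by (simp add: TorSpec_basic_def)
    show ?thesis
    proof (intro equalityI subsetI)
      fix F assume F: "F \<in> TorSpec_basic C (gen_torsion C A)"
      then have "F \<in> prime_torsion_theories C" by (simp add: TorSpec_basic_def)
      then obtain E where E: "E \<in> indec_injectives C" "F = gen_torsionfree C E"
        by (rule prime_imp_gen_torsionfree)
      then have "iso_class C E \<in> InjSpec_basic C A"
        using iff F iso_class_in_InjSpec_basic_iff[OF E(1) A] by simp
      then show "F \<in> \<Phi> ` InjSpec_basic C A" using \<Phi>[OF E(1)] E(2) by (metis imageI)
    next
      fix F assume "F \<in> \<Phi> ` InjSpec_basic C A"
      then obtain E where E: "E \<in> indec_injectives C" "Hom C A E = {Zero C A E}" "F = \<Phi> (iso_class C E)"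
        by (auto simp: InjSpec_basic_def)
      then show "F \<in> TorSpec_basic C (gen_torsion C A)" using iff[OF E(1)] \<Phi>[OF E(1)] by simp
    qed
  qed
  have fpOb: "A \<in> Ob C" if "finitely_presented U C A" for A
    using that by (simp add: finitely_presented_def)
  have "homeomorphic_map (InjSpec U C) (TorSpec U C) \<Phi>"
    unfolding InjSpec_def TorSpec_def
  proof (rule homeomorphic_map_base)
    fix S T assume "\<exists>A. finitely_presented U C A \<and> S = InjSpec_basic C A"
      "\<exists>A. finitely_presented U C A \<and> T = InjSpec_basic C A"
    then obtain A B where AB: "finitely_presented U C A" "S = InjSpec_basic C A"
      "finitely_presented U C B" "T = InjSpec_basic C B" by blast
    obtain D where D: "is_biproduct C A B D" using ex_biproduct fpOb AB by blast
    then show "\<exists>A. finitely_presented U C A \<and> S \<inter> T = InjSpec_basic C A"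
      using finitely_presented_biproduct[OF AB(1,3)] InjSpec_basic_biproduct AB by blast
  next
    fix V
    show "(\<exists>A. finitely_presented U C A \<and> V = TorSpec_basic C (gen_torsion C A)) \<longleftrightarrow>
      (\<exists>S. (\<exists>A. finitely_presented U C A \<and> S = InjSpec_basic C A) \<and> V = \<Phi> ` S)"
      using basic fpOb by blast
  next
    show "inj_on \<Phi> (\<Union>{V. \<exists>A. finitely_presented U C A \<and> V = InjSpec_basic C A})"
    proof (rule inj_onI)
      fix c c' assume "c \<in> \<Union>{V. \<exists>A. finitely_presented U C A \<and> V = InjSpec_basic C A}"
        "c' \<in> \<Union>{V. \<exists>A. finitely_presented U C A \<and> V = InjSpec_basic C A}" and eq: "\<Phi> c = \<Phi> c'"
      then obtain E E' where E: "E \<in> indec_injectives C" "c = iso_class C E"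
        and E': "E' \<in> indec_injectives C" "c' = iso_class C E'"
        by (auto simp: InjSpec_basic_def)
      have "gen_torsionfree C E = gen_torsionfree C E'" using eq E E' \<Phi> by simp
      then have "isomorphic C E E'" by (rule isomorphic_if_gen_torsionfree_eq[OF E(1) E'(1)])
      then show "c = c'" using iso_class_eq_iff E E' Ob by simp
    qed
  qed
  then show ?thesis using \<Phi> by blast
qed

end

theorem theorem3p3:
  fixes C :: "('o, 'm) category"
  assumes "universe_type TYPE('u)"
    and "locally_noetherian TYPE('u) C"
  shows "\<exists>\<Phi>. (\<forall>E \<in> indec_injectives C. \<Phi> (iso_class C E) = gen_torsionfree C E) \<and>
    homeomorphic_map (InjSpec TYPE('u) C) (TorSpec TYPE('u) C) \<Phi>"
proof -
  have g: "grothendieck_category TYPE('u) C" using assms(2) by (simp add: locally_noetherian_def)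
  obtain H where H: "small TYPE('u) H" "generating C H"
    "\<And>X A. \<lbrakk>X \<in> H; A \<in> Ob C\<rbrakk> \<Longrightarrow> small TYPE('u) (Hom C X A)"
    using g unfolding grothendieck_category_def by blast
  obtain G where G: "small TYPE('u) G" "generating C G" "\<And>X. X \<in> G \<Longrightarrow> noetherian_object C X"
    using assms(2) unfolding locally_noetherian_def by blast
  interpret abelian_category C using g by (simp add: grothendieck_category_def)
  interpret grothendieck C "TYPE('u)"
    by unfold_locales (use g assms(1) in \<open>simp_all add: grothendieck_category_def\<close>)
  \<comment> \<open>\<open>H\<close> serves only to bound the sets of arrows out of noetherian
    objects; with this bound the noetherian generating set \<open>G\<close> satisfies the second
    locale.\<close>
  interpret H: grothendieck_generators C "TYPE('u)" H
    by unfold_locales (use H in blast)+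
  interpret noetherian_generators C "TYPE('u)" G
    by unfold_locales (use G H.small_Hom_noetherian in blast)+
  show ?thesis by (rule InjSpec_homeomorphic_TorSpec)
qed

end
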